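(* Let $G\in\mathcal F_5$. If $G$ has an induced subgraph isomorphic to the double diamond, then either one of $G,\overline G$ admits a 2-join, or $G$ admits a balanced skew partition.
   Context: Graphs are finite and simple; Berge: all holes (induced cycles of length $\ge4$) and antiholes (induced subgraphs whose complement is a hole) are even. Paths are induced subgraphs that are paths; antipaths induced subgraphs whose complement is a path; length counts edges. A prism consists of two vertex-disjoint triangles $\{a_1,a_2,a_3\},\{b_1,b_2,b_3\}$ and paths $P_i$ from $a_i$ to $b_i$ ($i=1,2,3$) with the only edges between $V(P_i),V(P_j)$ ($i\neq j$) being $a_ia_j,b_ib_j$; it is long if some $P_i$ has length $>1$. $\mathcal F_5$ is the class of Berge graphs $G$ such that for every bipartite subdivision $H$ of $K_4$ (each edge replaced by an internally disjoint path) neither $G$ nor $\overline G$ has an induced subgraph isomorphic to the line graph $L(H)$, and neither $G$ nor $\overline G$ has an induced subgraph that is a long prism. The double diamond is the graph on $a_1,\dots,a_4,b_1,\dots,b_4$ in which every two $a_i$ are adjacent except $a_3a_4$, every two $b_i$ are adjacent except $b_3b_4$, $a_ib_i$ is an edge for each $i$, and there are no other edges. 2-join: partition $(X_1,X_2)$ of $V(G)$ with disjoint nonempty $A_i,B_i\subseteq X_i$, $A_1$ complete to $A_2$, $B_1$ complete to $B_2$, no other edges between $X_1,X_2$, each component of $G|X_i$ meeting $A_i$ and $B_i$, and if $|A_i|=|B_i|=1$ and $G|X_i$ is a path joining them then it has length $\ge3$. Skew partition: partition $(A,B)$ of $V(G)$ with $G|A$ disconnected, $\overline G|B$ disconnected;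 balanced if there is no odd path between nonadjacent vertices of $B$ with interior in $A$ and no odd antipath between adjacent vertices of $A$ with interior in $B$. *)

theory Defs
  imports Main
begin

definition graph :: "'a set \<Rightarrow> ('a \<Rightarrow> 'a \<Rightarrow> bool) \<Rightarrow> bool" where
  "graph V E \<longleftrightarrow> finite V \<and> (\<forall>x y. E x y \<longrightarrow> x \<in> V \<and> y \<in> V \<and> x \<noteq> y \<and> E y x)"

definition compl :: "'a set \<Rightarrow> ('a \<Rightarrow> 'a \<Rightarrow> bool) \<Rightarrow> 'a \<Rightarrow> 'a \<Rightarrow> bool" where
  "compl V E x y \<longleftrightarrow> x \<in> V \<and> y \<in> V \<and> x \<noteq> y \<and> \<not> E x y"

definition embeds :: "'a set \<Rightarrow> ('a \<Rightarrow> 'a \<Rightarrow> bool) \<Rightarrow> 'b set \<Rightarrow> ('b \<Rightarrow> 'b \<Rightarrow> bool) \<Rightarrow> bool" where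
  "embeds V E V' E' \<longleftrightarrow> (\<exists>f. inj_on f V' \<and> f ` V' \<subseteq> V \<and>
      (\<forall>x\<in>V'. \<forall>y\<in>V'. E (f x) (f y) \<longleftrightarrow> E' x y))"

definition hole :: "'a set \<Rightarrow> ('a \<Rightarrow> 'a \<Rightarrow> bool) \<Rightarrow> 'a list \<Rightarrow> bool" where
  "hole V E vs \<longleftrightarrow> distinct vs \<and> set vs \<subseteq> V \<and> length vs \<ge> 4 \<and>
     (\<forall>i<length vs. \<forall>j<length vs. E (vs!i) (vs!j) \<longleftrightarrow>
        (j = Suc i mod length vs \<or> i = Suc j mod length vs))"

definition berge :: "'a set \<Rightarrow> ('a \<Rightarrow> 'a \<Rightarrow> bool) \<Rightarrow> bool" where
  "berge V E \<longleftrightarrow> (\<forall>vs. hole V E vs \<longrightarrow> even (length vs)) \<and>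
                  (\<forall>vs. hole V (compl V E) vs \<longrightarrow> even (length vs))"

text \<open>Induced path v_0 ... v_n (its length is n = length vs - 1).
  An antipath is an induced path of the complement.\<close>
definition ipath :: "'a set \<Rightarrow> ('a \<Rightarrow> 'a \<Rightarrow> bool) \<Rightarrow> 'a list \<Rightarrow> bool" where
  "ipath V E vs \<longleftrightarrow> vs \<noteq> [] \<and> distinct vs \<and> set vs \<subseteq> V \<and>
     (\<forall>i<length vs. \<forall>j<length vs. E (vs!i) (vs!j) \<longleftrightarrow> (i = Suc j \<or> j = Suc i))"

definition has_long_prism :: "'a set \<Rightarrow> ('a \<Rightarrow> 'a \<Rightarrow> bool) \<Rightarrow> bool" where
  "has_long_prism V E \<longleftrightarrow> (\<exists>P :: nat \<Rightarrow> 'a list.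
     (\<forall>i<3. ipath V E (P i) \<and> length (P i) \<ge> 2) \<and>
     (\<forall>i<3. \<forall>j<3. i \<noteq> j \<longrightarrow> set (P i) \<inter> set (P j) = {} \<and>
        (\<forall>x\<in>set (P i). \<forall>y\<in>set (P j). E x y \<longleftrightarrow>
           ((x = hd (P i) \<and> y = hd (P j)) \<or> (x = last (P i) \<and> y = last (P j))))) \<and>
     (\<exists>i<3. length (P i) > 2))"

text \<open>H = (VH,EH) is a subdivision of K4: branch vertices b 0..b 3, and for
  i < j < 4 a path P i j from b i to b j; the paths are internally disjoint and
  H is exactly their union.  Vertices of H are labelled by naturals (any finite
  graph is isomorphic to one on nat).\<close>
definition subdiv_K4 :: "nat set \<Rightarrow> (nat \<Rightarrow> nat \<Rightarrow> bool) \<Rightarrow> bool" where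
  "subdiv_K4 VH EH \<longleftrightarrow> (\<exists>(b :: nat \<Rightarrow> nat) (P :: nat \<Rightarrow> nat \<Rightarrow> nat list).
     inj_on b {..<4} \<and>
     (\<forall>i j. i < j \<and> j < 4 \<longrightarrow> distinct (P i j) \<and> length (P i j) \<ge> 2 \<and>
        hd (P i j) = b i \<and> last (P i j) = b j \<and>
        (\<forall>x\<in>set (P i j). x \<in> b ` {..<4} \<longrightarrow> x = b i \<or> x = b j)) \<and>
     (\<forall>i j k l. i < j \<and> j < 4 \<and> k < l \<and> l < 4 \<and> (i, j) \<noteq> (k, l) \<longrightarrow>
        set (P i j) \<inter> set (P k l) \<subseteq> b ` {..<4}) \<and>
     VH = (\<Union>i<4. \<Union>j\<in>{i<..<4}. set (P i j)) \<and>
     (\<forall>x y. EH x y \<longleftrightarrow> (\<exists>i j k. i < j \<and> j < 4 \<and> Suc k < length (P i j) \<and>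
        {x, y} = {P i j ! k, P i j ! Suc k})))"

definition bipartite :: "'b set \<Rightarrow> ('b \<Rightarrow> 'b \<Rightarrow> bool) \<Rightarrow> bool" where
  "bipartite VH EH \<longleftrightarrow> (\<exists>c :: 'b \<Rightarrow> bool. \<forall>x\<in>VH. \<forall>y\<in>VH. EH x y \<longrightarrow> c x \<noteq> c y)"

definition lineV :: "('b \<Rightarrow> 'b \<Rightarrow> bool) \<Rightarrow> 'b set set" where
  "lineV EH = {{x, y} | x y. EH x y}"

definition lineE :: "('b \<Rightarrow> 'b \<Rightarrow> bool) \<Rightarrow> 'b set \<Rightarrow> 'b set \<Rightarrow> bool" where
  "lineE EH e f \<longleftrightarrow> e \<in> lineV EH \<and> f \<in> lineV EH \<and> e \<noteq> f \<and> e \<inter> f \<noteq> {}"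

definition F5 :: "'a set \<Rightarrow> ('a \<Rightarrow> 'a \<Rightarrow> bool) \<Rightarrow> bool" where
  "F5 V E \<longleftrightarrow> berge V E \<and>
     (\<forall>(VH :: nat set) EH. subdiv_K4 VH EH \<and> bipartite VH EH \<longrightarrow>
        \<not> embeds V E (lineV EH) (lineE EH) \<and>
        \<not> embeds V (compl V E) (lineV EH) (lineE EH)) \<and>
     \<not> has_long_prism V E \<and> \<not> has_long_prism V (compl V E)"

text \<open>Double diamond on {0..7}: a_1..a_4 = 0..3, b_1..b_4 = 4..7.\<close>
definition dd_E :: "nat \<Rightarrow> nat \<Rightarrow> bool" where
  "dd_E x y \<longleftrightarrow> x < 8 \<and> y < 8 \<and> x \<noteq> y \<and>
     ((x < 4 \<and> y < 4 \<and> {x, y} \<noteq> {2, 3}) \<or>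
      (4 \<le> x \<and> 4 \<le> y \<and> {x, y} \<noteq> {6, 7}) \<or>
      y = x + 4 \<or> x = y + 4)"

definition reach :: "'a set \<Rightarrow> ('a \<Rightarrow> 'a \<Rightarrow> bool) \<Rightarrow> 'a \<Rightarrow> 'a \<Rightarrow> bool" where
  "reach X E = (\<lambda>u v. u \<in> X \<and> v \<in> X \<and> E u v)\<^sup>*\<^sup>*"

definition disconnected :: "'a set \<Rightarrow> ('a \<Rightarrow> 'a \<Rightarrow> bool) \<Rightarrow> bool" where
  "disconnected X E \<longleftrightarrow> (\<exists>x\<in>X. \<exists>y\<in>X. \<not> reach X E x y)"

definition two_join_side :: "'a set \<Rightarrow> ('a \<Rightarrow> 'a \<Rightarrow> bool) \<Rightarrow> 'a set \<Rightarrow> 'a set \<Rightarrow> 'a set \<Rightarrow> bool" where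
  "two_join_side V E X A B \<longleftrightarrow> A \<noteq> {} \<and> B \<noteq> {} \<and> A \<subseteq> X \<and> B \<subseteq> X \<and> A \<inter> B = {} \<and>
     (\<forall>x\<in>X. (\<exists>a\<in>A. reach X E x a) \<and> (\<exists>b\<in>B. reach X E x b)) \<and>
     (\<forall>a b vs. A = {a} \<and> B = {b} \<and> ipath V E vs \<and> set vs = X \<and> hd vs = a \<and> last vs = b
        \<longrightarrow> length vs \<ge> 4)"

definition two_join :: "'a set \<Rightarrow> ('a \<Rightarrow> 'a \<Rightarrow> bool) \<Rightarrow> bool" where
  "two_join V E \<longleftrightarrow> (\<exists>X1 X2 A1 B1 A2 B2.
     X1 \<union> X2 = V \<and> X1 \<inter> X2 = {} \<and>
     two_join_side V E X1 A1 B1 \<and> two_join_side V E X2 A2 B2 \<and>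
     (\<forall>x\<in>X1. \<forall>y\<in>X2. E x y \<longleftrightarrow> ((x \<in> A1 \<and> y \<in> A2) \<or> (x \<in> B1 \<and> y \<in> B2))))"

definition balanced_skew_partition :: "'a set \<Rightarrow> ('a \<Rightarrow> 'a \<Rightarrow> bool) \<Rightarrow> bool" where
  "balanced_skew_partition V E \<longleftrightarrow> (\<exists>A B.
     A \<union> B = V \<and> A \<inter> B = {} \<and>
     disconnected A E \<and> disconnected B (compl V E) \<and>
     \<not> (\<exists>vs. ipath V E vs \<and> odd (length vs - 1) \<and> hd vs \<in> B \<and> last vs \<in> B \<and>
            \<not> E (hd vs) (last vs) \<and> set (butlast (tl vs)) \<subseteq> A) \<and>
     \<not> (\<exists>vs. ipath V (compl V E) vs \<and> odd (length vs - 1) \<and> hd vs \<in> A \<and> last vs \<in> A \<and>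
            E (hd vs) (last vs) \<and> set (butlast (tl vs)) \<subseteq> B))"

end

theory Submission
  imports Defs
begin

text \<open>
  Call \<open>(A, B)\<close> square-connected if induced 4-cycles \<open>a1 a2 b2 b1\<close> with \<open>a1 a2\<close> in \<open>A\<close> and \<open>b2 b1\<close> in \<open>B\<close> link up all of
  \<open>A\<close> and all of \<open>B\<close>. The double diamond contains disjoint sets \<open>A, B, C, D\<close> such that \<open>(A, B)\<close> is square-connected
  in \<open>E\<close>, \<open>(C, D)\<close> is square-connected in the complement, \<open>A\<close>-\<open>C\<close> and \<open>B\<close>-\<open>D\<close> are complete and \<open>A\<close>-\<open>D\<close> and
  \<open>B\<close>-\<open>C\<close> anticomplete; take such sets with the union \<open>K\<close> as large as possible. If \<open>K\<close> is everything, then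
  \<open>(A \<union> B, C \<union> D)\<close> is a 2-join.

  Since there is no induced 5-cycle, each vertex outside \<open>K\<close> is minor (its neighbours in \<open>L = A \<union> C\<close> are complete to
  those in \<open>R = B \<union> D\<close>) or minor with respect to the configuration \<open>(C, D, B, A)\<close> of the complement; any other
  attachment would enlarge \<open>K\<close>. A connected set of minor vertices behaves in the same way as a single one: an
  induced path violating this yields, together with a double diamond, an odd hole, a long prism, the line graph of
  \<open>K\<^sub>3\<^sub>,\<^sub>3\<close> minus an edge, or a pair of vertices enlarging \<open>K\<close>. Hence the attachments of a component of the
  minor vertices give a skew partition. It can be made balanced because it is loose or because the
  Roussel-Rubio lemma excludes the bad paths.
\<close>

text \<open>Complementation turns a configuration \<open>(A, B, C, D)\<close> into
  \<open>(C, D, B, A)\<close> and preserves the hypotheses and the conclusion. So whatever is shown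
  for minor vertices also holds for vertices minor in the complement, and a single vertex outside
  \<open>K\<close>, minor in one of the two graphs, is enough for a skew partition. The obstacle is
  that holes, prisms and line graphs do not dispose of all bad connected sets: two adjacent vertices
  attached in parallel to the two halves of a diamond survive. They have the shape of a new rung of
  the configuration, so only maximality can remove them, and for this their attachment has to be
  carried from one diamond to all diamonds along squares. Balance concerns odd paths of every
  length, while a diamond controls only short pieces. The Roussel-Rubio lemma bridges this: an odd
  path whose ends are complete to an anticonnected set with no complete interior vertex yields an
  odd antipath through the set or an odd path with the same interior and ends in the set. Used in
  both graphs, it lets the path half and the antipath half of balance support each other.\<close>

abbreviation conn :: "'a set \<Rightarrow> ('a \<Rightarrow> 'a \<Rightarrow> bool) \<Rightarrow> bool" where
  "conn S E \<equiv> \<not> disconnected S E"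

lemma graph_sym: "graph V E \<Longrightarrow> E x y \<Longrightarrow> E y x"
  and graph_in1: "graph V E \<Longrightarrow> E x y \<Longrightarrow> x \<in> V"
  and graph_in2: "graph V E \<Longrightarrow> E x y \<Longrightarrow> y \<in> V"
  and graph_neq: "graph V E \<Longrightarrow> E x y \<Longrightarrow> x \<noteq> y"
  and graph_irrefl: "graph V E \<Longrightarrow> \<not> E x x"
  and graph_finite: "graph V E \<Longrightarrow> finite V"
  by (auto simp: graph_def)

lemma graph_sym_iff: "graph V E \<Longrightarrow> E x y \<longleftrightarrow> E y x"
  by (auto simp: graph_def)

lemma compl_iff: "x \<in> V \<Longrightarrow> y \<in> V \<Longrightarrow> compl V E x y \<longleftrightarrow> x \<noteq> y \<and> \<not> E x y"
  by (simp add: compl_def)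

lemma graph_compl: "graph V E \<Longrightarrow> graph V (compl V E)"
  by (auto simp: graph_def compl_def)

lemma compl_compl: "graph V E \<Longrightarrow> compl V (compl V E) = E"
  by (auto simp: graph_def compl_def fun_eq_iff)

lemma berge_compl: "graph V E \<Longrightarrow> berge V E \<Longrightarrow> berge V (compl V E)"
  by (auto simp: berge_def compl_compl)

lemma F5_compl: "graph V E \<Longrightarrow> F5 V E \<Longrightarrow> F5 V (compl V E)"
  by (auto simp: F5_def berge_compl compl_compl)

section \<open>Connectivity expressed by edges that leave every proper nonempty subset\<close>

lemma conn_iff:
  assumes "graph V E"
  shows "conn S E \<longleftrightarrow> (\<forall>U\<subseteq>S. U \<noteq> {} \<and> U \<noteq> S \<longrightarrow> (\<exists>u\<in>U. \<exists>w\<in>S - U. E u w))"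
proof
  assume c: "conn S E"
  show "\<forall>U\<subseteq>S. U \<noteq> {} \<and> U \<noteq> S \<longrightarrow> (\<exists>u\<in>U. \<exists>w\<in>S - U. E u w)"
  proof (intro allI impI)
    fix U assume U: "U \<subseteq> S" "U \<noteq> {} \<and> U \<noteq> S"
    then obtain x y where xy: "x \<in> U" "y \<in> S - U" by blast
    then have "reach S E x y" using c U unfolding disconnected_def by blast
    then have "y \<in> U \<or> (\<exists>u\<in>U. \<exists>w\<in>S - U. E u w)"
      unfolding reach_def
      by (induction rule: rtranclp_induct) (use xy in auto)
    then show "\<exists>u\<in>U. \<exists>w\<in>S - U. E u w" using xy by blast
  qed
next
  assume h: "\<forall>U\<subseteq>S. U \<noteq> {} \<and> U \<noteq> S \<longrightarrow> (\<exists>u\<in>U. \<exists>w\<in>S - U. E u w)"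
  show "conn S E"
    unfolding disconnected_def
  proof (intro notI, elim bexE)
    fix x y assume xy: "x \<in> S" "y \<in> S" "\<not> reach S E x y"
    define U where "U = {z\<in>S. reach S E x z}"
    have "x \<in> U" using xy by (simp add: U_def reach_def)
    moreover have "y \<notin> U" using xy by (simp add: U_def)
    moreover have "U \<subseteq> S" by (auto simp: U_def)
    ultimately obtain u w where uw: "u \<in> U" "w \<in> S - U" "E u w" using h xy by blast
    then have "reach S E x u" "u \<in> S" by (auto simp: U_def)
    then have "reach S E x w" using uw unfolding reach_def
      by (intro rtranclp.rtrancl_into_rtrancl[of _ x u w]) auto
    then show False using uw by (auto simp: U_def)
  qed
qed

lemma conn_cross:
  assumes "graph V E" "conn S E" "u \<in> S" "Q u" "w \<in> S" "\<not> Q w"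
  shows "\<exists>u\<in>S. \<exists>w\<in>S. Q u \<and> \<not> Q w \<and> E u w"
proof -
  have "\<exists>u\<in>{u\<in>S. Q u}. \<exists>w\<in>S - {u\<in>S. Q u}. E u w"
    using assms(2) unfolding conn_iff[OF assms(1)] by (rule allE[of _ "{u\<in>S. Q u}"]) (use assms in blast)
  then show ?thesis by blast
qed

lemma conn_union_cases:
  assumes "graph V E" "conn S E" "S \<subseteq> A \<union> B" "A \<inter> B = {}" "\<And>x y. x \<in> A \<Longrightarrow> y \<in> B \<Longrightarrow> \<not> E x y"
  shows "S \<subseteq> A \<or> S \<subseteq> B"
proof (rule ccontr)
  assume "\<not> (S \<subseteq> A \<or> S \<subseteq> B)"
  then obtain u w where "u \<in> S" "u \<in> A" "w \<in> S" "w \<notin> A" using assms(3) by blast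
  from conn_cross[OF assms(1,2), of u "\<lambda>z. z \<in> A" w] this assms show False by blast
qed

lemma conn_insert:
  assumes "graph V E" "conn S E" "u \<in> S" "E u z"
  shows "conn (insert z S) E"
  unfolding conn_iff[OF assms(1)]
proof (intro allI impI)
  fix U assume U: "U \<subseteq> insert z S" "U \<noteq> {} \<and> U \<noteq> insert z S"
  have ez: "E z u" using assms(1,4) by (rule graph_sym)
  show "\<exists>u\<in>U. \<exists>w\<in>insert z S - U. E u w"
  proof (cases "U \<inter> S = {}")
    case True
    then have "U = {z}" "u \<notin> U" using U assms by auto
    then show ?thesis using assms ez by auto
  next
    case False
    show ?thesis
    proof (cases "S \<subseteq> U")
      case True
      then have "z \<notin> U" using U by auto
      then show ?thesis using assms True by auto
    next
      case F: False
      obtain p q where "p \<in> S" "p \<in> U" "q \<in> S" "q \<notin> U" using False F by blast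
      then have "\<exists>u\<in>S. \<exists>w\<in>S. u \<in> U \<and> w \<notin> U \<and> E u w"
        by (intro conn_cross[OF assms(1,2)])
      then show ?thesis by blast
    qed
  qed
qed

lemma conn_singleton: "conn {x} E"
  by (simp add: disconnected_def reach_def)

text \<open>\<open>R\<close> grows along edges leaving it and stays connected; the vertex that would
  be added last is not a cut vertex. In the complement, a single vertex as \<open>R\<close> gives a
  vertex whose removal keeps a set anticonnected, and an antipath as \<open>R\<close> gives such a
  vertex off the antipath.\<close>

lemma conn_noncut:
  assumes g: "graph V E" and fin: "finite T" and c: "conn T E" and R: "R \<subset> T" "R \<noteq> {}" "conn R E"
  shows "\<exists>z\<in>T - R. conn (T - {z}) E"
  using R
proof (induction "card (T - R)" arbitrary: R rule: less_induct)
  case less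
  obtain u w where uw: "u \<in> R" "w \<in> T - R" "E u w"
  proof -
    obtain p q where "p \<in> R" "q \<in> T" "q \<notin> R" using less.prems by blast
    then show ?thesis using conn_cross[OF g c, of p "\<lambda>z. z \<in> R" q] less.prems that by blast
  qed
  have c': "conn (insert w R) E" using conn_insert[OF g less.prems(3) uw(1,3)] .
  show ?case
  proof (cases "insert w R = T")
    case True
    then have "T - {w} = R" using uw by auto
    then show ?thesis using uw less.prems by auto
  next
    case False
    have "card (T - insert w R) < card (T - R)"
      using fin uw by (intro psubset_card_mono) auto
    from less.hyps[OF this _ _ c'] show ?thesis using False uw less.prems by blast
  qed
qed

lemma conn_component:
  assumes g: "graph V E" and x: "x \<in> X"
  shows "\<exists>S. x \<in> S \<and> S \<subseteq> X \<and> conn S E \<and> (\<forall>u\<in>S. \<forall>w\<in>X - S. \<not> E u w)"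
proof -
  define S where "S = {z. reach X E x z}"
  have xS: "x \<in> S" by (simp add: S_def reach_def)
  have SX: "S \<subseteq> X"
  proof
    fix z assume "z \<in> S"
    then have "reach X E x z" by (simp add: S_def)
    then show "z \<in> X" unfolding reach_def by (induction rule: rtranclp_induct) (use x in auto)
  qed
  have cl: "\<not> E u w" if "u \<in> S" "w \<in> X - S" for u w
  proof
    assume "E u w"
    then have "reach X E x w" using that SX unfolding S_def reach_def
      by (auto intro: rtranclp.rtrancl_into_rtrancl)
    then show False using that by (simp add: S_def)
  qed
  have "conn S E"
    unfolding conn_iff[OF g]
  proof (intro allI impI, rule ccontr)
    fix U assume U: "U \<subseteq> S" "U \<noteq> {} \<and> U \<noteq> S" and n: "\<not> (\<exists>u\<in>U. \<exists>w\<in>S - U. E u w)"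
    have n': "\<not> E u w" if "u \<in> U" "w \<in> X - U" for u w
      using that n cl U by blast
    have n2: "\<not> E w u" if "u \<in> U" "w \<in> X - U" for u w
      using n'[OF that] graph_sym[OF g] by blast
    have "(x \<in> U \<longleftrightarrow> z \<in> U)" if "z \<in> S" for z
    proof -
      have "reach X E x z" using that by (simp add: S_def)
      then show ?thesis unfolding reach_def
        by (induction rule: rtranclp_induct) (use n' n2 in auto)
    qed
    then show False using U xS by blast
  qed
  then show ?thesis using xS SX cl by blast
qed

lemma disconnectedI:
  assumes "graph V E" "X \<union> Y = S" "x \<in> X" "y \<in> Y" "X \<inter> Y = {}" "\<And>u w. u \<in> X \<Longrightarrow> w \<in> Y \<Longrightarrow> \<not> E u w"
  shows "disconnected S E"
  using conn_union_cases[OF assms(1), of S X Y] assms by blast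

lemma disconnected_split:
  assumes "graph V E" "disconnected S E"
  shows "\<exists>X Y. X \<union> Y = S \<and> X \<inter> Y = {} \<and> X \<noteq> {} \<and> Y \<noteq> {} \<and> (\<forall>x\<in>X. \<forall>y\<in>Y. \<not> E x y)"
proof -
  from assms obtain U where "U \<subseteq> S" "U \<noteq> {}" "U \<noteq> S" "\<not> (\<exists>u\<in>U. \<exists>w\<in>S - U. E u w)"
    using conn_iff[OF assms(1), of S] by blast
  then show ?thesis by (intro exI[of _ U] exI[of _ "S - U"]) auto
qed

section \<open>Induced paths and holes\<close>

lemma ipath_Nil: "\<not> ipath V E []"
  by (simp add: ipath_def)

lemma ipath_single: "graph V E \<Longrightarrow> x \<in> V \<Longrightarrow> ipath V E [x]"
  by (auto simp: ipath_def graph_irrefl)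

text \<open>Turns the index-based definition into a recursion, so that short explicit paths reduce
  to finitely many adjacencies by rewriting.\<close>

lemma ipath_Cons:
  assumes g: "graph V E"
  shows "ipath V E (x # y # ys) \<longleftrightarrow>
    x \<in> V \<and> ipath V E (y # ys) \<and> x \<notin> set (y # ys) \<and> (\<forall>z\<in>set (y # ys). E x z \<longleftrightarrow> z = y)"
    (is "?L \<longleftrightarrow> ?R")
proof
  assume L: ?L
  let ?w = "x # y # ys"
  have e: "E (?w ! i) (?w ! j) \<longleftrightarrow> i = Suc j \<or> j = Suc i" if "i < length ?w" "j < length ?w" for i j
    using L that unfolding ipath_def by blast
  have d: "distinct ?w" "set ?w \<subseteq> V" using L unfolding ipath_def by auto
  have "E ((y # ys) ! i) ((y # ys) ! j) \<longleftrightarrow> i = Suc j \<or> j = Suc i"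
    if "i < length (y # ys)" "j < length (y # ys)" for i j
    using e[of "Suc i" "Suc j"] that by auto
  then have "ipath V E (y # ys)" using d unfolding ipath_def by auto
  moreover have "E x z \<longleftrightarrow> z = y" if z: "z \<in> set (y # ys)" for z
  proof -
    obtain j where j: "j < length (y # ys)" "z = (y # ys) ! j" using z by (metis in_set_conv_nth)
    have "E x z \<longleftrightarrow> j = 0" using e[of 0 "Suc j"] j by auto
    also have "\<dots> \<longleftrightarrow> z = y" using j d by (auto simp: nth_Cons')
    finally show ?thesis .
  qed
  ultimately show ?R using d by auto
next
  assume R: ?R
  let ?w = "x # y # ys"
  have p: "ipath V E (y # ys)" using R by blast
  have d: "distinct ?w" "set ?w \<subseteq> V" using R unfolding ipath_def by auto
  have e1: "E x ((y # ys) ! j) \<longleftrightarrow> j = 0" if "j < length (y # ys)" for j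
  proof -
    have "(y # ys) ! j \<in> set (y # ys)" using that by (rule nth_mem)
    moreover have "\<forall>z\<in>set (y # ys). E x z \<longleftrightarrow> z = y" using R by blast
    ultimately have "E x ((y # ys) ! j) \<longleftrightarrow> (y # ys) ! j = (y # ys) ! 0" by (simp only: nth_Cons_0)
    also have "\<dots> \<longleftrightarrow> j = 0" using d that by (subst nth_eq_iff_index_eq) auto
    finally show ?thesis .
  qed
  have "E (?w ! i) (?w ! j) \<longleftrightarrow> i = Suc j \<or> j = Suc i" if ij: "i < length ?w" "j < length ?w" for i j
  proof (cases i)
    case 0
    show ?thesis
    proof (cases j)
      case 0 then show ?thesis using \<open>i = 0\<close> graph_irrefl[OF g] by auto
    next
      case (Suc j') then show ?thesis using e1[of j'] \<open>i = 0\<close> ij by auto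
    qed
  next
    case (Suc i')
    show ?thesis
    proof (cases j)
      case 0 then show ?thesis using e1[of i'] \<open>i = Suc i'\<close> ij graph_sym_iff[OF g] by auto
    next
      case (Suc j') then show ?thesis using p \<open>i = Suc i'\<close> ij unfolding ipath_def by auto
    qed
  qed
  then show ?L using d unfolding ipath_def by auto
qed

lemma ipath_rev:
  assumes "graph V E" "ipath V E vs"
  shows "ipath V E (rev vs)"
proof -
  have "E (rev vs ! i) (rev vs ! j) \<longleftrightarrow> i = Suc j \<or> j = Suc i" if "i < length vs" "j < length vs" for i j
  proof -
    have "E (rev vs ! i) (rev vs ! j) \<longleftrightarrow> E (vs ! (length vs - Suc i)) (vs ! (length vs - Suc j))"
      using that by (simp add: rev_nth)
    also have "\<dots> \<longleftrightarrow> length vs - Suc i = Suc (length vs - Suc j) \<or> length vs - Suc j = Suc (length vs - Suc i)"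
      using assms(2) that unfolding ipath_def by (metis diff_less_Suc diff_less less_nat_zero_code linorder_neqE_nat zero_less_Suc)
    also have "\<dots> \<longleftrightarrow> i = Suc j \<or> j = Suc i" using that by auto
    finally show ?thesis .
  qed
  then show ?thesis using assms(2) unfolding ipath_def by auto
qed

lemma ipath_drop: "ipath V E vs \<Longrightarrow> k < length vs \<Longrightarrow> ipath V E (drop k vs)"
  unfolding ipath_def by (auto dest: in_set_dropD)

lemma ipath_take: "ipath V E vs \<Longrightarrow> 0 < k \<Longrightarrow> ipath V E (take k vs)"
  unfolding ipath_def by (auto dest: in_set_takeD)

lemma ipath_ConsI:
  assumes g: "graph V E" and p: "ipath V E vs" and "x \<in> V" "x \<notin> set vs"
    and "\<And>z. z \<in> set vs \<Longrightarrow> E x z \<longleftrightarrow> z = hd vs"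
  shows "ipath V E (x # vs)"
  using assms ipath_Nil by (cases vs) (auto simp: ipath_Cons[OF g])

lemma ipath_snocI:
  assumes g: "graph V E" and p: "ipath V E vs" and "x \<in> V" "x \<notin> set vs"
    and "\<And>z. z \<in> set vs \<Longrightarrow> E x z \<longleftrightarrow> z = last vs"
  shows "ipath V E (vs @ [x])"
proof -
  have "ipath V E (x # rev vs)"
    using assms by (intro ipath_ConsI ipath_rev) (auto simp: hd_rev)
  from ipath_rev[OF g this] show ?thesis by simp
qed

lemma ipath_conn:
  assumes g: "graph V E" and "ipath V E vs"
  shows "conn (set vs) E"
  using assms(2)
proof (induction vs)
  case Nil then show ?case by (simp add: ipath_Nil)
next
  case (Cons x vs)
  show ?case
  proof (cases vs)
    case Nil then show ?thesis by (simp add: disconnected_def reach_def)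
  next
    case (Cons y ys)
    then have "ipath V E vs" "E y x" using Cons.prems graph_sym[OF g] by (auto simp: ipath_Cons[OF g])
    then show ?thesis using conn_insert[OF g _ _ , of "set vs" y x] Cons.IH Cons by auto
  qed
qed

text \<open>\<open>z\<close> completes the path to a hole with \<open>length vs + 1\<close>
  vertices; three path vertices are needed to reach a 4-cycle. All odd holes and antiholes below are
  excluded through this lemma.\<close>

lemma berge_close:
  assumes g: "graph V E" and b: "berge V E" and p: "ipath V E vs" and len: "length vs \<ge> 3"
    and z: "z \<in> V" "z \<notin> set vs" and adj: "\<And>x. x \<in> set vs \<Longrightarrow> E z x \<longleftrightarrow> x = hd vs \<or> x = last vs"
  shows "odd (length vs)"
proof -
  let ?h = "vs @ [z]" and ?n = "length vs"
  have d: "distinct vs" "set vs \<subseteq> V" using p unfolding ipath_def by auto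
  have hd0: "hd vs = vs ! 0" and lst: "last vs = vs ! (?n - 1)" using len by (cases vs; auto simp: last_conv_nth hd_conv_nth)+
  have az: "E z (vs ! i) \<longleftrightarrow> i = 0 \<or> i = ?n - 1" if "i < ?n" for i
  proof -
    have "vs ! i = vs ! 0 \<longleftrightarrow> i = 0" "vs ! i = vs ! (?n - 1) \<longleftrightarrow> i = ?n - 1"
      using d len that by (subst nth_eq_iff_index_eq; auto)+
    then show ?thesis using adj[of "vs ! i"] that hd0 lst by simp
  qed
  have "E (?h ! i) (?h ! j) \<longleftrightarrow> j = Suc i mod Suc ?n \<or> i = Suc j mod Suc ?n"
    if ij: "i < Suc ?n" "j < Suc ?n" for i j
  proof -
    consider "i < ?n" "j < ?n" | "i < ?n" "j = ?n" | "i = ?n" "j < ?n" | "i = ?n" "j = ?n" using ij by linarith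
    then show ?thesis
    proof cases
      case 1
      then show ?thesis using p unfolding ipath_def by (auto simp: nth_append)
    next
      case 2
      then show ?thesis using az[of i] graph_sym_iff[OF g] by (auto simp: nth_append)
    next
      case 3
      then show ?thesis using az[of j] by (auto simp: nth_append)
    next
      case 4
      then show ?thesis using graph_irrefl[OF g] len by (auto simp: nth_append)
    qed
  qed
  then have "hole V E ?h" unfolding hole_def using d z len by auto
  then have "even (length ?h)" using b unfolding berge_def by blast
  then show ?thesis by simp
qed

lemma no_C5:
  assumes g: "graph V E" and b: "berge V E"
    and "E v p" "E p q" "E q r" "E r s" "E s v" "\<not> E v q" "\<not> E v r" "\<not> E p r" "\<not> E p s" "\<not> E q s"
  shows False
proof -
  have V: "v \<in> V" "p \<in> V" "q \<in> V" "r \<in> V" "s \<in> V" using assms graph_in1[OF g] graph_in2[OF g] by auto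
  have "v \<noteq> p" "v \<noteq> q" "v \<noteq> r" "v \<noteq> s" "p \<noteq> q" "p \<noteq> r" "p \<noteq> s" "q \<noteq> r" "q \<noteq> s" "r \<noteq> s"
    using assms graph_sym[OF g] graph_irrefl[OF g] by metis+
  moreover from this have "ipath V E [p, q, r, s]"
    using assms V graph_irrefl[OF g] by (auto simp: ipath_Cons[OF g] ipath_single[OF g])
  ultimately have "odd (length [p, q, r, s])"
    using assms V graph_sym[OF g] by (intro berge_close[OF g b, of _ v]) auto
  then show False by simp
qed

lemma conn_ipath:
  assumes g: "graph V E" and S: "S \<subseteq> V" and c: "conn S E" and xy: "x \<in> S" "y \<in> S"
  shows "\<exists>vs. ipath V E vs \<and> set vs \<subseteq> S \<and> hd vs = x \<and> last vs = y"
proof -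
  have "reach S E x y" using c xy unfolding disconnected_def by blast
  then show ?thesis unfolding reach_def
  proof (induction rule: rtranclp_induct)
    case base
    then show ?case using xy S ipath_single[OF g, of x] by (intro exI[of _ "[x]"]) auto
  next
    case (step y z)
    then obtain vs where vs: "ipath V E vs" "set vs \<subseteq> S" "hd vs = x" "last vs = y" by blast
    have ne: "vs \<noteq> []" using vs ipath_Nil by auto
    show ?case
    proof (cases "z \<in> set vs")
      case True
      then obtain i where i: "i < length vs" "vs ! i = z" by (metis in_set_conv_nth)
      then have "last (take (Suc i) vs) = z" by (simp add: take_Suc_conv_app_nth)
      then show ?thesis using vs i ne
        by (intro exI[of _ "take (Suc i) vs"]) (auto intro: ipath_take dest: in_set_takeD)
    next
      case False
      \<comment> \<open>Cutting the path at its first neighbour of \<open>z\<close> keeps it induced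
        when \<open>z\<close> is appended.\<close>
      define i where "i = (LEAST i. i < length vs \<and> E (vs ! i) z)"
      have "length vs - 1 < length vs \<and> E (vs ! (length vs - 1)) z"
        using step vs ne by (auto simp: last_conv_nth)
      then have i: "i < length vs \<and> E (vs ! i) z" unfolding i_def by (rule LeastI)
      have imin: "\<not> E (vs ! j) z" if "j < i" for j
        using that i not_less_Least[of j "\<lambda>i. i < length vs \<and> E (vs ! i) z"] unfolding i_def by auto
      let ?p = "take (Suc i) vs"
      have pp: "ipath V E ?p" using vs by (auto intro: ipath_take)
      have lp: "last ?p = vs ! i" using i by (simp add: take_Suc_conv_app_nth)
      have "E z u \<longleftrightarrow> u = last ?p" if u: "u \<in> set ?p" for u
      proof -
        obtain j where j: "j \<le> i" "u = vs ! j" using u i by (auto simp: in_set_conv_nth less_Suc_eq_le)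
        then show ?thesis using i imin[of j] lp graph_sym_iff[OF g, of z u] by (cases "j = i") auto
      qed
      then have "ipath V E (?p @ [z])"
        using pp False step S by (intro ipath_snocI[OF g]) (auto dest: in_set_takeD)
      then show ?thesis using vs step ne
        by (intro exI[of _ "?p @ [z]"]) (auto dest: in_set_takeD simp: hd_append)
    qed
  qed
qed

lemma conn_ipath_through:
  assumes g: "graph V E" and S: "S \<subseteq> V" and c: "conn S E"
    and x: "x \<in> V" "x \<notin> S" and y: "y \<in> V" "y \<notin> S" and xy: "x \<noteq> y" "\<not> E x y"
    and s: "s \<in> S" "E x s" and t: "t \<in> S" "E y t"
  shows "\<exists>R. ipath V E (x # R @ [y]) \<and> set R \<subseteq> S \<and> R \<noteq> []"
proof -
  have "conn (insert y S) E" using conn_insert[OF g c t(1)] graph_sym[OF g t(2)] by blast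
  then have "conn (insert x (insert y S)) E"
    using conn_insert[OF g, of "insert y S" s x] s graph_sym[OF g s(2)] by blast
  from conn_ipath[OF g _ this, of x y] obtain vs where
    vs: "ipath V E vs" "set vs \<subseteq> insert x (insert y S)" "hd vs = x" "last vs = y"
    using S x y by auto
  have d: "distinct vs" "vs \<noteq> []" using vs unfolding ipath_def by auto
  obtain ws where ws: "vs = x # ws" using d vs(3) by (cases vs) auto
  then have "ws \<noteq> []" "last ws = y" using vs xy by auto
  then obtain R where R: "ws = R @ [y]" by (metis append_butlast_last_id)
  have "R \<noteq> []"
  proof
    assume "R = []"
    then have "ipath V E [x, y]" using vs ws R by simp
    then show False using xy by (simp add: ipath_Cons[OF g])
  qed
  moreover have "set R \<subseteq> S" using vs d ws R by auto
  ultimately show ?thesis using vs ws R by auto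
qed

section \<open>A variant of the Roussel-Rubio lemma\<close>

text \<open>Induced paths as functions, where \<open>n\<close> counts edges. The following arguments
  cut, shift and reverse subpaths, which is index arithmetic here and would be list surgery
  otherwise.\<close>

definition fpath :: "'a set \<Rightarrow> ('a \<Rightarrow> 'a \<Rightarrow> bool) \<Rightarrow> nat \<Rightarrow> (nat \<Rightarrow> 'a) \<Rightarrow> bool" where
  "fpath V E n p \<longleftrightarrow> (\<forall>i\<le>n. p i \<in> V) \<and> inj_on p {..n} \<and>
     (\<forall>i\<le>n. \<forall>j\<le>n. E (p i) (p j) \<longleftrightarrow> i = Suc j \<or> j = Suc i)"

lemma fpath_in: "fpath V E n p \<Longrightarrow> i \<le> n \<Longrightarrow> p i \<in> V"
  and fpath_eq: "fpath V E n p \<Longrightarrow> i \<le> n \<Longrightarrow> j \<le> n \<Longrightarrow> p i = p j \<longleftrightarrow> i = j"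
  and fpath_edge: "fpath V E n p \<Longrightarrow> i \<le> n \<Longrightarrow> j \<le> n \<Longrightarrow> E (p i) (p j) \<longleftrightarrow> i = Suc j \<or> j = Suc i"
  unfolding fpath_def inj_on_def by auto

lemma fpathI:
  assumes "\<And>i. i \<le> n \<Longrightarrow> p i \<in> V" "\<And>i j. i \<le> n \<Longrightarrow> j \<le> n \<Longrightarrow> p i = p j \<Longrightarrow> i = j"
    and "\<And>i j. i \<le> n \<Longrightarrow> j \<le> n \<Longrightarrow> E (p i) (p j) \<longleftrightarrow> i = Suc j \<or> j = Suc i"
  shows "fpath V E n p"
  using assms unfolding fpath_def inj_on_def by blast

lemma fpath_ipath: "fpath V E n p \<Longrightarrow> ipath V E (map p [0..<Suc n])"
  unfolding fpath_def ipath_def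
  by (auto simp: distinct_map atLeast0LessThan lessThan_Suc_atMost nth_append simp del: upt_Suc)

lemma ipath_fpath:
  assumes "ipath V E vs"
  shows "fpath V E (length vs - 1) (nth vs)"
proof -
  have "inj_on ((!) vs) {..length vs - 1}"
    using assms unfolding ipath_def by (intro inj_on_nth) (auto simp: Suc_le_eq[symmetric] simp flip: length_greater_0_conv)
  then show ?thesis using assms unfolding ipath_def fpath_def
    by (auto simp: subset_iff simp flip: length_greater_0_conv)
qed

lemma fpath_close:
  assumes g: "graph V E" and b: "berge V E" and p: "fpath V E n p" and n: "n \<ge> 2"
    and z: "z \<in> V" "\<And>i. i \<le> n \<Longrightarrow> z \<noteq> p i" and adj: "\<And>i. i \<le> n \<Longrightarrow> E z (p i) \<longleftrightarrow> i = 0 \<or> i = n"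
  shows "even n"
proof -
  have h: "hd (map p [0..<Suc n]) = p 0" by (simp add: hd_map del: upt_Suc)
  have l: "last (map p [0..<Suc n]) = p n" by simp
  have i: "p i = p j \<longleftrightarrow> i = j" if "i \<le> n" "j \<le> n" for i j
    using p that unfolding fpath_def inj_on_def by auto
  have "odd (length (map p [0..<Suc n]))"
  proof (rule berge_close[OF g b fpath_ipath[OF p] _ z(1)])
    show "z \<notin> set (map p [0..<Suc n])"
    proof
      assume "z \<in> set (map p [0..<Suc n])"
      then obtain k where "k \<le> n" "z = p k" by (auto simp: less_Suc_eq_le simp del: upt_Suc)
      then show False using z(2) by blast
    qed
    show "E z x \<longleftrightarrow> x = hd (map p [0..<Suc n]) \<or> x = last (map p [0..<Suc n])"
      if x: "x \<in> set (map p [0..<Suc n])" for x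
    proof -
      obtain k where k: "k \<le> n" "x = p k" using x by (auto simp: less_Suc_eq_le simp del: upt_Suc)
      then show ?thesis unfolding h l using adj[of k] i[of k 0] i[of k n] by simp
    qed
  qed (use n in simp)
  then show ?thesis by simp
qed

lemma fpath_sub: "fpath V E n p \<Longrightarrow> a \<le> b \<Longrightarrow> b \<le> n \<Longrightarrow> fpath V E (b - a) (\<lambda>i. p (a + i))"
  by (rule fpathI) (simp_all add: fpath_in fpath_eq fpath_edge)

lemma fpath_rev:
  assumes p: "fpath V E n p"
  shows "fpath V E n (\<lambda>i. p (n - i))"
proof (rule fpathI)
  fix i j assume ij: "i \<le> n" "j \<le> n"
  show "i = j" if "p (n - i) = p (n - j)"
    using that fpath_eq[OF p, of "n - i" "n - j"] ij by simp
  have "n - i = Suc (n - j) \<or> n - j = Suc (n - i) \<longleftrightarrow> i = Suc j \<or> j = Suc i"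
    using ij by arith
  then show "E (p (n - i)) (p (n - j)) \<longleftrightarrow> i = Suc j \<or> j = Suc i"
    using fpath_edge[OF p, of "n - i" "n - j"] by simp
qed (use p in \<open>simp add: fpath_in\<close>)

lemma fpath_Cons:
  assumes g: "graph V E" and p: "fpath V E n p" and x: "x \<in> V" "\<And>i. i \<le> n \<Longrightarrow> x \<noteq> p i"
    and adj: "\<And>i. i \<le> n \<Longrightarrow> E x (p i) \<longleftrightarrow> i = 0"
  shows "fpath V E (Suc n) (\<lambda>i. case i of 0 \<Rightarrow> x | Suc i \<Rightarrow> p i)" (is "fpath V E _ ?q")
proof (rule fpathI)
  fix i j assume ij: "i \<le> Suc n" "j \<le> Suc n"
  show "E (?q i) (?q j) \<longleftrightarrow> i = Suc j \<or> j = Suc i"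
    using ij fpath_edge[OF p] adj graph_irrefl[OF g] graph_sym_iff[OF g, of _ x]
    by (cases i; cases j) auto
  show "i = j" if "?q i = ?q j"
    using ij that fpath_eq[OF p] x(2)[of "i - 1"] x(2)[of "j - 1"] by (cases i; cases j) auto
qed (use x in \<open>auto simp: fpath_in[OF p] split: nat.split\<close>)

lemma fpath_snoc:
  assumes g: "graph V E" and p: "fpath V E n p" and x: "x \<in> V" "\<And>i. i \<le> n \<Longrightarrow> x \<noteq> p i"
    and adj: "\<And>i. i \<le> n \<Longrightarrow> E x (p i) \<longleftrightarrow> i = n"
  shows "fpath V E (Suc n) (\<lambda>i. if i \<le> n then p i else x)" (is "fpath V E _ ?q")
proof -
  have "E (?q i) (?q j) \<longleftrightarrow> i = Suc j \<or> j = Suc i" if "i \<le> Suc n" "j \<le> Suc n" for i j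
    using that p adj graph_irrefl[OF g] graph_sym_iff[OF g, of _ x] unfolding fpath_def
    by (cases "i \<le> n"; cases "j \<le> n") auto
  moreover have "inj_on ?q {..Suc n}"
  proof (rule inj_onI)
    fix i j assume "i \<in> {..Suc n}" "j \<in> {..Suc n}" "?q i = ?q j"
    then show "i = j" using p x(2)[of i] x(2)[of j] unfolding fpath_def inj_on_def
      by (auto split: if_splits)
  qed
  ultimately show ?thesis using p x unfolding fpath_def by auto
qed

text \<open>In the complement \<open>p 0, p 3, p 1, R, p 2\<close> is a hole with
  \<open>length R + 4\<close> vertices, since \<open>p 0\<close> and \<open>p 3\<close> are joined
  to all of \<open>T\<close> in \<open>E\<close>. Length 3 is the case of the Roussel-Rubio lemma in
  which the outcome is an odd antipath instead of a leap.\<close>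

lemma Roussel_Rubio_3:
  assumes g: "graph V E" and b: "berge V E" and p: "fpath V E 3 p"
    and T: "T \<subseteq> V" "conn T (compl V E)" "\<And>t i. t \<in> T \<Longrightarrow> i \<le> 3 \<Longrightarrow> t \<noteq> p i"
    and ends: "\<And>t. t \<in> T \<Longrightarrow> E t (p 0)" "\<And>t. t \<in> T \<Longrightarrow> E t (p 3)"
    and t1: "t1 \<in> T" "\<not> E t1 (p 1)" and t2: "t2 \<in> T" "\<not> E t2 (p 2)"
  shows "\<exists>R. ipath V (compl V E) (p 1 # R @ [p 2]) \<and> set R \<subseteq> T \<and> R \<noteq> [] \<and> even (length R)"
proof -
  let ?C = "compl V E"
  note gc = graph_compl[OF g]
  have pV: "p i \<in> V" if "i \<le> 3" for i using p that unfolding fpath_def by auto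
  have pe: "E (p i) (p j) \<longleftrightarrow> i = Suc j \<or> j = Suc i" if "i \<le> 3" "j \<le> 3" for i j
    using p that unfolding fpath_def by auto
  have pd: "p i = p j \<longleftrightarrow> i = j" if "i \<le> 3" "j \<le> 3" for i j
    using p that unfolding fpath_def inj_on_def by auto
  have pT: "p i \<notin> T" if "i \<le> 3" for i using T(3)[OF _ that] by blast
  have tV: "t \<in> V" if "t \<in> T" for t using T that by auto
  have c1: "?C (p 1) t1" "?C (p 2) t2"
    using t1 t2 T(3)[of t1 1] T(3)[of t2 2] pV[of 1] pV[of 2] tV graph_sym_iff[OF g] by (auto simp: compl_iff)
  have "\<exists>R. ipath V ?C (p 1 # R @ [p 2]) \<and> set R \<subseteq> T \<and> R \<noteq> []"
  proof (rule conn_ipath_through[OF gc T(1,2) pV _ pV _ _ _ t1(1) c1(1) t2(1) c1(2)])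
    show "\<not> ?C (p 1) (p 2)" using pe[of 1 2] by (simp add: compl_def)
    show "p 1 \<notin> T" "p 2 \<notin> T" using T(3)[of _ 1] T(3)[of _ 2] by auto
    show "p 1 \<noteq> p 2" using pd[of 1 2] by simp
  qed simp_all
  then obtain R where R: "ipath V ?C (p 1 # R @ [p 2])" "set R \<subseteq> T" "R \<noteq> []" by blast
  have e3: "\<not> ?C (p 3) t" "\<not> ?C (p 0) t" "t \<noteq> p 3" "t \<noteq> p 0" if "t \<in> T" for t
    using ends[OF that] graph_sym[OF g] T(3)[OF that] by (auto simp: compl_def)
  have q: "ipath V ?C (p 3 # (p 1 # R @ [p 2]))"
  proof (rule ipath_ConsI[OF gc R(1) pV])
    show "p 3 \<notin> set (p 1 # R @ [p 2])" using R(2) pT[of 3] pd[of 3 1] pd[of 3 2] by auto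
    show "?C (p 3) z \<longleftrightarrow> z = hd (p 1 # R @ [p 2])" if "z \<in> set (p 1 # R @ [p 2])" for z
    proof -
      consider "z = p 1" | "z = p 2" | "z \<in> T" using \<open>z \<in> _\<close> R(2) by auto
      then show ?thesis
      proof cases
        case 1 then show ?thesis using pe[of 3 1] pd[of 3 1] pV[of 3] pV[of 1] by (simp add: compl_iff)
      next
        case 2 then show ?thesis using pe[of 3 2] pd[of 2 1] pV[of 3] pV[of 2] by (simp add: compl_iff)
      next
        case 3 then show ?thesis using e3[of z] T(3)[OF 3, of 1] by auto
      qed
    qed
  qed simp
  have "odd (length (p 3 # p 1 # R @ [p 2]))"
  proof (rule berge_close[OF gc berge_compl[OF g b] q])
    show "p 0 \<notin> set (p 3 # p 1 # R @ [p 2])" using R(2) pT[of 0] pd[of 0 1] pd[of 0 2] pd[of 0 3] by auto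
    show "?C (p 0) z \<longleftrightarrow> z = hd (p 3 # p 1 # R @ [p 2]) \<or> z = last (p 3 # p 1 # R @ [p 2])"
      if "z \<in> set (p 3 # p 1 # R @ [p 2])" for z
    proof -
      consider "z = p 1" | "z = p 2" | "z = p 3" | "z \<in> T" using \<open>z \<in> _\<close> R(2) by auto
      then show ?thesis
      proof cases
        case 1 then show ?thesis using pe[of 0 1] pd[of 1 3] pd[of 1 2] pV[of 0] pV[of 1] by (simp add: compl_iff)
      next
        case 2 then show ?thesis using pe[of 0 2] pd[of 0 2] pV[of 0] pV[of 2] by (simp add: compl_iff)
      next
        case 3 then show ?thesis using pe[of 0 3] pd[of 0 3] pV[of 0] pV[of 3] by (simp add: compl_iff)
      next
        case 4 then show ?thesis using e3[of z] T(3)[OF 4, of 2] T(3)[OF 4, of 3] by auto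
      qed
    qed
  qed (use pV in auto)
  then show ?thesis using R by auto
qed

text \<open>The Roussel-Rubio conclusion for odd paths with at least 5 edges: \<open>x\<close> and
  \<open>y\<close> form a leap, and putting them in place of the ends of the path gives an induced
  path of the same length. With all paths quantified this is a property of \<open>T\<close> alone,
  suited to induction on \<open>card T\<close>.\<close>

definition leaps :: "'a set \<Rightarrow> ('a \<Rightarrow> 'a \<Rightarrow> bool) \<Rightarrow> 'a set \<Rightarrow> bool" where
  "leaps V E T \<longleftrightarrow> (\<forall>n p. fpath V E n p \<and> odd n \<and> n \<ge> 5 \<and> (\<forall>i\<le>n. p i \<notin> T) \<and>
     (\<forall>t\<in>T. E t (p 0) \<and> E t (p n)) \<and> (\<forall>i. 0 < i \<and> i < n \<longrightarrow> (\<exists>t\<in>T. \<not> E t (p i))) \<longrightarrow>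
     (\<exists>x\<in>T. \<exists>y\<in>T. x \<noteq> y \<and> \<not> E x y \<and>
        (\<forall>i. 0 < i \<and> i < n \<longrightarrow> (E x (p i) \<longleftrightarrow> i = 1) \<and> (E y (p i) \<longleftrightarrow> i = n - 1))))"

text \<open>\<open>z\<close> closes a structure of the wrong parity: for \<open>n = 3\<close>, in
  the complement, the antipath \<open>p 1, R, p 2\<close>; for larger \<open>n\<close> the path in
  which a leap replaces the ends of \<open>p\<close>. The condition on \<open>z\<close> concerns
  only the interior of \<open>p\<close>, so \<open>z\<close> may be adjacent to its ends.\<close>

lemma leaps_no_outside_complete:
  assumes g: "graph V E" and b: "berge V E" and T: "T \<subseteq> V" "conn T (compl V E)" "leaps V E T"
    and p: "fpath V E n p" "odd n" "n \<ge> 3" and pT: "\<And>i. i \<le> n \<Longrightarrow> p i \<notin> T"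
    and ends: "\<And>t. t \<in> T \<Longrightarrow> E t (p 0)" "\<And>t. t \<in> T \<Longrightarrow> E t (p n)"
    and int: "\<And>i. 0 < i \<Longrightarrow> i < n \<Longrightarrow> \<exists>t\<in>T. \<not> E t (p i)"
    and z: "z \<in> V" "\<And>t. t \<in> T \<Longrightarrow> E t z" "\<And>i. 0 < i \<Longrightarrow> i < n \<Longrightarrow> z \<noteq> p i \<and> \<not> E z (p i)"
  shows False
proof (cases "n = 3")
  case True
  let ?C = "compl V E"
  note gc = graph_compl[OF g]
  obtain t1 t2 where "t1 \<in> T" "\<not> E t1 (p 1)" "t2 \<in> T" "\<not> E t2 (p 2)"
    using int[of 1] int[of 2] True by auto
  then obtain R where R: "ipath V ?C (p 1 # R @ [p 2])" "set R \<subseteq> T" "R \<noteq> []" "even (length R)"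
    using Roussel_Rubio_3[OF g b, of p T t1 t2] p T ends pT True by blast
  have zz: "z \<noteq> p 1" "z \<noteq> p 2" "\<not> E z (p 1)" "\<not> E z (p 2)" using z(3)[of 1] z(3)[of 2] True by auto
  have zT: "t \<noteq> z" "E z t" if "t \<in> T" for t using z(2)[OF that] graph_neq[OF g] graph_sym[OF g] by auto
  have pV: "p 1 \<in> V" "p 2 \<in> V" using p True unfolding fpath_def by auto
  have pne: "p 1 \<notin> T" "p 2 \<notin> T" using pT[of 1] pT[of 2] True by auto
  have "odd (length (p 1 # R @ [p 2]))"
  proof (rule berge_close[OF gc berge_compl[OF g b] R(1)])
    show "3 \<le> length (p 1 # R @ [p 2])" using R(3) by (cases R) auto
    show "z \<notin> set (p 1 # R @ [p 2])" using zz zT R(2) by auto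
    show "?C z x \<longleftrightarrow> x = hd (p 1 # R @ [p 2]) \<or> x = last (p 1 # R @ [p 2])"
      if "x \<in> set (p 1 # R @ [p 2])" for x
    proof -
      consider "x = p 1" | "x = p 2" | "x \<in> T" using \<open>x \<in> _\<close> R(2) by auto
      then show ?thesis
      proof cases
        case 3
        then show ?thesis using zT[OF 3] pne by (auto simp: compl_def)
      qed (use zz pV z(1) in \<open>auto simp: compl_def\<close>)
    qed
  qed (rule z(1))
  then show False using R by simp
next
  case False
  then have n: "n \<ge> 5" using p by presburger
  have "\<exists>x\<in>T. \<exists>y\<in>T. x \<noteq> y \<and> \<not> E x y \<and>
        (\<forall>i. 0 < i \<and> i < n \<longrightarrow> (E x (p i) \<longleftrightarrow> i = 1) \<and> (E y (p i) \<longleftrightarrow> i = n - 1))"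
    using p n pT ends int by (intro T(3)[unfolded leaps_def, rule_format]) auto
  then obtain x y where xy: "x \<in> T" "y \<in> T" "x \<noteq> y" "\<not> E x y"
    "\<And>i. 0 < i \<Longrightarrow> i < n \<Longrightarrow> (E x (p i) \<longleftrightarrow> i = 1) \<and> (E y (p i) \<longleftrightarrow> i = n - 1)"
    by auto
  \<comment> \<open>\<open>q\<close> is the interior of \<open>p\<close>; \<open>q1\<close> puts
    \<open>x\<close> in front and \<open>q2\<close> puts \<open>y\<close> behind, so that
    \<open>q2\<close> again has length \<open>n\<close>.\<close>
  define q where "q = (\<lambda>i. p (1 + i))"
  have q: "fpath V E (n - 1 - 1) q" unfolding q_def by (rule fpath_sub[OF p(1)]) (use n in auto)
  define q1 where "q1 = (\<lambda>i. case i of 0 \<Rightarrow> x | Suc i \<Rightarrow> q i)"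
  have q1: "fpath V E (Suc (n - 1 - 1)) q1" unfolding q1_def
  proof (rule fpath_Cons[OF g q])
    show "x \<in> V" using xy T by auto
    show "x \<noteq> q i" if "i \<le> n - 1 - 1" for i using xy pT[of "1 + i"] that n unfolding q_def by auto
    show "E x (q i) \<longleftrightarrow> i = 0" if "i \<le> n - 1 - 1" for i using xy(5)[of "1 + i"] that n unfolding q_def by auto
  qed
  define q2 where "q2 = (\<lambda>i. if i \<le> Suc (n - 1 - 1) then q1 i else y)"
  have q2: "fpath V E (Suc (Suc (n - 1 - 1))) q2" unfolding q2_def
  proof (rule fpath_snoc[OF g q1])
    show "y \<in> V" using xy T by auto
    show "y \<noteq> q1 i" if "i \<le> Suc (n - 1 - 1)" for i
      using xy pT[of i] that n unfolding q1_def q_def by (cases i) auto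
    show "E y (q1 i) \<longleftrightarrow> i = Suc (n - 1 - 1)" if "i \<le> Suc (n - 1 - 1)" for i
      using xy(4) xy(5)[of i] that n graph_sym_iff[OF g, of x y] unfolding q1_def q_def by (cases i) auto
  qed
  have nn: "Suc (Suc (n - 1 - 1)) = n" using n by simp
  have "even n"
  proof (rule fpath_close[OF g b q2[unfolded nn]])
    show "z \<in> V" by fact
    show "z \<noteq> q2 i" if "i \<le> n" for i
      using z(3)[of i] z(2)[OF xy(1)] z(2)[OF xy(2)] graph_neq[OF g] that n
      unfolding q2_def q1_def q_def by (cases i) auto
    show "E z (q2 i) \<longleftrightarrow> i = 0 \<or> i = n" if "i \<le> n" for i
      using z(3)[of i] z(2)[OF xy(1)] z(2)[OF xy(2)] graph_sym[OF g] that n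
      unfolding q2_def q1_def q_def by (cases i) auto
  qed (use n in auto)
  then show False using p by simp
qed

text \<open>A gap between consecutive marks contributes one marked edge if it has length 1, and none
  otherwise, when its length is even. So the number of marked edges and the total length agree
  modulo 2. The induction splits off the last gap.\<close>

lemma card_marked_edges:
  fixes n :: nat
  assumes "0 \<in> M" "n \<in> M"
    and "\<And>a b. a < b \<Longrightarrow> b \<le> n \<Longrightarrow> a \<in> M \<Longrightarrow> b \<in> M \<Longrightarrow> (\<And>k. a < k \<Longrightarrow> k < b \<Longrightarrow> k \<notin> M) \<Longrightarrow> b = Suc a \<or> even (b - a)"
  shows "odd (card {i. i < n \<and> i \<in> M \<and> Suc i \<in> M}) \<longleftrightarrow> odd n"
  using assms(2,3)
proof (induction n rule: less_induct)
  case (less n)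
  show ?case
  proof (cases "n = 0")
    case True then show ?thesis by simp
  next
    case False
    define b where "b = Max {i. i < n \<and> i \<in> M}"
    have fin: "finite {i. i < n \<and> i \<in> M}" by simp
    have "b \<in> {i. i < n \<and> i \<in> M}" unfolding b_def using False assms(1) by (intro Max_in) auto
    then have b: "b < n" "b \<in> M" by auto
    have bm: "k \<notin> M" if "b < k" "k < n" for k
    proof
      assume "k \<in> M"
      then have "k \<le> b" unfolding b_def using fin that by (intro Max_ge) auto
      then show False using that by simp
    qed
    have gap: "n = Suc b \<or> even (n - b)" using less.prems(2)[of b n] b less.prems(1) bm by blast
    have IH: "odd (card {i. i < b \<and> i \<in> M \<and> Suc i \<in> M}) \<longleftrightarrow> odd b"
      using b less.prems(2) by (intro less.IH) auto
    show ?thesis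
    proof (cases "n = Suc b")
      case True
      then have "{i. i < n \<and> i \<in> M \<and> Suc i \<in> M} = insert b {i. i < b \<and> i \<in> M \<and> Suc i \<in> M}"
        using b less.prems(1) by auto
      then have "card {i. i < n \<and> i \<in> M \<and> Suc i \<in> M} = Suc (card {i. i < b \<and> i \<in> M \<and> Suc i \<in> M})" by simp
      then show ?thesis using IH True by simp
    next
      case F: False
      have "i < b" if "i < n" "i \<in> M" "Suc i \<in> M" for i
      proof (rule ccontr)
        assume "\<not> i < b"
        then have "b < i \<or> (i = b \<and> b < Suc i \<and> Suc i < n)" using F that b by linarith
        then consider "b < i" | "i = b" "b < Suc i" "Suc i < n" by blast
        then show False using bm that by cases auto
      qed
      then have "{i. i < n \<and> i \<in> M \<and> Suc i \<in> M} = {i. i < b \<and> i \<in> M \<and> Suc i \<in> M}"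
        using b by auto
      moreover have "odd b \<longleftrightarrow> odd n" using gap F b by presburger
      ultimately show ?thesis using IH by simp
    qed
  qed
qed

locale minimal_no_leap =
  fixes V :: "'a set" and E :: "'a \<Rightarrow> 'a \<Rightarrow> bool" and T :: "'a set" and n :: nat and p :: "nat \<Rightarrow> 'a"
  assumes g: "graph V E" and b: "berge V E" and TV: "T \<subseteq> V" and connT: "conn T (compl V E)"
    and p: "fpath V E n p" and n: "odd n" "n \<ge> 5" and pT: "\<And>i. i \<le> n \<Longrightarrow> p i \<notin> T"
    and ends: "\<And>t. t \<in> T \<Longrightarrow> E t (p 0)" "\<And>t. t \<in> T \<Longrightarrow> E t (p n)"
    and int: "\<And>i. 0 < i \<Longrightarrow> i < n \<Longrightarrow> \<exists>t\<in>T. \<not> E t (p i)"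
    and IH: "\<And>Y. Y \<subset> T \<Longrightarrow> Y \<noteq> {} \<Longrightarrow> conn Y (compl V E) \<Longrightarrow> leaps V E Y"
    and minimal: "\<And>Y. Y \<subset> T \<Longrightarrow> Y \<noteq> {} \<Longrightarrow> conn Y (compl V E) \<Longrightarrow> \<exists>i. 0 < i \<and> i < n \<and> (\<forall>y\<in>Y. E y (p i))"
begin

definition K :: "'a set \<Rightarrow> nat set" where
  "K Y = {i. i \<le> n \<and> (\<forall>y\<in>Y. E y (p i))}"

lemma K_ends: "Y \<subseteq> T \<Longrightarrow> 0 \<in> K Y" "Y \<subseteq> T \<Longrightarrow> n \<in> K Y"
  using ends by (auto simp: K_def)

lemma K_le: "i \<in> K Y \<Longrightarrow> i \<le> n"
  by (simp add: K_def)

text \<open>An odd gap longer than 1 would be an odd path with \<open>Y\<close>-complete ends and no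
  \<open>Y\<close>-complete interior vertex. By \<open>minimal\<close> it is not all of
  \<open>p\<close>, so one end of \<open>p\<close> is distinct from and non-adjacent to every
  interior vertex of the gap. That end is \<open>Y\<close>-complete, against
  \<open>leaps_no_outside_complete\<close>.\<close>

lemma gap:
  assumes Y: "Y \<subset> T" "Y \<noteq> {}" "conn Y (compl V E)"
    and ac: "a < c" "c \<le> n" "a \<in> K Y" "c \<in> K Y" and btw: "\<And>k. a < k \<Longrightarrow> k < c \<Longrightarrow> k \<notin> K Y"
  shows "c = Suc a \<or> even (c - a)"
proof (rule ccontr)
  assume n': "\<not> (c = Suc a \<or> even (c - a))"
  obtain i where i: "0 < i" "i < n" "i \<in> K Y" using minimal[OF Y] by (auto simp: K_def)
  have an: "0 < a \<or> c < n"
  proof (rule ccontr)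
    assume "\<not> (0 < a \<or> c < n)"
    then have "a < i" "i < c" using i ac by auto
    then show False using btw i by blast
  qed
  have q: "fpath V E (c - a) (\<lambda>i. p (a + i))" by (rule fpath_sub[OF p]) (use ac in auto)
  define z where "z = (if 0 < a then p 0 else p n)"
  show False
  proof (rule leaps_no_outside_complete[OF g b _ Y(3) IH[OF Y] q])
    show "Y \<subseteq> V" using Y TV by auto
    show "odd (c - a)" "3 \<le> c - a" using n' ac by presburger+
    show "p (a + i) \<notin> Y" if "i \<le> c - a" for i
    proof -
      have "a + i \<le> n" using that ac by linarith
      then show ?thesis using pT Y by blast
    qed
    show "E t (p (a + 0))" "E t (p (a + (c - a)))" if "t \<in> Y" for t using that ac by (auto simp: K_def)
    show "\<exists>t\<in>Y. \<not> E t (p (a + i))" if "0 < i" "i < c - a" for i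
      using btw[of "a + i"] that ac by (auto simp: K_def)
    show "z \<in> V" using fpath_in[OF p] by (simp add: z_def)
    show "E t z" if "t \<in> Y" for t using ends Y that by (auto simp: z_def)
    show "z \<noteq> p (a + i) \<and> \<not> E z (p (a + i))" if "0 < i" "i < c - a" for i
      using that ac an fpath_eq[OF p, of _ "a + i"] fpath_edge[OF p, of _ "a + i"] by (auto simp: z_def)
  qed
qed

lemma odd_card_edges:
  assumes Y: "Y \<subset> T" "Y \<noteq> {}" "conn Y (compl V E)"
  shows "odd (card {i. i < n \<and> i \<in> K Y \<and> Suc i \<in> K Y})"
proof -
  have "odd (card {i. i < n \<and> i \<in> K Y \<and> Suc i \<in> K Y}) \<longleftrightarrow> odd n"
    by (rule card_marked_edges) (use K_ends[of Y] gap[OF Y] Y in auto)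
  then show ?thesis using n by simp
qed

lemma K_disjoint:
  assumes "x \<in> T" "i \<in> K (T - {x})" "i \<in> K {x}"
  shows "i = 0 \<or> i = n"
proof (rule ccontr)
  assume "\<not> (i = 0 \<or> i = n)"
  then have "0 < i" "i < n" using K_le[OF assms(2)] by auto
  then obtain t where "t \<in> T" "\<not> E t (p i)" using int by blast
  then show False using assms by (cases "t = x") (auto simp: K_def)
qed

text \<open>If all nearest pairs of positions from the two sets had even sum,
  \<open>card_marked_edges\<close> would apply to \<open>K (T - {x}) \<union> K {x}\<close> and give
  an odd number of marked edges. But no edge would mix the two sets, so this number would be the sum
  of two odd ones.\<close>

lemma odd_switch:
  assumes x: "x \<in> T" and Y: "T - {x} \<noteq> {}" "conn (T - {x}) (compl V E)"
  shows "\<exists>i j. 0 < i \<and> i < n \<and> 0 < j \<and> j < n \<and> i \<in> K (T - {x}) \<and> j \<in> K {x} \<and> i \<noteq> j \<and> odd (i + j) \<and>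
     (\<forall>k. min i j < k \<and> k < max i j \<longrightarrow> k \<notin> K (T - {x}) \<and> k \<notin> K {x})"
proof (rule ccontr)
  assume neg: "\<not> ?thesis"
  let ?Y = "T - {x}"
  have Y': "?Y \<subset> T" using x by auto
  have X: "{x} \<subset> T" "{x} \<noteq> {}" using x Y by auto
  note X = X conn_singleton[of x "compl V E"]
  have sw: "even (i + j)" if "i \<in> K ?Y" "j \<in> K {x}" "i \<notin> K {x}" "j \<notin> K ?Y"
    "\<And>k. min i j < k \<Longrightarrow> k < max i j \<Longrightarrow> k \<notin> K ?Y \<union> K {x}" for i j
  proof -
    have "i \<noteq> 0" "i \<noteq> n" "j \<noteq> 0" "j \<noteq> n" "i \<noteq> j" "i \<le> n" "j \<le> n"
      using that K_ends[of ?Y] K_ends[of "{x}"] X Y' K_le by auto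
    then show ?thesis using neg that by (metis Un_iff le_neq_implies_less not_gr_zero)
  qed
  let ?M = "K ?Y \<union> K {x}"
  let ?e = "\<lambda>M. {i. i < n \<and> i \<in> M \<and> Suc i \<in> M}"
  have odd: "odd (card (?e ?M)) \<longleftrightarrow> odd n"
  proof (rule card_marked_edges)
    show "0 \<in> ?M" "n \<in> ?M" using K_ends[of ?Y] Y' by auto
    fix a c assume ac: "a < c" "c \<le> n" "a \<in> ?M" "c \<in> ?M" and btw: "\<And>k. a < k \<Longrightarrow> k < c \<Longrightarrow> k \<notin> ?M"
    consider "a \<in> K ?Y" "c \<in> K ?Y" | "a \<in> K {x}" "c \<in> K {x}"
      | "a \<in> K ?Y" "c \<in> K {x}" "a \<notin> K {x}" "c \<notin> K ?Y" | "c \<in> K ?Y" "a \<in> K {x}" "c \<notin> K {x}" "a \<notin> K ?Y"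
      using ac by blast
    then show "c = Suc a \<or> even (c - a)"
    proof cases
      case 1 then show ?thesis using gap[OF Y' Y, of a c] ac btw by blast
    next
      case 2 then show ?thesis using gap[OF X, of a c] ac btw by blast
    next
      case 3 then have "even (a + c)" using sw[of a c] btw ac by (simp add: min_def max_def)
      then show ?thesis using ac by simp
    next
      case 4 then have "even (c + a)" using sw[of c a] btw ac by (simp add: min_def max_def)
      then show ?thesis using ac by simp
    qed
  qed
  have "?e ?M = ?e (K ?Y) \<union> ?e (K {x})"
  proof -
    have "\<not> (i \<in> K ?Y \<and> i \<notin> K {x} \<and> Suc i \<in> K {x} \<and> Suc i \<notin> K ?Y)" for i using sw[of i "Suc i"] by auto
    moreover have "\<not> (i \<in> K {x} \<and> i \<notin> K ?Y \<and> Suc i \<in> K ?Y \<and> Suc i \<notin> K {x})" for i using sw[of "Suc i" i] by auto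
    ultimately show ?thesis by blast
  qed
  moreover have "?e (K ?Y) \<inter> ?e (K {x}) = {}"
  proof (rule ccontr)
    assume "\<not> ?thesis"
    then obtain i where i: "i < n" "i \<in> K ?Y" "i \<in> K {x}" "Suc i \<in> K ?Y" "Suc i \<in> K {x}" by blast
    then show False using K_disjoint[OF x, of i] K_disjoint[OF x, of "Suc i"] n by auto
  qed
  ultimately have "card (?e ?M) = card (?e (K ?Y)) + card (?e (K {x}))"
    by (simp add: card_Un_disjoint)
  then show False using odd n odd_card_edges[OF Y' Y] odd_card_edges[OF X] by simp
qed

lemma segment:
  assumes "i \<le> n" "j \<le> n" "i \<noteq> j"
  shows "\<exists>u. fpath V E (max i j - min i j) u \<and> u 0 = p j \<and> u (max i j - min i j) = p i \<and>
    (\<forall>k. 0 < k \<and> k < max i j - min i j \<longrightarrow> (\<exists>m. min i j < m \<and> m < max i j \<and> u k = p m))"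
proof (cases "j < i")
  case True
  then have mm: "min i j = j" "max i j = i" by auto
  have "fpath V E (i - j) (\<lambda>k. p (j + k))" by (rule fpath_sub[OF p]) (use True assms in auto)
  moreover have "\<exists>m. j < m \<and> m < i \<and> p (j + k) = p m" if "0 < k" "k < i - j" for k
    using that by (intro exI[of _ "j + k"]) auto
  ultimately show ?thesis using True unfolding mm by (intro exI[of _ "\<lambda>k. p (j + k)"]) auto
next
  case False
  then have ij: "i < j" and mm: "min i j = i" "max i j = j" using assms by auto
  have "fpath V E (j - i) (\<lambda>k. p (i + k))" by (rule fpath_sub[OF p]) (use ij assms in auto)
  from fpath_rev[OF this] have "fpath V E (j - i) (\<lambda>k. p (i + (j - i - k)))" .
  moreover have "\<exists>m. i < m \<and> m < j \<and> p (i + (j - i - k)) = p m" if "0 < k" "k < j - i" for k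
    using that by (intro exI[of _ "i + (j - i - k)"]) auto
  ultimately show ?thesis using ij unfolding mm
    by (intro exI[of _ "\<lambda>k. p (i + (j - i - k))"]) auto
qed

text \<open>A segment beginning after position 1 avoids \<open>p 0\<close> and its neighbour; one
  ending before position \<open>n - 1\<close> avoids \<open>p n\<close> and its neighbour.\<close>

lemma far_end:
  assumes "0 < i" "i < n" "0 < j" "j < n" "\<not> (min i j = 1 \<and> max i j = n - 1)"
  shows "\<exists>e\<in>{0, n}. \<forall>m. min i j \<le> m \<and> m \<le> max i j \<longrightarrow> p e \<noteq> p m \<and> \<not> E (p e) (p m)"
proof (cases "min i j = 1")
  case True
  have "p n \<noteq> p m \<and> \<not> E (p n) (p m)" if "m \<le> max i j" for m
  proof -
    have "m \<le> n" "m \<noteq> n" "n \<noteq> Suc m" using that assms True by linarith+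
    then show ?thesis using fpath_eq[OF p, of n m] fpath_edge[OF p, of n m] by auto
  qed
  then show ?thesis by blast
next
  case False
  have "p 0 \<noteq> p m \<and> \<not> E (p 0) (p m)" if "min i j \<le> m" "m \<le> max i j" for m
  proof -
    have "m \<le> n" "m \<noteq> 0" "m \<noteq> 1" using that assms False by linarith+
    then show ?thesis using fpath_eq[OF p, of 0 m] fpath_edge[OF p, of 0 m] by auto
  qed
  then show ?thesis by blast
qed

lemma switch_path:
  assumes x: "x \<in> T" and i: "0 < i" "i < n" "i \<notin> K {x}" and j: "0 < j" "j < n" "j \<in> K {x}"
    and btw: "\<And>k. min i j < k \<Longrightarrow> k < max i j \<Longrightarrow> k \<notin> K {x}"
  shows "\<exists>q. fpath V E (Suc (max i j - min i j)) q \<and> q 0 = x \<and> q (Suc (max i j - min i j)) = p i \<and>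
    (\<forall>k. 0 < k \<and> k < Suc (max i j - min i j) \<longrightarrow> (\<exists>m. (m = j \<or> min i j < m \<and> m < max i j) \<and> q k = p m))"
proof -
  let ?d = "max i j - min i j"
  have ij: "i \<noteq> j" using i j by auto
  obtain u where u: "fpath V E ?d u" "u 0 = p j" "u ?d = p i"
    "\<And>k. 0 < k \<Longrightarrow> k < ?d \<Longrightarrow> \<exists>m. min i j < m \<and> m < max i j \<and> u k = p m"
    using segment[of i j] i j ij by auto
  let ?q = "\<lambda>i. case i of 0 \<Rightarrow> x | Suc i \<Rightarrow> u i"
  have "fpath V E (Suc ?d) ?q"
  proof (rule fpath_Cons[OF g u(1)])
    show "x \<in> V" using x TV by auto
    have um: "\<exists>m\<le>n. u k = p m \<and> (E x (p m) \<longleftrightarrow> k = 0)" if "k \<le> ?d" for k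
    proof -
      consider "k = 0" | "k = ?d" "k \<noteq> 0" | "0 < k" "k < ?d" using \<open>k \<le> ?d\<close> by linarith
      then show ?thesis
      proof cases
        case 1 then show ?thesis using u(2) j by (intro exI[of _ j]) (auto simp: K_def)
      next
        case 2 then show ?thesis using u(3) i by (intro exI[of _ i]) (auto simp: K_def)
      next
        case 3
        then obtain m where "min i j < m" "m < max i j" "u k = p m" using u(4) by blast
        then show ?thesis using 3 btw[of m] i j by (intro exI[of _ m]) (auto simp: K_def)
      qed
    qed
    show "x \<noteq> u k" if "k \<le> ?d" for k using um[OF that] pT x by auto
    show "E x (u k) \<longleftrightarrow> k = 0" if "k \<le> ?d" for k using um[OF that] by auto
  qed
  moreover have "\<exists>m. (m = j \<or> min i j < m \<and> m < max i j) \<and> ?q k = p m" if k: "0 < k" "k < Suc ?d" for k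
  proof (cases "k = 1")
    case True then show ?thesis using u(2) by auto
  next
    case False
    then obtain k' where k': "k = Suc k'" "0 < k'" "k' < ?d" using k by (cases k) auto
    then obtain m where "min i j < m \<and> m < max i j \<and> u k' = p m" using u(4) by blast
    then show ?thesis using k' by auto
  qed
  ultimately show ?thesis using u(3) by (intro exI[of _ ?q]) auto
qed

text \<open>For an odd switch \<open>i\<close>, \<open>j\<close>, the far end \<open>p e\<close>,
  then \<open>x\<close>, then the segment from \<open>p j\<close> to \<open>p i\<close> form an odd
  path whose ends, but no inner vertices, are complete to \<open>T - {x}\<close>. One end of a
  complete interior edge would see none of the inner vertices, against
  \<open>leaps_no_outside_complete\<close>.\<close>

lemma no_interior_edge:
  assumes x: "x \<in> T" and Y: "T - {x} \<noteq> {}" "conn (T - {x}) (compl V E)"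
    and k: "0 < k" "Suc k < n" "k \<in> K (T - {x})" "Suc k \<in> K (T - {x})"
  shows False
proof -
  let ?Y = "T - {x}"
  have Y': "?Y \<subset> T" using x by auto
  obtain i j where ij: "0 < i" "i < n" "0 < j" "j < n" "i \<in> K ?Y" "j \<in> K {x}" "i \<noteq> j" "odd (i + j)"
    and btw: "\<And>k. min i j < k \<Longrightarrow> k < max i j \<Longrightarrow> k \<notin> K ?Y \<and> k \<notin> K {x}"
    using odd_switch[OF x Y] by blast
  have nx: "i \<notin> K {x}" "j \<notin> K ?Y" using K_disjoint[OF x] ij by blast+
  have "\<not> (min i j = 1 \<and> max i j = n - 1)"
  proof
    assume m: "min i j = 1 \<and> max i j = n - 1"
    have "1 < k \<and> k < n - 1 \<or> 1 < Suc k \<and> Suc k < n - 1" using k n by linarith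
    then show False using btw[of k] btw[of "Suc k"] k m by auto
  qed
  then obtain e where e: "e = 0 \<or> e = n" and far: "\<And>m. min i j \<le> m \<Longrightarrow> m \<le> max i j \<Longrightarrow> p e \<noteq> p m \<and> \<not> E (p e) (p m)"
    using far_end[OF ij(1-4)] by blast
  let ?d = "max i j - min i j"
  obtain q where q: "fpath V E (Suc ?d) q" "q 0 = x" "q (Suc ?d) = p i"
    "\<And>k. 0 < k \<Longrightarrow> k < Suc ?d \<Longrightarrow> \<exists>m. (m = j \<or> min i j < m \<and> m < max i j) \<and> q k = p m"
    using switch_path[OF x ij(1,2) nx(1) ij(3,4,6)] btw by blast
  have qm: "\<exists>m. min i j \<le> m \<and> m \<le> max i j \<and> q k = p m" if k: "0 < k" "k \<le> Suc ?d" for k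
  proof (cases "k = Suc ?d")
    case True then show ?thesis using q(3) by (intro exI[of _ i]) auto
  next
    case False
    then obtain m where "m = j \<or> min i j < m \<and> m < max i j" "q k = p m" using q(4)[of k] k by auto
    then show ?thesis by (intro exI[of _ m]) auto
  qed
  have ex: "E x (p e)" "E t (p e)" if "t \<in> ?Y" for t using e ends x that by auto
  let ?q = "\<lambda>i. case i of 0 \<Rightarrow> p e | Suc i \<Rightarrow> q i"
  obtain y where y: "y \<in> ?Y" using Y by blast
  have Q: "fpath V E (Suc (Suc ?d)) ?q"
  proof (rule fpath_Cons[OF g q(1)])
    show "p e \<in> V" using e fpath_in[OF p] by auto
    show "p e \<noteq> q k" if "k \<le> Suc ?d" for k
    proof (cases "k = 0")
      case True then show ?thesis using q(2) ex(1)[OF y] graph_irrefl[OF g] by auto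
    next
      case False
      then obtain m where "min i j \<le> m" "m \<le> max i j" "q k = p m" using qm[of k] \<open>k \<le> _\<close> by auto
      then show ?thesis using far[of m] by simp
    qed
    show "E (p e) (q k) \<longleftrightarrow> k = 0" if "k \<le> Suc ?d" for k
      using that qm[of k] far q(2) graph_sym[OF g ex(1)[OF y]] by (cases "k = 0") auto
  qed
  \<comment> \<open>The neighbour of position \<open>j\<close> on the side away from
    \<open>i\<close>. It is at distance at least 2 from \<open>i\<close>, so one of
    \<open>k\<close>, \<open>Suc k\<close> avoids both; any complete position other than
    \<open>i\<close> and \<open>oj\<close> is far from all inner vertices.\<close>
  define oj where "oj = (if i < j then Suc j else j - 1)"
  obtain f where f: "0 < f" "f < n" "f \<in> K ?Y" "f \<noteq> i" "f \<noteq> oj"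
  proof -
    have "\<not> (k \<in> {i, oj} \<and> Suc k \<in> {i, oj})" using ij by (auto simp: oj_def)
    then show ?thesis using that[of k] that[of "Suc k"] k by auto
  qed
  have fm: "p f \<noteq> p m \<and> \<not> E (p f) (p m)" if m: "m = j \<or> min i j < m \<and> m < max i j" for m
  proof -
    have "f \<noteq> j" using f nx by auto
    moreover have "\<not> (min i j < f \<and> f < max i j)" using btw f by blast
    ultimately have "f \<noteq> m" "f \<noteq> Suc m" "m \<noteq> Suc f"
      using m f ij by (auto simp: oj_def min_def max_def split: if_splits)
    moreover have "m \<le> n" using m ij by (elim disjE) linarith+
    ultimately show ?thesis using fpath_eq[OF p, of f m] fpath_edge[OF p, of f m] f by auto
  qed
  show False
  proof (rule leaps_no_outside_complete[OF g b _ Y(2) IH[OF Y' Y] Q])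
    show "?Y \<subseteq> V" using TV by auto
    show "odd (Suc (Suc ?d))" using ij(8) by (auto simp: min_def max_def)
    then show "3 \<le> Suc (Suc ?d)" using ij(7) by (auto simp: min_def max_def)
    show "?q k \<notin> ?Y" if "k \<le> Suc (Suc ?d)" for k
    proof (cases k)
      case 0 then show ?thesis using e pT by auto
    next
      case (Suc k') then show ?thesis using q(2) qm[of k'] that pT ij by (cases "k' = 0") force+
    qed
    show "E t (?q 0)" if "t \<in> ?Y" for t using ex(2)[OF that] by simp
    show "E t (?q (Suc (Suc ?d)))" if "t \<in> ?Y" for t using q(3) ij that by (auto simp: K_def)
    show "p f \<in> V" using fpath_in[OF p] f by auto
    show "E t (p f)" if "t \<in> ?Y" for t using f that by (auto simp: K_def)
    \<comment> \<open>\<open>x\<close> is not complete to the rest of \<open>T\<close> because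
      \<open>T\<close> is anticonnected.\<close>
    have nbr: "\<exists>t\<in>?Y. \<not> E t x"
    proof -
      have "\<exists>u\<in>T. \<exists>w\<in>T. u = x \<and> w \<noteq> x \<and> compl V E u w"
        using conn_cross[OF graph_compl[OF g] connT, of x "\<lambda>z. z = x" y] x y by auto
      then show ?thesis using graph_sym[OF g] by (auto simp: compl_def)
    qed
    show "\<exists>t\<in>?Y. \<not> E t (?q k)" if k: "0 < k" "k < Suc (Suc ?d)" for k
    proof (cases "k = 1")
      case True then show ?thesis using nbr q(2) by simp
    next
      case False
      then obtain k' where "k = Suc k'" "0 < k'" "k' < Suc ?d" using k by (cases k) auto
      moreover from this obtain m where m: "m = j \<or> min i j < m \<and> m < max i j" "q k' = p m" using q(4) by blast
      moreover from m have "m \<notin> K ?Y" "m \<le> n" using btw nx ij by auto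
      ultimately show ?thesis by (auto simp: K_def)
    qed
    show "p f \<noteq> ?q k \<and> \<not> E (p f) (?q k)" if k: "0 < k" "k < Suc (Suc ?d)" for k
    proof (cases "k = 1")
      case True
      have "\<not> E x (p f)" using f K_disjoint[OF x, of f] by (auto simp: K_def)
      then show ?thesis using True q(2) pT[of f] f x graph_sym[OF g] by auto
    next
      case False
      then obtain k' where "k = Suc k'" "0 < k'" "k' < Suc ?d" using k by (cases k) auto
      moreover from this obtain m where "m = j \<or> min i j < m \<and> m < max i j" "q k' = p m" using q(4) by blast
      ultimately show ?thesis using fm by auto
    qed
  qed
qed

text \<open>The number of complete edges is odd, and \<open>no_interior_edge\<close> leaves only the
  first and the last edge as candidates, so exactly one of them is complete.\<close>

lemma end_edge:
  assumes x: "x \<in> T" and Y: "T - {x} \<noteq> {}" "conn (T - {x}) (compl V E)"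
  shows "1 \<in> K (T - {x}) \<longleftrightarrow> n - 1 \<notin> K (T - {x})"
    and "{i. i < n \<and> i \<in> K (T - {x}) \<and> Suc i \<in> K (T - {x})} \<subseteq> {0, n - 1}"
proof -
  let ?Y = "T - {x}"
  have Y': "?Y \<subset> T" using x by auto
  define e where "e = {i. i < n \<and> i \<in> K ?Y \<and> Suc i \<in> K ?Y}"
  have sub: "e \<subseteq> {0, n - 1}"
  proof
    fix k assume k: "k \<in> e"
    show "k \<in> {0, n - 1}"
    proof (rule ccontr)
      assume "k \<notin> {0, n - 1}"
      then have "0 < k" "Suc k < n" using k by (auto simp: e_def)
      then show False using no_interior_edge[OF x Y, of k] k by (auto simp: e_def)
    qed
  qed
  then show "{i. i < n \<and> i \<in> K (T - {x}) \<and> Suc i \<in> K (T - {x})} \<subseteq> {0, n - 1}" by (simp add: e_def)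
  have m: "0 \<in> e \<longleftrightarrow> 1 \<in> K ?Y" "n - 1 \<in> e \<longleftrightarrow> n - 1 \<in> K ?Y"
    using K_ends[of ?Y] Y' n by (auto simp: e_def)
  have o: "odd (card e)" unfolding e_def by (rule odd_card_edges[OF Y' Y])
  have "e \<noteq> {}" using o by auto
  moreover have "e \<noteq> {0, n - 1}" using o n by auto
  ultimately have "0 \<in> e \<longleftrightarrow> n - 1 \<notin> e" using sub by blast
  then show "1 \<in> K ?Y \<longleftrightarrow> n - 1 \<notin> K ?Y" using m by blast
qed

text \<open>By \<open>end_edge\<close>, two vertices \<open>x\<close>, \<open>y\<close> whose
  removal keeps \<open>T\<close> anticonnected are tied to opposite ends of the path. There is no
  room for a third one, so \<open>T\<close> is an antipath from \<open>x\<close> to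
  \<open>y\<close>. If it has two vertices, it is a leap or closes an odd hole; if it has more,
  exactly two edges are complete to \<open>T - {x, y}\<close>, against
  \<open>odd_card_edges\<close>.\<close>

lemma contradiction:
  assumes fin: "card T \<noteq> 1"
    and nl: "\<not> (\<exists>x\<in>T. \<exists>y\<in>T. x \<noteq> y \<and> \<not> E x y \<and>
        (\<forall>i. 0 < i \<and> i < n \<longrightarrow> (E x (p i) \<longleftrightarrow> i = 1) \<and> (E y (p i) \<longleftrightarrow> i = n - 1)))"
  shows False
proof -
  let ?C = "compl V E"
  note gc = graph_compl[OF g] and bc = berge_compl[OF g b]
  have finT: "finite T" using TV graph_finite[OF g] finite_subset by auto
  obtain t0 where t0: "t0 \<in> T" using int[of 1] n by auto
  have big: "{t} \<subset> T" if "t \<in> T" for t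
  proof (rule ccontr)
    assume "\<not> {t} \<subset> T"
    then have "T = {t}" using that by auto
    then show False using fin by simp
  qed
  have nonempty: "T - {t} \<noteq> {}" if "t \<in> T" for t using big[OF that] by blast
  obtain x where x: "x \<in> T" "conn (T - {x}) ?C"
    using conn_noncut[OF gc finT connT big[OF t0] _ conn_singleton] by auto
  obtain y where y: "y \<in> T" "y \<noteq> x" "conn (T - {y}) ?C"
    using conn_noncut[OF gc finT connT big[OF x(1)] _ conn_singleton] by auto
  have excl: "\<not> (i \<in> K (T - {u}) \<and> i \<in> K (T - {w}))" if "u \<noteq> w" "0 < i" "i < n" for u w i
  proof
    assume "i \<in> K (T - {u}) \<and> i \<in> K (T - {w})"
    then have "E t (p i)" if "t \<in> T" for t using that \<open>u \<noteq> w\<close> by (cases "t = u") (auto simp: K_def)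
    then show False using int[OF that(2,3)] by blast
  qed
  have n1: "0 < (1::nat)" "1 < n" "0 < n - 1" "n - 1 < n" using n by auto
  note end_x = end_edge(1)[OF x(1) nonempty[OF x(1)] x(2)] and end_y = end_edge(1)[OF y(1) nonempty[OF y(1)] y(3)]
  have "\<exists>a c. a \<in> T \<and> c \<in> T \<and> a \<noteq> c \<and> conn (T - {a}) ?C \<and> conn (T - {c}) ?C \<and> 1 \<in> K (T - {a}) \<and> n - 1 \<in> K (T - {c})"
  proof (cases "1 \<in> K (T - {x})")
    case True
    then have "n - 1 \<in> K (T - {y})" using end_y excl[OF y(2) n1(1,2)] by blast
    then show ?thesis using True x y by blast
  next
    case False
    then have "n - 1 \<in> K (T - {x})" using end_x by blast
    moreover from this have "1 \<in> K (T - {y})" using end_y excl[OF y(2) n1(3,4)] by blast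
    ultimately show ?thesis using x y by blast
  qed
  \<comment> \<open>The two vertices are renamed so that position 1 belongs to \<open>x\<close> and
    position \<open>n - 1\<close> to \<open>y\<close>.\<close>
  then obtain x y where x: "x \<in> T" "conn (T - {x}) ?C" "1 \<in> K (T - {x})"
    and y: "y \<in> T" "conn (T - {y}) ?C" "n - 1 \<in> K (T - {y})" and xy: "x \<noteq> y" by blast
  \<comment> \<open>For a third vertex \<open>z\<close>, position 1 or \<open>n - 1\<close> would be
    complete to \<open>T - {z}\<close> and also to \<open>T - {x}\<close> or \<open>T - {y}\<close>,
    hence to all of \<open>T\<close>.\<close>
  have only: "z = x \<or> z = y" if z: "z \<in> T" "conn (T - {z}) ?C" for z
    using end_edge(1)[OF z(1) nonempty[OF z(1)] z(2)] excl[OF _ n1(1,2), of z x] excl[OF _ n1(3,4), of z y] x y by blast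
  have nx: "n - 1 \<notin> K (T - {x})" "1 \<notin> K (T - {y})"
    using excl[OF xy n1(1,2)] excl[OF xy n1(3,4)] x y by blast+
  obtain Q where Q: "ipath V ?C Q" "set Q \<subseteq> T" "hd Q = x" "last Q = y"
    using conn_ipath[OF gc TV connT x(1) y(1)] by blast
  have Qne: "Q \<noteq> []" using Q(1) ipath_Nil by auto
  have dQ: "distinct Q" using Q(1) unfolding ipath_def by auto
  have QT: "set Q = T"
  proof (rule ccontr)
    assume "set Q \<noteq> T"
    then have "set Q \<subset> T" using Q by auto
    then obtain z where "z \<in> T - set Q" "conn (T - {z}) ?C"
      using conn_noncut[OF gc finT connT _ _ ipath_conn[OF gc Q(1)]] Qne by auto
    then show False using only[of z] Q Qne hd_in_set[OF Qne] last_in_set[OF Qne] by auto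
  qed
  have pV: "p i \<in> V" if "i \<le> n" for i using fpath_in[OF p that] .
  have ke: "E t (p i)" if "i \<in> K (T - {u})" "t \<in> T" "t \<noteq> u" for t u i using that by (auto simp: K_def)
  have kn: "\<not> E u (p i)" if "i \<in> K (T - {u})" "u \<in> T" "0 < i" "i < n" for u i
    using K_disjoint[OF that(2,1)] that(3,4) K_le[OF that(1)] by (auto simp: K_def)
  have cp: "?C (p i) t \<longleftrightarrow> t = u" "p i \<noteq> t"
    if "i \<in> K (T - {u})" "u \<in> T" "0 < i" "i < n" "t \<in> T" for i u t
    using ke[OF that(1,5)] kn[OF that(1-4)] pV[of i] that pT[of i] TV graph_sym_iff[OF g] by (auto simp: compl_def)
  have "length Q \<noteq> 0" using Qne by simp
  then consider "length Q = 1" | "length Q = 2" | "length Q \<ge> 3" by linarith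
  then show False
  proof cases
    case 1
    then show False using Q xy by (cases Q) auto
  next
    case 2
    then have "Q = [x, y]" using Q by (cases Q; cases "tl Q") auto
    then have T2: "T = {x, y}" "T - {x} = {y}" "T - {y} = {x}" and nxy: "\<not> E x y"
      using QT xy Q(1) by (auto simp: ipath_Cons[OF gc] compl_def)
    obtain i j where ij: "0 < i" "i < n" "0 < j" "j < n" "i \<in> K {y}" "j \<in> K {x}" "i \<noteq> j" "odd (i + j)"
      and btw: "\<And>k. min i j < k \<Longrightarrow> k < max i j \<Longrightarrow> k \<notin> K {y} \<and> k \<notin> K {x}"
      using odd_switch[OF x(1) nonempty[OF x(1)] x(2), unfolded T2(2)] by blast
    have nij: "i \<notin> K {x}" "j \<notin> K {y}" using K_disjoint[OF x(1), unfolded T2(2)] ij by blast+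
    let ?d = "max i j - min i j"
    obtain q where q: "fpath V E (Suc ?d) q" "q 0 = x" "q (Suc ?d) = p i"
      "\<And>k. 0 < k \<Longrightarrow> k < Suc ?d \<Longrightarrow> \<exists>m. (m = j \<or> min i j < m \<and> m < max i j) \<and> q k = p m"
      using switch_path[OF x(1) ij(1,2) nij(1) ij(3,4,6)] btw by blast
    have qm: "\<exists>m. min i j \<le> m \<and> m \<le> max i j \<and> q k = p m" if k: "0 < k" "k \<le> Suc ?d" for k
    proof (cases "k = Suc ?d")
      case True then show ?thesis using q(3) by (intro exI[of _ i]) auto
    next
      case False
      then obtain m where "m = j \<or> min i j < m \<and> m < max i j" "q k = p m" using q(4)[of k] k by auto
      then show ?thesis by (intro exI[of _ m]) auto
    qed
    show False
    proof (cases "min i j = 1 \<and> max i j = n - 1")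
      case True
      have "1 \<in> K {y}" "n - 1 \<in> K {x}" using x y T2 by simp_all
      have n13: "1 \<notin> K {x}" "n - 1 \<notin> K {y}" using nx T2 by simp_all
      have only: "E x (p k) \<longleftrightarrow> k = n - 1" "E y (p k) \<longleftrightarrow> k = 1" if k: "0 < k" "k < n" for k
      proof -
        consider "k = 1" | "k = n - 1" | "min i j < k" "k < max i j" using True k by linarith
        then have "(k \<in> K {x} \<longleftrightarrow> k = n - 1) \<and> (k \<in> K {y} \<longleftrightarrow> k = 1)"
          using n13 \<open>1 \<in> K {y}\<close> \<open>n - 1 \<in> K {x}\<close> btw[of k] True n by cases auto
        then show "E x (p k) \<longleftrightarrow> k = n - 1" "E y (p k) \<longleftrightarrow> k = 1" using k by (auto simp: K_def)
      qed
      have "\<not> E y x" using nxy graph_sym[OF g] by blast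
      then have "y \<noteq> x \<and> \<not> E y x \<and> (\<forall>i. 0 < i \<and> i < n \<longrightarrow> (E y (p i) \<longleftrightarrow> i = 1) \<and> (E x (p i) \<longleftrightarrow> i = n - 1))"
        using only xy by simp
      then show False using nl x(1) y(1) by meson
    next
      case False
      then obtain e where e: "e = 0 \<or> e = n" and far: "\<And>m. min i j \<le> m \<Longrightarrow> m \<le> max i j \<Longrightarrow> p e \<noteq> p m \<and> \<not> E (p e) (p m)"
        using far_end[OF ij(1-4)] by blast
      have ee: "E x (p e)" "E y (p e)" "p e \<in> V" using e ends x y pV by auto
      define q' where "q' = (\<lambda>k. if k \<le> Suc ?d then q k else y)"
      have q': "fpath V E (Suc (Suc ?d)) q'"
        unfolding q'_def
      proof (rule fpath_snoc[OF g q(1)])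
        show "y \<in> V" using y TV by auto
        show "y \<noteq> q k" if k: "k \<le> Suc ?d" for k
        proof (cases "k = 0")
          case False
          then obtain m where "m \<le> max i j" "q k = p m" using qm[of k] k by auto
          moreover have "m \<le> n" using \<open>m \<le> max i j\<close> ij by linarith
          ultimately show ?thesis using pT y(1) by auto
        qed (use q(2) xy in simp)
        show "E y (q k) \<longleftrightarrow> k = Suc ?d" if k: "k \<le> Suc ?d" for k
        proof -
          consider "k = 0" | "k = Suc ?d" | "0 < k" "k < Suc ?d" using k by linarith
          then show ?thesis
          proof cases
            case 1 then show ?thesis using nxy q(2) graph_sym[OF g] by auto
          next
            case 2 then show ?thesis using q(3) ij by (auto simp: K_def)
          next
            case 3
            then obtain m where m: "m = j \<or> min i j < m \<and> m < max i j" "q k = p m" using q(4) by blast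
            have "m \<le> n" using m ij by (elim disjE) linarith+
            moreover have "m \<notin> K {y}" using m btw nij by blast
            ultimately show ?thesis using m 3 by (auto simp: K_def)
          qed
        qed
      qed
      have pq: "p e \<noteq> q k \<and> \<not> E (p e) (q k)" if k: "0 < k" "k \<le> Suc ?d" for k
      proof -
        obtain m where "min i j \<le> m" "m \<le> max i j" "q k = p m" using qm[OF k] by blast
        then show ?thesis using far[of m] by simp
      qed
      have "even (Suc (Suc ?d))"
      proof (rule fpath_close[OF g b q' _ ee(3)])
        show "p e \<noteq> q' k" if "k \<le> Suc (Suc ?d)" for k
          using pq[of k] q(2) ee(1,2) graph_irrefl[OF g] that by (cases "k = 0") (auto simp: q'_def)
        show "E (p e) (q' k) \<longleftrightarrow> k = 0 \<or> k = Suc (Suc ?d)" if "k \<le> Suc (Suc ?d)" for k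
          using pq[of k] q(2) graph_sym[OF g ee(1)] graph_sym[OF g ee(2)] that by (cases "k = 0") (auto simp: q'_def)
      qed simp
      then show False using ij(8) by (auto simp: min_def max_def split: if_splits)
    qed
  next
    case 3
    have path1: "ipath V ?C (p i # Q)" if i: "i \<in> K (T - {x})" "0 < i" "i < n" for i
      using cp[OF i(1) x(1) i(2,3)] QT Q(3) pV[of i] i pT[of i]
      by (intro ipath_ConsI[OF gc Q(1)]) auto
    have "?C (p (n - 1)) (p 1)"
      using fpath_edge[OF p, of "n - 1" 1] fpath_eq[OF p, of "n - 1" 1] pV n by (auto simp: compl_iff)
    \<comment> \<open>Within \<open>T\<close>, \<open>p 1\<close> misses only \<open>x\<close> and
      \<open>p (n - 1)\<close> misses only \<open>y\<close>; with \<open>Q\<close> they form an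
      antihole with \<open>length Q + 2\<close> vertices.\<close>
    then have "odd (length (p 1 # Q))"
      using cp[OF y(3) y(1) n1(3,4)] QT Q(4) pV[of "n - 1"] Qne 3 fpath_eq[OF p, of "n - 1" 1] n
      by (intro berge_close[OF gc bc path1[OF x(3) n1(1,2)], of "p (n - 1)"]) auto
    then have evQ: "even (length Q)" by simp
    let ?Y = "T - {x, y}"
    obtain Q' where Q': "Q = x # Q' @ [y]"
    proof -
      obtain ws where ws: "Q = x # ws" using Qne Q(3) by (cases Q) auto
      then have "ws \<noteq> []" "last ws = y" using 3 Q(4) by auto
      then have "ws = butlast ws @ [y]" by (metis append_butlast_last_id)
      then show ?thesis using that ws by blast
    qed
    have Y: "?Y = set Q'" using dQ QT Q' by auto
    have Q'ne: "Q' \<noteq> []" using 3 Q' by auto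
    have ipQ': "ipath V ?C Q'"
    proof -
      have "Q' = take (length Q') (drop 1 Q)" using Q' by simp
      moreover have "ipath V ?C (take (length Q') (drop 1 Q))"
        using 3 Q'ne by (intro ipath_take ipath_drop[OF Q(1)]) auto
      ultimately show ?thesis by simp
    qed
    have YT: "?Y \<subset> T" "?Y \<noteq> {}" "conn ?Y ?C"
      using x(1) Q'ne Y ipath_conn[OF gc ipQ'] by auto
    \<comment> \<open>Otherwise \<open>p i\<close> misses exactly the two ends of \<open>Q\<close>
      and closes it to an antihole with \<open>length Q + 1\<close> vertices, an odd number.\<close>
    have KY: "i \<in> K (T - {x}) \<or> i \<in> K (T - {y})" if i: "i \<in> K ?Y" for i
    proof (rule ccontr)
      assume n': "\<not> ?thesis"
      have "0 < i" "i < n" using n' K_ends[of "T - {x}"] K_le[OF i] by (cases "i = 0"; cases "i = n"; auto)+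
      have nn: "\<not> E x (p i)" "\<not> E y (p i)" using n' i by (auto simp: K_def)
      have adj: "?C (p i) t \<longleftrightarrow> t = x \<or> t = y" "p i \<noteq> t" if "t \<in> T" for t
        using nn i that pV[of i] TV pT[of i] \<open>i < n\<close> graph_sym_iff[OF g] by (auto simp: compl_def K_def)
      have "odd (length Q)"
        using adj QT Q pV[of i] \<open>i < n\<close> 3
        by (intro berge_close[OF gc bc Q(1), of "p i"]) auto
      then show False using evQ by simp
    qed
    \<comment> \<open>The antipath \<open>p i, Q, p j\<close> would be closed by the far end
      \<open>p e\<close>, which is complete to \<open>T\<close>, to an antihole with
      \<open>length Q + 3\<close> vertices.\<close>
    have cross: False if i: "i \<in> K (T - {x})" "0 < i" "i < n" and j: "j \<in> K (T - {y})" "0 < j" "j < n"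
      and adj: "j = Suc i \<or> i = Suc j" for i j
    proof -
      have "\<not> (min i j = 1 \<and> max i j = n - 1)" using adj n by linarith
      then obtain e where e: "e = 0 \<or> e = n"
        and "\<forall>m. min i j \<le> m \<and> m \<le> max i j \<longrightarrow> p e \<noteq> p m \<and> \<not> E (p e) (p m)"
        using far_end[OF i(2,3) j(2,3)] by blast
      then have far: "p e \<noteq> p i" "\<not> E (p e) (p i)" "p e \<noteq> p j" "\<not> E (p e) (p j)" by simp_all
      have pe: "\<not> ?C (p e) t" "p e \<noteq> t" if "t \<in> T" for t
        using e ends[OF that] pT[of e] that graph_sym[OF g] by (auto simp: compl_def)
      have "p j \<noteq> p i" "\<not> ?C (p j) (p i)"
        using adj fpath_eq[OF p, of j i] fpath_edge[OF p, of j i] i j by (auto simp: compl_def)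
      moreover have "p j \<in> V" "p i \<in> V" "p e \<in> V" using e pV i j by auto
      moreover have "last (p i # Q) = y" using Qne Q(4) by simp
      ultimately have pth: "ipath V ?C ((p i # Q) @ [p j])"
        using cp[OF j(1) y(1) j(2,3)] QT pT[of i] i y(1)
        by (intro ipath_snocI[OF gc path1[OF i]]) (auto simp del: last.simps)
      have "odd (length ((p i # Q) @ [p j]))"
      proof (rule berge_close[OF gc bc pth])
        show "3 \<le> length ((p i # Q) @ [p j])" using 3 by simp
        show "p e \<in> V" by fact
        show "p e \<notin> set ((p i # Q) @ [p j])" using pe far QT by auto
        have "?C (p e) (p i)" "?C (p e) (p j)"
          using far \<open>p e \<in> V\<close> \<open>p i \<in> V\<close> \<open>p j \<in> V\<close> by (auto simp: compl_iff)
        moreover have "p i \<notin> T" "p j \<notin> T" using pT i j by auto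
        ultimately show "?C (p e) z \<longleftrightarrow> z = hd ((p i # Q) @ [p j]) \<or> z = last ((p i # Q) @ [p j])"
          if "z \<in> set ((p i # Q) @ [p j])" for z
          using that pe QT by auto
      qed
      then show False using evQ by simp
    qed
    have edges: "{i. i < n \<and> i \<in> K ?Y \<and> Suc i \<in> K ?Y} = {0, n - 1}"
    proof
      have sub: "K (T - {x}) \<subseteq> K ?Y" "K (T - {y}) \<subseteq> K ?Y" by (auto simp: K_def)
      show "{0, n - 1} \<subseteq> {i. i < n \<and> i \<in> K ?Y \<and> Suc i \<in> K ?Y}"
        using sub x(3) y(3) K_ends[of ?Y] n by auto
      show "{i. i < n \<and> i \<in> K ?Y \<and> Suc i \<in> K ?Y} \<subseteq> {0, n - 1}"
      proof
        fix i assume "i \<in> {i. i < n \<and> i \<in> K ?Y \<and> Suc i \<in> K ?Y}"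
        then have i: "i < n" "i \<in> K ?Y" "Suc i \<in> K ?Y" by auto
        show "i \<in> {0, n - 1}"
        proof (rule ccontr)
          assume "i \<notin> {0, n - 1}"
          then have i': "0 < i" "Suc i < n" using i by auto
          consider "i \<in> K (T - {x})" "Suc i \<in> K (T - {x})" | "i \<in> K (T - {y})" "Suc i \<in> K (T - {y})"
            | "i \<in> K (T - {x})" "Suc i \<in> K (T - {y})" | "i \<in> K (T - {y})" "Suc i \<in> K (T - {x})"
            using KY[OF i(2)] KY[OF i(3)] by blast
          then show False
          proof cases
            case 1 then show False using no_interior_edge[OF x(1) nonempty[OF x(1)] x(2) i'] by blast
          next
            case 2 then show False using no_interior_edge[OF y(1) nonempty[OF y(1)] y(2) i'] by blast
          next
            case 3 then show False using cross[of i "Suc i"] i' by auto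
          next
            case 4 then show False using cross[of "Suc i" i] i' by auto
          qed
        qed
      qed
    qed
    have "odd (card {0, n - 1})" using odd_card_edges[OF YT] unfolding edges .
    then show False using n by simp
  qed
qed

end

text \<open>A smallest \<open>T\<close> without leaps satisfies \<open>minimal_no_leap\<close>: if a
  proper anticonnected subset had no complete interior vertex, it would have a leap on the same
  path, and this is a leap for \<open>T\<close>. A single vertex \<open>t\<close> would close the
  path to an odd hole, so \<open>T\<close> has at least two vertices.\<close>

lemma leaps_anticonnected:
  assumes g: "graph V E" and b: "berge V E" and "T \<subseteq> V" "T \<noteq> {}" "conn T (compl V E)"
  shows "leaps V E T"
  using assms(3-)
proof (induction "card T" arbitrary: T rule: less_induct)
  case less
  have finT: "finite T" using less.prems graph_finite[OF g] finite_subset by auto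
  show ?case
    unfolding leaps_def
  proof (intro allI impI, elim conjE)
    fix n p
    assume p: "fpath V E n p" and n: "odd n" "5 \<le> n" and pT: "\<forall>i\<le>n. p i \<notin> T"
      and ends: "\<forall>t\<in>T. E t (p 0) \<and> E t (p n)" and int: "\<forall>i. 0 < i \<and> i < n \<longrightarrow> (\<exists>t\<in>T. \<not> E t (p i))"
    have IH: "leaps V E Y" if "Y \<subset> T" "Y \<noteq> {}" "conn Y (compl V E)" for Y
      using less.hyps[of Y] that less.prems finT psubset_card_mono by blast
    let ?goal = "\<lambda>T. \<exists>x\<in>T. \<exists>y\<in>T. x \<noteq> y \<and> \<not> E x y \<and>
        (\<forall>i. 0 < i \<and> i < n \<longrightarrow> (E x (p i) \<longleftrightarrow> i = 1) \<and> (E y (p i) \<longleftrightarrow> i = n - 1))"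
    show "?goal T"
    proof (rule ccontr)
      assume neg: "\<not> ?goal T"
      have min: "\<exists>i. 0 < i \<and> i < n \<and> (\<forall>y\<in>Y. E y (p i))" if Y: "Y \<subset> T" "Y \<noteq> {}" "conn Y (compl V E)" for Y
      proof (rule ccontr)
        assume a: "\<not> ?thesis"
        have "?goal Y"
          by (rule IH[OF Y, unfolded leaps_def, rule_format]) (use p n pT ends a Y in auto)
        then show False using neg Y by blast
      qed
      interpret minimal_no_leap V E T n p
        by unfold_locales (use g b less.prems p n pT ends int IH min in auto)
      have "card T \<noteq> 1"
      proof
        assume "card T = 1"
        then obtain t where t: "T = {t}" by (auto simp: card_1_singleton_iff)
        have "even n"
        proof (rule fpath_close[OF g b p])
          show "E t (p i) \<longleftrightarrow> i = 0 \<or> i = n" if "i \<le> n" for i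
            using t ends int that by (cases "i = 0"; cases "i = n") auto
        qed (use t n less.prems pT in auto)
        then show False using n by simp
      qed
      then show False using contradiction neg by blast
    qed
  qed
qed

section \<open>Skew partitions\<close>

lemma ipath_snoc_iff:
  assumes g: "graph V E" and I: "I \<noteq> []"
  shows "ipath V E (I @ [y]) \<longleftrightarrow> ipath V E I \<and> y \<in> V \<and> y \<notin> set I \<and> (\<forall>i\<in>set I. E y i \<longleftrightarrow> i = last I)"
proof -
  obtain j J where J: "rev I = j # J" using I by (cases "rev I") auto
  then have I': "I = rev (j # J)" by (metis rev_rev_ident)
  have r: "ipath V E (rev xs) \<longleftrightarrow> ipath V E xs" for xs using ipath_rev[OF g] by (metis rev_rev_ident)
  have "ipath V E (I @ [y]) \<longleftrightarrow> ipath V E (y # j # J)" using r[of "y # j # J"] I' by simp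
  also have "\<dots> \<longleftrightarrow> y \<in> V \<and> ipath V E (j # J) \<and> y \<notin> set I \<and> (\<forall>i\<in>set I. E y i \<longleftrightarrow> i = last I)"
    using I' by (auto simp: ipath_Cons[OF g])
  finally show ?thesis using r[of "j # J"] I' by auto
qed

lemma ipath_ends_iff:
  assumes g: "graph V E" and I: "I \<noteq> []"
  shows "ipath V E (x # I @ [y]) \<longleftrightarrow> ipath V E I \<and> x \<in> V \<and> y \<in> V \<and> x \<notin> set I \<and> y \<notin> set I \<and> x \<noteq> y \<and>
    \<not> E x y \<and> (\<forall>i\<in>set I. (E x i \<longleftrightarrow> i = hd I) \<and> (E y i \<longleftrightarrow> i = last I))"
proof -
  obtain j J where J: "I = j # J" using I by (cases I) auto
  have "ipath V E (x # I @ [y]) \<longleftrightarrow> x \<in> V \<and> ipath V E (I @ [y]) \<and> x \<notin> set (I @ [y]) \<and>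
    (\<forall>z\<in>set (I @ [y]). E x z \<longleftrightarrow> z = j)"
    unfolding J by (simp only: append_Cons ipath_Cons[OF g])
  also have "\<dots> \<longleftrightarrow> x \<in> V \<and> ipath V E (I @ [y]) \<and> x \<notin> set I \<and> x \<noteq> y \<and> (y \<notin> set I \<longrightarrow> \<not> E x y) \<and> (\<forall>z\<in>set I. E x z \<longleftrightarrow> z = hd I)"
    unfolding ipath_snoc_iff[OF g I] using J by auto
  finally show ?thesis unfolding ipath_snoc_iff[OF g I] by blast
qed

lemma ipath_append:
  assumes g: "graph V E" and "ipath V E xs" "ipath V E ys" "set xs \<inter> set ys = {}"
    and "\<And>x y. x \<in> set xs \<Longrightarrow> y \<in> set ys \<Longrightarrow> E x y \<longleftrightarrow> x = last xs \<and> y = hd ys"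
  shows "ipath V E (xs @ ys)"
  using assms(2,4,5)
proof (induction xs)
  case Nil then show ?case by (simp add: ipath_Nil)
next
  case (Cons x xs)
  show ?case
  proof (cases "xs = []")
    case True
    have "x \<in> V" using Cons.prems(1) by (simp add: ipath_def)
    then have "ipath V E (x # ys)"
      using Cons.prems(2,3) True by (intro ipath_ConsI[OF g assms(3)]) auto
    then show ?thesis using True by simp
  next
    case False
    then obtain y zs where xs: "xs = y # zs" by (cases xs) auto
    have "ipath V E (xs @ ys)" using Cons xs by (auto simp: ipath_Cons[OF g])
    moreover have "x \<notin> set (xs @ ys)" "\<And>z. z \<in> set (xs @ ys) \<Longrightarrow> E x z \<longleftrightarrow> z = y" "x \<in> V"
    proof -
      show "x \<notin> set (xs @ ys)" "x \<in> V" using Cons.prems xs by (auto simp: ipath_Cons[OF g])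
      have "x \<noteq> last (x # xs)" using Cons.prems(1) False unfolding ipath_def by auto
      then show "E x z \<longleftrightarrow> z = y" if "z \<in> set (xs @ ys)" for z
        using that Cons.prems xs by (auto simp: ipath_Cons[OF g])
    qed
    ultimately show ?thesis unfolding xs by (simp add: ipath_Cons[OF g])
  qed
qed

text \<open>The two paths together form a hole with \<open>length I + length J + 2\<close> vertices.
  For \<open>berge_close\<close> one vertex is taken out: the only one of \<open>J\<close>, or its
  first one.\<close>

lemma two_paths_parity:
  assumes g: "graph V E" and b: "berge V E" and P: "ipath V E (x # I @ [y])" and Q: "ipath V E (x # J @ [y])"
    and ne: "I \<noteq> []" "J \<noteq> []" and dis: "set I \<inter> set J = {}" and anti: "\<And>i j. i \<in> set I \<Longrightarrow> j \<in> set J \<Longrightarrow> \<not> E i j"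
  shows "even (length I + length J)"
proof -
  note P' = P[unfolded ipath_ends_iff[OF g ne(1)]] and Q' = Q[unfolded ipath_ends_iff[OF g ne(2)]]
  have sym: "E u w \<longleftrightarrow> E w u" for u w by (rule graph_sym_iff[OF g])
  show ?thesis
  proof (cases "length J = 1")
    case True
    then obtain j where j: "J = [j]" by (cases J) auto
    have jj: "j \<in> V" "j \<noteq> x" "j \<noteq> y" "E j x" "E j y"
    proof -
      have "E x j" "E y j" using Q' j by auto
      then show "E j x" "E j y" using sym by blast+
      show "j \<in> V" "j \<noteq> x" "j \<noteq> y" using Q' j by (auto simp: ipath_def)
    qed
    have jI: "j \<notin> set I" "\<not> E j i" if "i \<in> set I" for i
      using dis anti[OF that, of j] j sym[of i j] that by auto
    have "odd (length (x # I @ [y]))"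
    proof (rule berge_close[OF g b P])
      show "3 \<le> length (x # I @ [y])" using ne(1) by (cases I) auto
      show "j \<notin> set (x # I @ [y])" using jj jI by auto
      show "E j z \<longleftrightarrow> z = hd (x # I @ [y]) \<or> z = last (x # I @ [y])" if "z \<in> set (x # I @ [y])" for z
        using that jj jI P' by auto
    qed (rule jj)
    then show ?thesis using j by simp
  next
    case False
    then obtain j J' where J: "J = j # J'" "J' \<noteq> []" using ne by (cases J) auto
    have pJ: "ipath V E (rev J')" and jn: "j \<notin> set J'" and jV: "j \<in> V" and jJ: "\<forall>z\<in>set J'. E j z \<longleftrightarrow> z = hd J'"
    proof -
      obtain j' J'' where J'': "J' = j' # J''" using J by (cases J') auto
      have "ipath V E (j # j' # J'')" using Q' J J'' by blast
      then have *: "ipath V E J'" "j \<notin> set J'" "j \<in> V" "\<forall>z\<in>set J'. E j z \<longleftrightarrow> z = hd J'"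
        unfolding ipath_Cons[OF g] J'' by simp_all
      then show "ipath V E (rev J')" by (intro ipath_rev[OF g])
      show "j \<notin> set J'" "j \<in> V" "\<forall>z\<in>set J'. E j z \<longleftrightarrow> z = hd J'" by fact+
    qed
    have "ipath V E ((x # I @ [y]) @ rev J')"
    proof (rule ipath_append[OF g P pJ])
      show "set (x # I @ [y]) \<inter> set (rev J') = {}" using Q' dis J by auto
      show "E u w \<longleftrightarrow> u = last (x # I @ [y]) \<and> w = hd (rev J')" if u: "u \<in> set (x # I @ [y])" and w: "w \<in> set (rev J')" for u w
      proof -
        have wJ: "w \<in> set J" "w \<noteq> j" using w J jn by auto
        have h: "hd (rev J') = last J" "hd J = j" using J by (simp_all add: hd_rev)
        have "E x w \<longleftrightarrow> w = j" "E y w \<longleftrightarrow> w = last J" using Q' wJ(1) h by auto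
        moreover have "u \<noteq> y" "\<not> E u w" if "u \<in> set I" using that P' anti wJ by auto
        ultimately show ?thesis using u wJ(2) P' unfolding h by auto
      qed
    qed
    then have "odd (length ((x # I @ [y]) @ rev J'))"
    proof (rule berge_close[OF g b])
      show "j \<in> V" "j \<notin> set ((x # I @ [y]) @ rev J')" using jV Q' dis J jn by auto
      show "E j z \<longleftrightarrow> z = hd ((x # I @ [y]) @ rev J') \<or> z = last ((x # I @ [y]) @ rev J')"
        if "z \<in> set ((x # I @ [y]) @ rev J')" for z
      proof -
        have l: "last ((x # I @ [y]) @ rev J') = hd J'" using J by (simp add: last_rev)
        have h: "hd J' \<in> set J'" using J by simp
        have jE: "j \<in> set J" "hd J = j" "last J \<in> set J'" using J by auto
        have "E x j" "\<not> E y j" using Q' jE jn by auto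
        then have jxy: "E j x" "\<not> E j y" using sym by blast+
        have hn: "hd J' \<noteq> x" "hd J' \<noteq> y" "hd J' \<notin> set I" "x \<notin> set J'" using h Q' dis J by auto
        consider "z = x" | "z = y" | "z \<in> set I" | "z \<in> set J'" using \<open>z \<in> _\<close> by auto
        then have "E j z \<longleftrightarrow> z = x \<or> z = hd J'"
        proof cases
          case 1 then show ?thesis using jxy by simp
        next
          case 2 then show ?thesis using jxy hn P' by auto
        next
          case 3
          then have "\<not> E j z" using anti[OF 3 jE(1)] sym by blast
          then show ?thesis using 3 hn P' by auto
        next
          case 4 then show ?thesis using jJ hn by auto
        qed
        then show ?thesis unfolding l by simp
      qed
      show "3 \<le> length ((x # I @ [y]) @ rev J')" using ne(1) by (cases I) auto
    qed
    then show ?thesis using J by simp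
  qed
qed

text \<open>There are \<open>length I + 1\<close> edges, and a nonempty \<open>I\<close> of even
  length makes this at least 3. The ends are then non-adjacent, so the same predicate describes the
  odd paths and, in the complement, the odd antipaths that balance forbids.\<close>

definition odd_path :: "'a set \<Rightarrow> ('a \<Rightarrow> 'a \<Rightarrow> bool) \<Rightarrow> 'a \<Rightarrow> 'a list \<Rightarrow> 'a \<Rightarrow> bool" where
  "odd_path V E x I y \<longleftrightarrow> ipath V E (x # I @ [y]) \<and> I \<noteq> [] \<and> even (length I)"

lemma odd_pathD:
  assumes "graph V E" "odd_path V E x I y"
  shows "ipath V E I" "x \<in> V" "y \<in> V" "x \<notin> set I" "y \<notin> set I" "x \<noteq> y" "\<not> E x y" "set I \<subseteq> V" "I \<noteq> []" "even (length I)"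
    "hd I \<in> set I" "last I \<in> set I" "hd I \<noteq> last I" "conn (set I) E"
    "\<And>i. i \<in> set I \<Longrightarrow> E x i \<longleftrightarrow> i = hd I" "\<And>i. i \<in> set I \<Longrightarrow> E y i \<longleftrightarrow> i = last I"
proof -
  have ne: "I \<noteq> []" "even (length I)" and p: "ipath V E (x # I @ [y])" using assms(2) by (auto simp: odd_path_def)
  note P = p[unfolded ipath_ends_iff[OF assms(1) ne(1)]]
  show "ipath V E I" "x \<in> V" "y \<in> V" "x \<notin> set I" "y \<notin> set I" "x \<noteq> y" "\<not> E x y" "I \<noteq> []" "even (length I)"
    "hd I \<in> set I" "last I \<in> set I" using P ne by auto
  show "set I \<subseteq> V" using P by (auto simp: ipath_def)
  show "conn (set I) E" using P ipath_conn[OF assms(1)] by blast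
  show "\<And>i. i \<in> set I \<Longrightarrow> E x i \<longleftrightarrow> i = hd I" "\<And>i. i \<in> set I \<Longrightarrow> E y i \<longleftrightarrow> i = last I" using P by auto
  have "distinct I" using P by (auto simp: ipath_def)
  then show "hd I \<noteq> last I" using ne
    by (cases I) auto
qed

lemma odd_path_close:
  assumes g: "graph V E" and b: "berge V E" and P: "odd_path V E x I y"
    and z: "z \<in> V" "z \<notin> set I" "E z x" "E z y" "\<And>i. i \<in> set I \<Longrightarrow> \<not> E z i"
  shows False
proof -
  note D = odd_pathD[OF g P]
  have "odd (length (x # I @ [y]))"
  proof (rule berge_close[OF g b])
    show "ipath V E (x # I @ [y])" using P by (simp add: odd_path_def)
    show "3 \<le> length (x # I @ [y])" using D(9) by (cases I) auto
  qed (use z graph_irrefl[OF g] in auto)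
  then show False using D(10) by simp
qed

text \<open>Reroutes an odd path through another connected set; \<open>two_paths_parity\<close>
  keeps the length odd. This carries bad paths from one side of a skew partition to the
  other.\<close>

lemma odd_path_conn:
  assumes g: "graph V E" and b: "berge V E" and P: "odd_path V E x I y"
    and S: "S \<subseteq> V" "conn S E" "x \<notin> S" "y \<notin> S" "s \<in> S" "E x s" "t \<in> S" "E y t"
    and anti: "set I \<inter> S = {}" "\<And>i j. i \<in> set I \<Longrightarrow> j \<in> S \<Longrightarrow> \<not> E i j"
  shows "\<exists>J. odd_path V E x J y \<and> set J \<subseteq> S"
proof -
  note D = odd_pathD[OF g P]
  obtain J where J: "ipath V E (x # J @ [y])" "set J \<subseteq> S" "J \<noteq> []"
    using conn_ipath_through[OF g S(1,2) D(2) S(3) D(3) S(4) D(6,7) S(5-8)] by blast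
  have "even (length I + length J)"
    by (rule two_paths_parity[OF g b _ J(1) D(9) J(3)]) (use P anti J in \<open>auto simp: odd_path_def\<close>)
  then show ?thesis using J D(10) by (auto simp: odd_path_def)
qed

text \<open>The outcomes come from length 3 and from length at least 5. Of a leap only the odd path
  with unchanged interior and new ends in \<open>T\<close> is retained, which is what the balance
  arguments consume.\<close>

lemma Roussel_Rubio_weak:
  assumes g: "graph V E" and b: "berge V E" and T: "T \<subseteq> V" "T \<noteq> {}" "conn T (compl V E)"
    and P: "odd_path V E x I y" and dis: "x \<notin> T" "y \<notin> T" "set I \<inter> T = {}"
    and ends: "\<And>t. t \<in> T \<Longrightarrow> E t x" "\<And>t. t \<in> T \<Longrightarrow> E t y"
    and int: "\<And>i. i \<in> set I \<Longrightarrow> \<exists>t\<in>T. \<not> E t i"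
  obtains R where "odd_path V (compl V E) (hd I) R (last I)" "set R \<subseteq> T" "E (hd I) (last I)"
    | u w where "u \<in> T" "w \<in> T" "odd_path V E u I w"
proof -
  let ?vs = "x # I @ [y]" and ?n = "Suc (length I)"
  note D = odd_pathD[OF g P]
  have p: "ipath V E ?vs" using P by (simp add: odd_path_def)
  have fp: "fpath V E ?n (nth ?vs)" using ipath_fpath[OF p] by simp
  have vs: "?vs ! 0 = x" "?vs ! ?n = y" "\<And>i. 0 < i \<Longrightarrow> i < ?n \<Longrightarrow> ?vs ! i = I ! (i - 1)"
    by (auto simp: nth_Cons' nth_append)
  have vT: "?vs ! i \<notin> T" if "i \<le> ?n" for i
  proof -
    have "?vs ! i \<in> set ?vs" using that by (intro nth_mem) auto
    then show ?thesis using dis by auto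
  qed
  have vI: "\<exists>t\<in>T. \<not> E t (?vs ! i)" if "0 < i" "i < ?n" for i
    using int[of "I ! (i - 1)"] vs(3)[OF that] that by simp
  have ev: "even (length I)" "I \<noteq> []" using D by auto
  show thesis
  proof (cases "length I = 2")
    case True
    then obtain i1 i2 where I: "I = [i1, i2]" by (cases I; cases "tl I") auto
    have n3: "?n = 3" using I by simp
    obtain t1 t2 where t: "t1 \<in> T" "\<not> E t1 (?vs ! 1)" "t2 \<in> T" "\<not> E t2 (?vs ! 2)"
      using vI[of 1] vI[of 2] n3 by auto
    have "\<exists>R. ipath V (compl V E) (?vs ! 1 # R @ [?vs ! 2]) \<and> set R \<subseteq> T \<and> R \<noteq> [] \<and> even (length R)"
    proof (rule Roussel_Rubio_3[OF g b fp[unfolded n3] T(1,3)])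
      show "t \<noteq> ?vs ! i" if "t \<in> T" "i \<le> 3" for t i using vT[of i] that n3 by auto
      show "E t (?vs ! 0)" "E t (?vs ! 3)" if "t \<in> T" for t using ends[OF that] I by auto
    qed (use t in auto)
    then obtain R where "ipath V (compl V E) (i1 # R @ [i2])" "set R \<subseteq> T" "R \<noteq> []" "even (length R)"
      using I by auto
    moreover have "E i1 i2" using D(1) I by (simp add: ipath_Cons[OF g])
    ultimately show thesis using that(1)[of R] I by (simp add: odd_path_def)
  next
    case False
    have "length I \<noteq> 0" using ev by simp
    then have n5: "?n \<ge> 5" "odd ?n" using ev(1) False by presburger+
    have lp: "leaps V E T" by (rule leaps_anticonnected[OF g b T])
    define q m where "q = nth ?vs" and "m = ?n"
    have q: "fpath V E m q" "odd m" "m \<ge> 5" "\<forall>i\<le>m. q i \<notin> T" "\<forall>t\<in>T. E t (q 0) \<and> E t (q m)"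
      "\<forall>i. 0 < i \<and> i < m \<longrightarrow> (\<exists>t\<in>T. \<not> E t (q i))"
    proof -
      show "fpath V E m q" "odd m" "m \<ge> 5" unfolding q_def m_def by (fact fp n5)+
      show "\<forall>i\<le>m. q i \<notin> T" "\<forall>i. 0 < i \<and> i < m \<longrightarrow> (\<exists>t\<in>T. \<not> E t (q i))"
        unfolding q_def m_def using vT vI by blast+
      have "q 0 = x" "q m = y" unfolding q_def m_def by (fact vs(1,2))+
      then show "\<forall>t\<in>T. E t (q 0) \<and> E t (q m)" using ends by simp
    qed
    then have "\<exists>u\<in>T. \<exists>w\<in>T. u \<noteq> w \<and> \<not> E u w \<and>
        (\<forall>i. 0 < i \<and> i < m \<longrightarrow> (E u (q i) \<longleftrightarrow> i = 1) \<and> (E w (q i) \<longleftrightarrow> i = m - 1))"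
      using lp unfolding leaps_def by blast
    then have "\<exists>u\<in>T. \<exists>w\<in>T. u \<noteq> w \<and> \<not> E u w \<and>
        (\<forall>i. 0 < i \<and> i < ?n \<longrightarrow> (E u (?vs ! i) \<longleftrightarrow> i = 1) \<and> (E w (?vs ! i) \<longleftrightarrow> i = ?n - 1))"
      unfolding q_def m_def .
    then obtain u w where uw: "u \<in> T" "w \<in> T" "u \<noteq> w" "\<not> E u w"
      and adj: "\<And>i. 0 < i \<Longrightarrow> i < ?n \<Longrightarrow> (E u (?vs ! i) \<longleftrightarrow> i = 1) \<and> (E w (?vs ! i) \<longleftrightarrow> i = ?n - 1)" by blast
    have dI: "distinct I" using D(1) by (simp add: ipath_def)
    have "(E u i \<longleftrightarrow> i = hd I) \<and> (E w i \<longleftrightarrow> i = last I)" if i: "i \<in> set I" for i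
    proof -
      obtain k where k: "k < length I" "i = I ! k" using i by (metis in_set_conv_nth)
      have "(E u i \<longleftrightarrow> k = 0) \<and> (E w i \<longleftrightarrow> k = length I - 1)"
        using adj[of "Suc k"] vs(3)[of "Suc k"] k n5(1) by auto
      moreover have "i = hd I \<longleftrightarrow> k = 0" "i = last I \<longleftrightarrow> k = length I - 1"
        using k dI ev n5(1) by (auto simp: hd_conv_nth last_conv_nth nth_eq_iff_index_eq)
      ultimately show ?thesis by simp
    qed
    moreover have "u \<notin> set I" "w \<notin> set I" "u \<in> V" "w \<in> V" using uw dis T by auto
    ultimately have "odd_path V E u I w"
      using uw D(1) ev by (auto simp: odd_path_def ipath_ends_iff[OF g])
    then show thesis using that(2) uw by blast
  qed
qed

text \<open>Translates the \<open>hd\<close>/\<open>last\<close> form of balance into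
  \<open>odd_path\<close>. A single edge is no candidate because the ends are required to be
  non-adjacent in the graph concerned, so an interior always exists.\<close>

lemma balanced_skew_partitionI:
  assumes "A \<union> B = V" "A \<inter> B = {}" "disconnected A E" "disconnected B (compl V E)"
    and path: "\<And>x I y. odd_path V E x I y \<Longrightarrow> x \<in> B \<Longrightarrow> y \<in> B \<Longrightarrow> set I \<subseteq> A \<Longrightarrow> False"
    and antipath: "\<And>x I y. odd_path V (compl V E) x I y \<Longrightarrow> x \<in> A \<Longrightarrow> y \<in> A \<Longrightarrow> set I \<subseteq> B \<Longrightarrow> False"
    and g: "graph V E"
  shows "balanced_skew_partition V E"
proof -
  have *: "\<exists>x I y. vs = x # I @ [y] \<and> odd_path V F x I y"
    if F: "graph V F" "ipath V F vs" "odd (length vs - 1)" "\<not> F (hd vs) (last vs)" for F :: "'a \<Rightarrow> 'a \<Rightarrow> bool" and vs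
  proof -
    obtain x ws where x: "vs = x # ws" using F(3) by (cases vs) auto
    then have "ws \<noteq> []" using F(3) by auto
    then obtain I y where y: "ws = I @ [y]" by (metis append_butlast_last_id)
    have "I \<noteq> []" using F x y by (auto simp: ipath_Cons[OF F(1)])
    then show ?thesis using F x y by (auto simp: odd_path_def)
  qed
  have "\<not> (\<exists>vs. ipath V E vs \<and> odd (length vs - 1) \<and> hd vs \<in> B \<and> last vs \<in> B \<and>
            \<not> E (hd vs) (last vs) \<and> set (butlast (tl vs)) \<subseteq> A)"
  proof
    assume "\<exists>vs. ipath V E vs \<and> odd (length vs - 1) \<and> hd vs \<in> B \<and> last vs \<in> B \<and>
            \<not> E (hd vs) (last vs) \<and> set (butlast (tl vs)) \<subseteq> A"
    then obtain vs where vs: "ipath V E vs" "odd (length vs - 1)" "hd vs \<in> B" "last vs \<in> B"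
      "\<not> E (hd vs) (last vs)" "set (butlast (tl vs)) \<subseteq> A" by blast
    with *[OF g vs(1,2,5)] obtain x I y where "vs = x # I @ [y]" "odd_path V E x I y" by blast
    then show False using path[of x I y] vs by simp
  qed
  moreover have "\<not> (\<exists>vs. ipath V (compl V E) vs \<and> odd (length vs - 1) \<and> hd vs \<in> A \<and> last vs \<in> A \<and>
            E (hd vs) (last vs) \<and> set (butlast (tl vs)) \<subseteq> B)"
  proof
    assume "\<exists>vs. ipath V (compl V E) vs \<and> odd (length vs - 1) \<and> hd vs \<in> A \<and> last vs \<in> A \<and>
            E (hd vs) (last vs) \<and> set (butlast (tl vs)) \<subseteq> B"
    then obtain vs where vs: "ipath V (compl V E) vs" "odd (length vs - 1)" "hd vs \<in> A" "last vs \<in> A"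
      "E (hd vs) (last vs)" "set (butlast (tl vs)) \<subseteq> B" by blast
    then have "\<not> compl V E (hd vs) (last vs)" by (simp add: compl_def)
    with *[OF graph_compl[OF g] vs(1,2)] obtain x I y where "vs = x # I @ [y]" "odd_path V (compl V E) x I y" by blast
    then show False using antipath[of x I y] vs by simp
  qed
  ultimately show ?thesis unfolding balanced_skew_partition_def using assms(1-4) by blast
qed

lemma balanced_skew_partition_compl:
  assumes "graph V E" "balanced_skew_partition V (compl V E)"
  shows "balanced_skew_partition V E"
proof -
  have c: "compl V (compl V E) = E" by (rule compl_compl[OF assms(1)])
  obtain A B where AB: "A \<union> B = V" "A \<inter> B = {}" "disconnected A (compl V E)" "disconnected B E"
    and path: "\<not> (\<exists>vs. ipath V (compl V E) vs \<and> odd (length vs - 1) \<and> hd vs \<in> B \<and> last vs \<in> B \<and>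
            \<not> compl V E (hd vs) (last vs) \<and> set (butlast (tl vs)) \<subseteq> A)"
    and antipath: "\<not> (\<exists>vs. ipath V E vs \<and> odd (length vs - 1) \<and> hd vs \<in> A \<and> last vs \<in> A \<and>
            compl V E (hd vs) (last vs) \<and> set (butlast (tl vs)) \<subseteq> B)"
    using assms(2) unfolding balanced_skew_partition_def c by blast
  have BA: "B \<union> A = V" "B \<inter> A = {}" using AB by auto
  show ?thesis
  proof (rule balanced_skew_partitionI[OF BA AB(4,3) _ _ assms(1)])
    fix x I y assume h: "odd_path V E x I y" "x \<in> A" "y \<in> A" "set I \<subseteq> B"
    note D = odd_pathD[OF assms(1) h(1)]
    have "compl V E x y" using D(2,3,6,7) by (simp add: compl_def)
    then have "ipath V E (x # I @ [y]) \<and> odd (length (x # I @ [y]) - 1) \<and> hd (x # I @ [y]) \<in> A \<and>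
      last (x # I @ [y]) \<in> A \<and> compl V E (hd (x # I @ [y])) (last (x # I @ [y])) \<and>
      set (butlast (tl (x # I @ [y]))) \<subseteq> B"
      using h by (simp add: odd_path_def)
    then show False using antipath by blast
  next
    fix x I y assume h: "odd_path V (compl V E) x I y" "x \<in> B" "y \<in> B" "set I \<subseteq> A"
    note D = odd_pathD[OF graph_compl[OF assms(1)] h(1)]
    have "ipath V (compl V E) (x # I @ [y]) \<and> odd (length (x # I @ [y]) - 1) \<and> hd (x # I @ [y]) \<in> B \<and>
      last (x # I @ [y]) \<in> B \<and> \<not> compl V E (hd (x # I @ [y])) (last (x # I @ [y])) \<and>
      set (butlast (tl (x # I @ [y]))) \<subseteq> A"
      using h D(7) by (simp add: odd_path_def)
    then show False using path by blast
  qed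
qed

lemma set_two_sides:
  assumes g: "graph V E" and c: "conn S E" and S: "S \<subseteq> X \<union> Y" "X \<inter> Y = {}"
    and anti: "\<And>x y. x \<in> X \<Longrightarrow> y \<in> Y \<Longrightarrow> \<not> E x y"
  obtains "S \<subseteq> X" | "S \<subseteq> Y"
  using conn_union_cases[OF g c S anti] by blast

text \<open>Covers both kinds of loose skew partition: a \<open>v\<close> in \<open>B1\<close>
  without neighbours in \<open>A1\<close>, and a \<open>v\<close> in \<open>A2\<close> complete to
  \<open>B2\<close>. This form survives moving a vertex from \<open>B1\<close> to \<open>A2\<close>,
  and complementation exchanges \<open>A1\<close> with \<open>B2\<close> and \<open>A2\<close> with
  \<open>B1\<close>.\<close>

definition loose :: "'a set \<Rightarrow> ('a \<Rightarrow> 'a \<Rightarrow> bool) \<Rightarrow> 'a set \<Rightarrow> 'a set \<Rightarrow> 'a set \<Rightarrow> 'a set \<Rightarrow> 'a \<Rightarrow> bool" where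
  "loose V E A1 A2 B1 B2 v \<longleftrightarrow> A1 \<union> A2 \<union> (B1 \<union> B2) = V \<and> A1 \<inter> A2 = {} \<and> B1 \<inter> B2 = {} \<and> (A1 \<union> A2) \<inter> (B1 \<union> B2) = {} \<and>
     A1 \<noteq> {} \<and> A2 \<noteq> {} \<and> B1 \<noteq> {} \<and> B2 \<noteq> {} \<and>
     (\<forall>x\<in>A1. \<forall>y\<in>A2. \<not> E x y) \<and> (\<forall>x\<in>B1. \<forall>y\<in>B2. E x y) \<and>
     v \<in> A2 \<union> B1 \<and> (\<forall>x\<in>B2. E v x) \<and> (\<forall>x\<in>A1. \<not> E v x)"

text \<open>\<open>v\<close> sees all of \<open>B2\<close> and nothing of \<open>A1\<close>, so it
  closes odd paths with ends in \<open>B2\<close> and interior in \<open>A1\<close>, and likewise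
  odd antipaths with ends in \<open>A1\<close> and interior in \<open>B2\<close>. The minimality
  hypotheses reduce every other bad path to these: interiors are rerouted through \<open>A1\<close>
  or \<open>B2\<close>, and other ends are replaced by \<open>Roussel_Rubio_weak\<close>, applied
  with \<open>B2\<close> or, in the complement, with \<open>A1\<close>. The exceptions for
  singletons are harmless since a bad path has two distinct vertices in the set concerned.\<close>

lemma loose_minimal_balanced:
  assumes g: "graph V E" and b: "berge V E" and l: "loose V E A1 A2 B1 B2 v"
    and cA: "conn A1 E" and cB: "conn B2 (compl V E)"
    and nB2: "\<And>x. x \<in> B2 \<Longrightarrow> B2 \<noteq> {x} \<Longrightarrow> \<exists>a\<in>A1. E x a"
    and nB1: "\<And>x. x \<in> B1 \<Longrightarrow> B1 \<noteq> {x} \<Longrightarrow> \<exists>a\<in>A1. E x a"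
    and nA1: "\<And>a. a \<in> A1 \<Longrightarrow> A1 \<noteq> {a} \<Longrightarrow> \<exists>x\<in>B2. \<not> E a x"
  shows "balanced_skew_partition V E"
proof -
  let ?C = "compl V E"
  note gc = graph_compl[OF g] and bc = berge_compl[OF g b]
  have part: "A1 \<union> A2 \<union> (B1 \<union> B2) = V" "A1 \<inter> A2 = {}" "B1 \<inter> B2 = {}" "(A1 \<union> A2) \<inter> (B1 \<union> B2) = {}"
    and ne: "A1 \<noteq> {}" "A2 \<noteq> {}" "B1 \<noteq> {}" "B2 \<noteq> {}"
    and anti: "\<And>x y. x \<in> A1 \<Longrightarrow> y \<in> A2 \<Longrightarrow> \<not> E x y" and co: "\<And>x y. x \<in> B1 \<Longrightarrow> y \<in> B2 \<Longrightarrow> E x y"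
    and v: "v \<in> A2 \<union> B1" "\<And>x. x \<in> B2 \<Longrightarrow> E v x" "\<And>x. x \<in> A1 \<Longrightarrow> \<not> E v x"
    using l unfolding loose_def by auto
  have sub: "A1 \<subseteq> V" "A2 \<subseteq> V" "B1 \<subseteq> V" "B2 \<subseteq> V" "v \<in> V" "v \<notin> A1" "v \<notin> B2" using part v(1) by auto
  have sym: "\<And>x y. E x y \<Longrightarrow> E y x" by (rule graph_sym[OF g])
  have coC: "\<not> ?C x y" if "x \<in> B1" "y \<in> B2" for x y using co[OF that] by (simp add: compl_def)
  have vC: "?C v x" if "x \<in> A1" for x using v(3)[OF that] that sub by (auto simp: compl_def)
  have vC2: "\<not> ?C v x" if "x \<in> B2" for x using v(2)[OF that] by (simp add: compl_def)
  have side: "x \<in> B1 \<and> y \<in> B1 \<or> x \<in> B2 \<and> y \<in> B2" if "x \<in> B1 \<union> B2" "y \<in> B1 \<union> B2" "\<not> E x y" for x y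
    using that co sym by blast
  \<comment> \<open>Non-adjacent vertices of \<open>B1 \<union> B2\<close> lie in the same part,
    which therefore is not a singleton.\<close>
  have nb: "\<exists>a\<in>A1. E x a" "\<exists>a\<in>A1. E y a" if "x \<in> B1 \<union> B2" "y \<in> B1 \<union> B2" "\<not> E x y" "x \<noteq> y" for x y
  proof -
    have "(B1 \<noteq> {x} \<and> B1 \<noteq> {y} \<and> x \<in> B1 \<and> y \<in> B1) \<or> (B2 \<noteq> {x} \<and> B2 \<noteq> {y} \<and> x \<in> B2 \<and> y \<in> B2)"
      using side[OF that(1-3)] that(4) by auto
    then show "\<exists>a\<in>A1. E x a" "\<exists>a\<in>A1. E y a" using nB1 nB2 by meson+
  qed
  have path1: False if P: "odd_path V E x I y" and xy: "x \<in> B1 \<union> B2" "y \<in> B1 \<union> B2" and I: "set I \<subseteq> A1" for x I y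
  proof -
    note D = odd_pathD[OF g P]
    have B2case: False if "odd_path V E x I y" "x \<in> B2" "y \<in> B2" "set I \<subseteq> A1" for x I y
      using odd_path_close[OF g b that(1) sub(5)] v that sub by blast
    show False
    proof (cases "x \<in> B2")
      case True
      then have "y \<in> B2" using side[OF xy D(7)] part by blast
      then show False using B2case[OF P True _ I] by blast
    next
      case False
      then have B1: "x \<in> B1" "y \<in> B1" using side[OF xy D(7)] by blast+
      have big: "A1 \<noteq> {a}" for a
      proof
        assume "A1 = {a}"
        then have "hd I = a" "last I = a" using D(11,12) I by auto
        then show False using D(13) by simp
      qed
      show False
      proof (rule Roussel_Rubio_weak[OF g b sub(4) ne(4) cB P])
        show "x \<notin> B2" "y \<notin> B2" "set I \<inter> B2 = {}" using B1 part I by auto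
        show "E t x" "E t y" if "t \<in> B2" for t using co B1 that sym by blast+
        show "\<exists>t\<in>B2. \<not> E t i" if i: "i \<in> set I" for i
        proof -
          obtain t where "t \<in> B2" "\<not> E i t" using nA1[of i] big i I by blast
          then show ?thesis using sym by blast
        qed
      next
        fix R assume R: "odd_path V ?C (hd I) R (last I)" "set R \<subseteq> B2"
        show False
          using odd_path_close[OF gc bc R(1) sub(5)] R(2) sub vC vC2 D(11,12) I by blast
      next
        fix u w assume "u \<in> B2" "w \<in> B2" "odd_path V E u I w"
        then show False using B2case I by blast
      qed
    qed
  qed
  have path: False if P: "odd_path V E x I y" and xy: "x \<in> B1 \<union> B2" "y \<in> B1 \<union> B2" and I: "set I \<subseteq> A1 \<union> A2" for x I y
  proof -
    note D = odd_pathD[OF g P]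
    show False
    proof (rule set_two_sides[OF g D(14) I part(2) anti])
      assume "set I \<subseteq> A1" then show False using path1[OF P xy] by blast
    next
      assume I2: "set I \<subseteq> A2"
      obtain s t where st: "s \<in> A1" "E x s" "t \<in> A1" "E y t" using nb[OF xy D(7,6)] by blast
      have n: "x \<notin> A1" "y \<notin> A1" "set I \<inter> A1 = {}" using xy part I2 by auto
      have "\<exists>J. odd_path V E x J y \<and> set J \<subseteq> A1"
      proof (rule odd_path_conn[OF g b P sub(1) cA n(1,2) st n(3)])
        show "\<not> E i j" if "i \<in> set I" "j \<in> A1" for i j using anti[of j i] that I2 sym[of i j] by auto
      qed
      then show False using path1 xy by blast
    qed
  qed
  have sideA: "u \<in> A1 \<and> w \<in> A1 \<or> u \<in> A2 \<and> w \<in> A2" if "u \<in> A1 \<union> A2" "w \<in> A1 \<union> A2" "E u w" for u w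
    using that anti sym by blast
  have Eof: "E u w" if "odd_path V ?C u R w" for u R w
    using odd_pathD(2,3,6,7)[OF gc that] by (auto simp: compl_def)
  have anti12: False if R: "odd_path V ?C u R w" "u \<in> A1" "w \<in> A1" "set R \<subseteq> B2" for u R w
    using odd_path_close[OF gc bc R(1) sub(5)] R vC vC2 sub by blast
  have anti1: False if R: "odd_path V ?C u R w" and uw: "u \<in> A1" "w \<in> A1" and RB: "set R \<subseteq> B1 \<union> B2" for u R w
  proof -
    note D = odd_pathD[OF gc R]
    show False
    proof (rule set_two_sides[OF gc D(14) RB part(3) coC])
      assume "set R \<subseteq> B2" then show False using anti12 R uw by blast
    next
      assume R1: "set R \<subseteq> B1"
      have "A1 \<noteq> {u}" "A1 \<noteq> {w}" using uw D(6) by auto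
      then obtain s t where st: "s \<in> B2" "\<not> E u s" "t \<in> B2" "\<not> E w t" using nA1[OF uw(1)] nA1[OF uw(2)] by auto
      have disj: "u \<notin> B2" "w \<notin> B2" "set R \<inter> B2 = {}" using uw part R1 by auto
      then have st': "?C u s" "?C w t" using st uw sub by (auto simp: compl_def)
      have "\<exists>J. odd_path V ?C u J w \<and> set J \<subseteq> B2"
      proof (rule odd_path_conn[OF gc bc R sub(4) cB disj(1,2) st(1) st'(1) st(3) st'(2) disj(3)])
        show "\<not> ?C i j" if "i \<in> set R" "j \<in> B2" for i j using coC that R1 by blast
      qed
      then show False using anti12 uw by blast
    qed
  qed
  have antipath: False if R: "odd_path V ?C u R w" and uw: "u \<in> A1 \<union> A2" "w \<in> A1 \<union> A2" and RB: "set R \<subseteq> B1 \<union> B2" for u R w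
  proof (cases "u \<in> A1")
    case True
    then have "w \<in> A1" using sideA[OF uw Eof[OF R]] part by blast
    then show False using anti1[OF R True _ RB] by blast
  next
    case False
    note D = odd_pathD[OF gc R]
    have u2: "u \<in> A2" "w \<in> A2" using sideA[OF uw Eof[OF R]] False by blast+
    have Ra: "set R \<inter> A1 = {}" "set R \<inter> (A1 \<union> A2) = {}" using RB part by auto
    have nbr: "\<exists>a\<in>A1. E r a" if r: "r \<in> set R" for r
    proof (rule set_two_sides[OF gc D(14) RB part(3) coC])
      assume "set R \<subseteq> B1"
      then have "B1 \<noteq> {r}" using D(11-13) by auto
      then show ?thesis using nB1 r \<open>set R \<subseteq> B1\<close> by blast
    next
      assume "set R \<subseteq> B2"
      then have "B2 \<noteq> {r}" using D(11-13) by auto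
      then show ?thesis using nB2 r \<open>set R \<subseteq> B2\<close> by blast
    qed
    have c: "compl V ?C = E" by (rule compl_compl[OF g])
    show False
    \<comment> \<open>In the complement the ends are complete to \<open>A1\<close>, while by
      \<open>nbr\<close> no interior vertex is. The outcomes are an odd path through
      \<open>A1\<close> with ends in \<open>B1 \<union> B2\<close>, excluded by \<open>path\<close>,
      and an antipath with ends in \<open>A1\<close>, excluded by \<open>anti1\<close>.\<close>
    proof (rule Roussel_Rubio_weak[OF gc bc sub(1) ne(1) _ R])
      show "conn A1 (compl V ?C)" unfolding c by (rule cA)
      show "u \<notin> A1" "w \<notin> A1" "set R \<inter> A1 = {}" using u2 part Ra by auto
      show "?C t u" "?C t w" if "t \<in> A1" for t
        using anti that u2 sub part by (auto simp: compl_def)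
      show "\<exists>t\<in>A1. \<not> ?C t r" if "r \<in> set R" for r
        using nbr[OF that] sym by (auto simp: compl_def)
    next
      fix I assume I: "odd_path V (compl V ?C) (hd R) I (last R)" "set I \<subseteq> A1"
      show False using path[OF I(1)[unfolded c]] I(2) D(11,12) RB by blast
    next
      fix u' w' assume "u' \<in> A1" "w' \<in> A1" "odd_path V ?C u' R w'"
      then show False using anti1 RB by blast
    qed
  qed
  show ?thesis
  proof (rule balanced_skew_partitionI[OF part(1) part(4) _ _ path antipath g])
    obtain a1 a2 b1 b2 where "a1 \<in> A1" "a2 \<in> A2" "b1 \<in> B1" "b2 \<in> B2" using ne by blast
    then show "disconnected (A1 \<union> A2) E" "disconnected (B1 \<union> B2) ?C"
      using disconnectedI[OF g _ _ _ part(2) anti] disconnectedI[OF gc _ _ _ part(3) coC] by blast+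
  qed
qed

text \<open>Each violated hypothesis of \<open>loose_minimal_balanced\<close> is repaired by moving
  vertices, with the same witness \<open>v\<close>. The measure is lexicographic,
  \<open>card A1 + card B2\<close> before \<open>card B1\<close>, because moving a vertex of
  \<open>A1\<close> to \<open>B1\<close> enlarges \<open>B1\<close>; the factor
  \<open>Suc (card V)\<close> exceeds every possible \<open>card B1\<close>.\<close>

lemma loose_balanced:
  assumes g: "graph V E" and b: "berge V E" and "loose V E A1 A2 B1 B2 v"
  shows "balanced_skew_partition V E"
  using assms(3)
proof (induction "(card A1 + card B2) * Suc (card V) + card B1" arbitrary: A1 A2 B1 B2 v rule: less_induct)
  case less
  let ?C = "compl V E"
  let ?m = "\<lambda>A1 B1 B2. (card A1 + card B2) * Suc (card V) + card B1"
  note gc = graph_compl[OF g]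
  have part: "A1 \<union> A2 \<union> (B1 \<union> B2) = V" "A1 \<inter> A2 = {}" "B1 \<inter> B2 = {}" "(A1 \<union> A2) \<inter> (B1 \<union> B2) = {}"
    and ne: "A1 \<noteq> {}" "A2 \<noteq> {}" "B1 \<noteq> {}" "B2 \<noteq> {}"
    and anti: "\<And>x y. x \<in> A1 \<Longrightarrow> y \<in> A2 \<Longrightarrow> \<not> E x y" and co: "\<And>x y. x \<in> B1 \<Longrightarrow> y \<in> B2 \<Longrightarrow> E x y"
    and v: "v \<in> A2 \<union> B1" "\<And>x. x \<in> B2 \<Longrightarrow> E v x" "\<And>x. x \<in> A1 \<Longrightarrow> \<not> E v x"
    using less.prems unfolding loose_def by auto
  have sym: "\<And>x y. E x y \<Longrightarrow> E y x" by (rule graph_sym[OF g])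
  have finV: "finite V" by (rule graph_finite[OF g])
  have fin: "finite A1" "finite A2" "finite B1" "finite B2" using part finV by (auto simp flip: finite_Un)
  have step: "?m X1 Y1 Y2 < ?m A1 B1 B2" if "card X1 + card Y2 < card A1 + card B2" "Y1 \<subseteq> V" for X1 Y1 Y2
  proof -
    have "card Y1 \<le> card V" using that finV by (simp add: card_mono)
    then have "?m X1 Y1 Y2 < Suc (card X1 + card Y2) * Suc (card V)" by simp
    also have "\<dots> \<le> (card A1 + card B2) * Suc (card V)" using that(1) by (intro mult_le_mono1) simp
    finally show ?thesis by simp
  qed
  show ?case
  proof (cases "conn A1 E")
    case False
    then obtain X Y where XY: "X \<union> Y = A1" "X \<inter> Y = {}" "X \<noteq> {}" "Y \<noteq> {}" "\<forall>x\<in>X. \<forall>y\<in>Y. \<not> E x y"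
      using disconnected_split[OF g, of A1] by auto
    have "loose V E X (A2 \<union> Y) B1 B2 v"
      unfolding loose_def using XY part ne anti co v by auto
    moreover have "card X < card A1" using XY fin by (intro psubset_card_mono) auto
    ultimately show ?thesis using less.hyps[OF step[of X B2 B1]] part by auto
  next
    case cA: True
    show ?thesis
    proof (cases "conn B2 ?C")
      case False
      then obtain X Y where XY: "X \<union> Y = B2" "X \<inter> Y = {}" "X \<noteq> {}" "Y \<noteq> {}" "\<forall>x\<in>X. \<forall>y\<in>Y. \<not> ?C x y"
        using disconnected_split[OF gc, of B2] by auto
      have "E y x" if "x \<in> X" "y \<in> Y" for x y
      proof -
        have "x \<noteq> y" "x \<in> V" "y \<in> V" using that XY part by auto
        moreover have "\<not> ?C x y" using XY(5) that by blast
        ultimately have "E x y" by (simp add: compl_def)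
        then show ?thesis by (rule sym)
      qed
      then have yx: "E z x" if "z \<in> B1 \<union> Y" "x \<in> X" for z x using that co XY(1) by blast
      have "loose V E A1 A2 (B1 \<union> Y) X v"
        unfolding loose_def
      proof (intro conjI ballI)
        show "A1 \<union> A2 \<union> (B1 \<union> Y \<union> X) = V" "(A1 \<union> A2) \<inter> (B1 \<union> Y \<union> X) = {}" "(B1 \<union> Y) \<inter> X = {}"
          using part XY(1,2) by blast+
      qed (use part ne anti yx v XY in blast)+
      moreover have "card X < card B2" using XY fin by (intro psubset_card_mono) auto
      moreover have "B1 \<union> Y \<subseteq> V" using XY part by auto
      ultimately show ?thesis using less.hyps[OF step[of A1 X "B1 \<union> Y"]] by auto
    next
      case cB: True
      have "(\<exists>x. x \<in> B2 \<and> B2 \<noteq> {x} \<and> \<not> (\<exists>a\<in>A1. E x a)) \<or> (\<exists>x. x \<in> B1 \<and> B1 \<noteq> {x} \<and> \<not> (\<exists>a\<in>A1. E x a)) \<or>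
        (\<exists>a. a \<in> A1 \<and> A1 \<noteq> {a} \<and> \<not> (\<exists>x\<in>B2. \<not> E a x)) \<or>
        ((\<forall>x. x \<in> B2 \<longrightarrow> B2 \<noteq> {x} \<longrightarrow> (\<exists>a\<in>A1. E x a)) \<and> (\<forall>x. x \<in> B1 \<longrightarrow> B1 \<noteq> {x} \<longrightarrow> (\<exists>a\<in>A1. E x a)) \<and>
         (\<forall>a. a \<in> A1 \<longrightarrow> A1 \<noteq> {a} \<longrightarrow> (\<exists>x\<in>B2. \<not> E a x)))" (is "?c1 \<or> ?c2 \<or> ?c3 \<or> ?c4")
        by meson
      then consider x where "x \<in> B2" "B2 \<noteq> {x}" "\<not> (\<exists>a\<in>A1. E x a)"
        | x where "x \<in> B1" "B1 \<noteq> {x}" "\<not> (\<exists>a\<in>A1. E x a)"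
        | a where "a \<in> A1" "A1 \<noteq> {a}" "\<not> (\<exists>x\<in>B2. \<not> E a x)"
        | "?c4"
        by (elim disjE exE conjE) simp_all
      then show ?thesis
      proof cases
        case (1 x)
        have nx: "\<not> E a x" if "a \<in> A1" for a using 1(3) that sym[of a x] by auto
        have "loose V E A1 (insert x A2) B1 (B2 - {x}) v"
          unfolding loose_def using nx 1(1,2) part ne anti co v by auto
        moreover have "card (B2 - {x}) < card B2" using 1 fin by (intro psubset_card_mono) auto
        ultimately show ?thesis using less.hyps[OF step[of A1 "B2 - {x}" B1]] part by auto
      next
        case (2 x)
        have nx: "\<not> E a x" if "a \<in> A1" for a using 2(3) that sym[of a x] by auto
        have "loose V E A1 (insert x A2) (B1 - {x}) B2 v"
          unfolding loose_def using nx 2(1,2) part ne anti co v by auto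
        moreover have "card (B1 - {x}) < card B1" using 2 fin by (intro psubset_card_mono) auto
        ultimately show ?thesis using less.hyps[of A1 B2 "B1 - {x}"] by auto
      next
        case (3 a)
        have "loose V E (A1 - {a}) A2 (insert a B1) B2 v"
          unfolding loose_def using 3 part ne anti co v by auto
        moreover have "card (A1 - {a}) < card A1" using 3 fin by (intro psubset_card_mono) auto
        moreover have "insert a B1 \<subseteq> V" using 3 part by auto
        ultimately show ?thesis using less.hyps[OF step[of "A1 - {a}" B2 "insert a B1"]] by auto
      next
        case 4
        then show ?thesis by (intro loose_minimal_balanced[OF g b less.prems cA cB]) simp_all
      qed
    qed
  qed
qed

section \<open>Double diamonds\<close>

definition cross :: "('a \<Rightarrow> 'a \<Rightarrow> bool) \<Rightarrow> 'a list \<Rightarrow> 'a list \<Rightarrow> bool" where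
  "cross E P Q \<longleftrightarrow> set P \<inter> set Q = {} \<and>
     (\<forall>x\<in>set P. \<forall>y\<in>set Q. E x y \<longleftrightarrow> (x = hd P \<and> y = hd Q) \<or> (x = last P \<and> y = last Q))"

lemma cross_sym: "graph V E \<Longrightarrow> cross E P Q \<Longrightarrow> cross E Q P"
  unfolding cross_def using graph_sym_iff[of V E] by (metis inf_commute)

lemma long_prismI:
  assumes g: "graph V E" and p: "ipath V E P" "ipath V E Q" "ipath V E R"
    and len: "length P > 2" "length Q \<ge> 2" "length R \<ge> 2"
    and c: "cross E P Q" "cross E P R" "cross E Q R"
  shows "has_long_prism V E"
proof -
  define F where "F i = (if i = 0 then P else if i = 1 then Q else R)" for i :: nat
  have F: "F 0 = P" "F 1 = Q" "F 2 = R" by (simp_all add: F_def)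
  have i3: "i = 0 \<or> i = 1 \<or> i = 2" if "i < 3" for i :: nat using that by auto
  have c': "cross E Q P" "cross E R P" "cross E R Q" using c cross_sym[OF g] by blast+
  have cr: "cross E (F i) (F j)" if h: "i < 3" "j < 3" "i \<noteq> j" for i j
    using i3[OF h(1)] i3[OF h(2)] c c' h(3) F by (elim disjE) (simp_all only: refl not_True_eq_False)
  show ?thesis
    unfolding has_long_prism_def
  proof (intro exI[of _ F] conjI allI impI)
    fix i :: nat assume "i < 3"
    from i3[OF this] show "ipath V E (F i)" "2 \<le> length (F i)" using p len F by (elim disjE; simp)+
  next
    fix i j :: nat assume "i < 3" "j < 3" "i \<noteq> j"
    from cr[OF this] show "set (F i) \<inter> set (F j) = {}" "\<forall>x\<in>set (F i). \<forall>y\<in>set (F j). E x y \<longleftrightarrow>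
           (x = hd (F i) \<and> y = hd (F j)) \<or> (x = last (F i) \<and> y = last (F j))"
      unfolding cross_def by simp_all
  next
    show "\<exists>i<3. 2 < length (F i)" using F(1) len by (intro exI[of _ 0]) simp
  qed
qed

definition adj4 :: "nat \<Rightarrow> nat \<Rightarrow> bool" where
  "adj4 i j \<longleftrightarrow> i \<noteq> j \<and> \<not> (i = 2 \<and> j = 3) \<and> \<not> (i = 3 \<and> j = 2)"

text \<open>Labelled so that \<open>l i\<close>, \<open>r i\<close> are the rungs: both halves have
  the adjacency \<open>adj4\<close>, that is \<open>K4\<close> minus one edge, and the symmetry
  between the halves is the exchange of \<open>l\<close> and \<open>r\<close>.\<close>

definition ddiamond :: "'a set \<Rightarrow> ('a \<Rightarrow> 'a \<Rightarrow> bool) \<Rightarrow> (nat \<Rightarrow> 'a) \<Rightarrow> (nat \<Rightarrow> 'a) \<Rightarrow> bool" where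
  "ddiamond V E l r \<longleftrightarrow> (\<forall>i<4. l i \<in> V \<and> r i \<in> V) \<and>
     (\<forall>i<4. \<forall>j<4. (l i = l j \<longleftrightarrow> i = j) \<and> (r i = r j \<longleftrightarrow> i = j) \<and> l i \<noteq> r j \<and>
        (E (l i) (l j) \<longleftrightarrow> adj4 i j) \<and> (E (r i) (r j) \<longleftrightarrow> adj4 i j) \<and> (E (l i) (r j) \<longleftrightarrow> i = j))"

locale dd_path =
  fixes V :: "'a set" and E :: "'a \<Rightarrow> 'a \<Rightarrow> bool" and l r :: "nat \<Rightarrow> 'a" and vs :: "'a list"
  assumes g: "graph V E" and F5: "F5 V E" and D: "ddiamond V E l r" and p: "ipath V E vs" and len: "length vs \<ge> 2"
    and dis: "\<And>z m. z \<in> set vs \<Longrightarrow> m < 4 \<Longrightarrow> z \<noteq> l m \<and> z \<noteq> r m"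
begin

lemma b: "berge V E" and noprism: "\<not> has_long_prism V E"
  using F5 by (auto simp: F5_def)

lemma sym: "E x y \<longleftrightarrow> E y x"
  by (rule graph_sym_iff[OF g])

lemma dd_in [simp]: "i < 4 \<Longrightarrow> l i \<in> V" "i < 4 \<Longrightarrow> r i \<in> V"
  using D unfolding ddiamond_def by auto

lemma dd [simp]:
  assumes "i < 4" "j < 4"
  shows "l i = l j \<longleftrightarrow> i = j" "r i = r j \<longleftrightarrow> i = j" "l i \<noteq> r j" "r j \<noteq> l i"
    "E (l i) (l j) \<longleftrightarrow> adj4 i j" "E (r i) (r j) \<longleftrightarrow> adj4 i j" "E (l i) (r j) \<longleftrightarrow> i = j" "E (r j) (l i) \<longleftrightarrow> i = j"
proof -
  show *: "l i = l j \<longleftrightarrow> i = j" "r i = r j \<longleftrightarrow> i = j" "l i \<noteq> r j" "E (l i) (l j) \<longleftrightarrow> adj4 i j"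
    "E (r i) (r j) \<longleftrightarrow> adj4 i j" "E (l i) (r j) \<longleftrightarrow> i = j"
    using D assms unfolding ddiamond_def by blast+
  show "r j \<noteq> l i" using *(3) by metis
  show "E (r j) (l i) \<longleftrightarrow> i = j" using *(6) sym by metis
qed

text \<open>These describe the regular attachments to a shortest violating path: left vertices see
  at most its head, right vertices at most its last vertex. The bound on \<open>m\<close> is
  included so that it need not be carried separately.\<close>

definition onL where "onL m \<longleftrightarrow> m < 4 \<and> (\<forall>z\<in>set vs. E z (l m) \<longleftrightarrow> z = hd vs)"
definition onR where "onR m \<longleftrightarrow> m < 4 \<and> (\<forall>z\<in>set vs. E z (r m) \<longleftrightarrow> z = last vs)"
definition noL where "noL m \<longleftrightarrow> m < 4 \<and> (\<forall>z\<in>set vs. \<not> E z (l m))"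
definition noR where "noR m \<longleftrightarrow> m < 4 \<and> (\<forall>z\<in>set vs. \<not> E z (r m))"

lemma att:
  "onL m \<Longrightarrow> z \<in> set vs \<Longrightarrow> E z (l m) \<longleftrightarrow> z = hd vs" "onL m \<Longrightarrow> z \<in> set vs \<Longrightarrow> E (l m) z \<longleftrightarrow> z = hd vs"
  "onR m \<Longrightarrow> z \<in> set vs \<Longrightarrow> E z (r m) \<longleftrightarrow> z = last vs" "onR m \<Longrightarrow> z \<in> set vs \<Longrightarrow> E (r m) z \<longleftrightarrow> z = last vs"
  "noL m \<Longrightarrow> z \<in> set vs \<Longrightarrow> \<not> E z (l m)" "noL m \<Longrightarrow> z \<in> set vs \<Longrightarrow> \<not> E (l m) z"
  "noR m \<Longrightarrow> z \<in> set vs \<Longrightarrow> \<not> E z (r m)" "noR m \<Longrightarrow> z \<in> set vs \<Longrightarrow> \<not> E (r m) z"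
  "onL m \<Longrightarrow> m < 4" "onR m \<Longrightarrow> m < 4" "noL m \<Longrightarrow> m < 4" "noR m \<Longrightarrow> m < 4"
  using sym[of _ "l m"] sym[of _ "r m"] unfolding onL_def onR_def noL_def noR_def by blast+

lemma vs_ne: "vs \<noteq> []" "hd vs \<in> set vs" "last vs \<in> set vs" "hd vs \<noteq> last vs" "distinct vs" "hd vs \<in> V" "last vs \<in> V"
proof -
  show n: "vs \<noteq> []" and "hd vs \<in> set vs" "last vs \<in> set vs" using len by (cases vs; force)+
  moreover show d: "distinct vs" using p by (simp add: ipath_def)
  ultimately show "hd vs \<in> V" "last vs \<in> V" using p by (auto simp: ipath_def)
  obtain x ws where "vs = x # ws" using n by (cases vs) auto
  then show "hd vs \<noteq> last vs" using d len by auto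
qed

lemma vs_dis: "m < 4 \<Longrightarrow> l m \<notin> set vs" "m < 4 \<Longrightarrow> r m \<notin> set vs" "z \<in> set vs \<Longrightarrow> m < 4 \<Longrightarrow> z \<noteq> l m" "z \<in> set vs \<Longrightarrow> m < 4 \<Longrightarrow> z \<noteq> r m"
  "z \<in> set vs \<Longrightarrow> m < 4 \<Longrightarrow> l m \<noteq> z" "z \<in> set vs \<Longrightarrow> m < 4 \<Longrightarrow> r m \<noteq> z"
  using dis by blast+

lemma pathL: "onL i \<Longrightarrow> ipath V E (l i # vs)"
  using att(9) vs_dis att(2) by (intro ipath_ConsI[OF g p]) auto

lemma pathR: "onR j \<Longrightarrow> ipath V E (vs @ [r j])"
  using att(10) vs_dis att(4) by (intro ipath_snocI[OF g p]) auto

lemma pathLR: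
  assumes "onL i" "onR j" "i \<noteq> j"
  shows "ipath V E (l i # vs @ [r j])"
  using assms att(9,10) vs_dis att(2) vs_ne by (intro ipath_ConsI[OF g pathR]) auto

text \<open>The hole is \<open>l i, vs, r j, r i\<close>, with \<open>length vs + 3\<close>
  vertices.\<close>

lemma parity1:
  assumes "onL i" "onR j" "adj4 i j" "noR i"
  shows "odd (length vs)"
proof -
  have ij: "i < 4" "j < 4" "i \<noteq> j" using assms att by (auto simp: adj4_def)
  have "adj4 j i" using assms by (auto simp: adj4_def)
  have "odd (length (l i # vs @ [r j]))"
  proof (rule berge_close[OF g b pathLR[OF assms(1,2) ij(3)]])
    show "r i \<in> V" "r i \<notin> set (l i # vs @ [r j])" "3 \<le> length (l i # vs @ [r j])" using ij vs_dis vs_ne len by auto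
    show "E (r i) x \<longleftrightarrow> x = hd (l i # vs @ [r j]) \<or> x = last (l i # vs @ [r j])" if "x \<in> set (l i # vs @ [r j])" for x
      using that ij att(8)[OF assms(4)] vs_dis assms(3) by auto
  qed
  then show ?thesis by simp
qed

text \<open>The hole is \<open>l m, vs, r m\<close>, with \<open>length vs + 2\<close>
  vertices.\<close>

lemma parity2:
  assumes "onL m" "onR m"
  shows "even (length vs)"
proof -
  have m: "m < 4" using assms att by auto
  have "odd (length (l m # vs))"
  proof (rule berge_close[OF g b pathL[OF assms(1)]])
    show "r m \<in> V" "r m \<notin> set (l m # vs)" "3 \<le> length (l m # vs)" using m vs_dis vs_ne len by auto
    show "E (r m) x \<longleftrightarrow> x = hd (l m # vs) \<or> x = last (l m # vs)" if "x \<in> set (l m # vs)" for x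
      using that m att(4)[OF assms(2)] vs_ne vs_dis by auto
  qed
  then show ?thesis by simp
qed

text \<open>The hole is \<open>l i, vs, r j, r m, l m\<close>, with \<open>length vs + 4\<close>
  vertices.\<close>

lemma parity3:
  assumes "onL i" "onR j" "i \<noteq> j" "noL m" "noR m" "adj4 i m" "adj4 m j"
  shows "even (length vs)"
proof -
  have ij: "i < 4" "j < 4" "m < 4" "i \<noteq> m" "m \<noteq> j" using assms att by (auto simp: adj4_def)
  have ad: "adj4 m i" "adj4 j m" using assms by (auto simp: adj4_def)
  have "ipath V E ((l i # vs @ [r j]) @ [r m])"
    using ij ad assms att(8)[OF assms(5)] vs_dis by (intro ipath_snocI[OF g pathLR[OF assms(1-3)]]) auto
  then have "odd (length ((l i # vs @ [r j]) @ [r m]))"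
  proof (rule berge_close[OF g b])
    show "l m \<in> V" "l m \<notin> set ((l i # vs @ [r j]) @ [r m])" "3 \<le> length ((l i # vs @ [r j]) @ [r m])"
      using ij vs_dis len by auto
    show "E (l m) x \<longleftrightarrow> x = hd ((l i # vs @ [r j]) @ [r m]) \<or> x = last ((l i # vs @ [r j]) @ [r m])"
      if "x \<in> set ((l i # vs @ [r j]) @ [r m])" for x
      using that ij ad att(6)[OF assms(4)] vs_dis by auto
  qed
  then show ?thesis by simp
qed

text \<open>The hole is \<open>l i, vs, r j, r m, r n, l n\<close>, with
  \<open>length vs + 5\<close> vertices.\<close>

lemma parity4:
  assumes "onL i" "onR j" "i \<noteq> j" "noR m" "noL n" "noR n" "adj4 n i" "adj4 j m" "adj4 m n" "\<not> adj4 j n" "i \<noteq> m" "i \<noteq> n" "j \<noteq> n"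
  shows "odd (length vs)"
proof -
  have ij: "i < 4" "j < 4" "m < 4" "n < 4" "m \<noteq> n" "m \<noteq> j" using assms att by (auto simp: adj4_def)
  have ad: "adj4 m j" "adj4 n m" "\<not> adj4 n j" using assms by (auto simp: adj4_def)
  let ?w = "(l i # vs @ [r j]) @ [r m]"
  have w: "ipath V E ?w"
    using ij ad(1) assms(3,11) att(8)[OF assms(4)] vs_dis by (intro ipath_snocI[OF g pathLR[OF assms(1-3)]]) auto
  have w2: "ipath V E (?w @ [r n])"
  proof (rule ipath_snocI[OF g w])
    show "r n \<in> V" "r n \<notin> set ?w" using ij(3-5) ij(2) vs_dis(2)[OF ij(4)] assms(13) ij(1) by auto
    show "E (r n) z \<longleftrightarrow> z = last ?w" if "z \<in> set ?w" for z
    proof -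
      have l: "last ?w = r m" by simp
      consider "z = l i" | "z = r j" | "z = r m" | "z \<in> set vs" using \<open>z \<in> _\<close> by auto
      then show ?thesis unfolding l
        by cases (use ij ad assms(12,13) att(8)[OF assms(6)] vs_dis(4) in simp_all)
    qed
  qed
  have "odd (length (?w @ [r n]))"
  proof (rule berge_close[OF g b w2])
    show "l n \<in> V" "l n \<notin> set (?w @ [r n])" "3 \<le> length (?w @ [r n])"
      using ij(1-4) vs_dis(1)[OF ij(4)] len assms(12) by auto
    show "E (l n) x \<longleftrightarrow> x = hd (?w @ [r n]) \<or> x = last (?w @ [r n])" if "x \<in> set (?w @ [r n])" for x
    proof -
      have l: "hd (?w @ [r n]) = l i" "last (?w @ [r n]) = r n" by simp_all
      consider "x = l i" | "x = r j" | "x = r m" | "x = r n" | "x \<in> set vs" using \<open>x \<in> _\<close> by auto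
      then show ?thesis unfolding l
        by cases (use ij ad assms(7,12,13) att(6)[OF assms(5)] vs_dis(3,4) in simp_all)
    qed
  qed
  then show ?thesis by simp
qed

lemma rung: "i < 4 \<Longrightarrow> ipath V E [l i, r i]"
  by (simp add: ipath_Cons[OF g] ipath_single[OF g])

lemma cross_rungs: "i < 4 \<Longrightarrow> j < 4 \<Longrightarrow> adj4 i j \<Longrightarrow> cross E [l i, r i] [l j, r j]"
  by (auto simp: cross_def adj4_def)

text \<open>\<open>vs\<close> and the rungs \<open>i\<close>, \<open>j\<close> form a prism whose
  triangles are the ends of \<open>vs\<close> with the respective rung ends.\<close>

lemma prismA:
  assumes "onL i" "onR i" "onL j" "onR j" "adj4 i j" "length vs > 2"
  shows False
proof -
  have ij: "i < 4" "j < 4" using assms att by auto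
  have c: "cross E vs [l m, r m]" if "onL m" "onR m" for m
    using att(1)[OF that(1)] att(3)[OF that(2)] att(9)[OF that(1)] vs_dis vs_ne unfolding cross_def by auto
  show False
    using noprism long_prismI[OF g p rung[OF ij(1)] rung[OF ij(2)] assms(6) _ _ c c cross_rungs[OF ij assms(5)]] assms by simp
qed

text \<open>The path \<open>l i, vs, r j\<close> and the rungs \<open>m\<close>, \<open>n\<close>
  form a long prism with triangles \<open>l i, l m, l n\<close> and
  \<open>r j, r m, r n\<close>.\<close>

lemma prismC:
  assumes "onL i" "onR j" "i \<noteq> j" "noL m" "noR m" "noL n" "noR n" "adj4 i m" "adj4 i n" "adj4 m n" "adj4 j m" "adj4 j n"
  shows False
proof -
  have ij: "i < 4" "j < 4" "m < 4" "n < 4" using assms att by auto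
  have c: "cross E (l i # vs @ [r j]) [l k, r k]" if "k < 4" "noL k" "noR k" "adj4 i k" "adj4 j k" for k
    using that ij att(5)[OF that(2)] att(7)[OF that(3)] vs_dis assms(3) unfolding cross_def
    by (auto simp: adj4_def)
  show False
    using noprism long_prismI[OF g pathLR[OF assms(1-3)] rung[OF ij(3)] rung[OF ij(4)] _ _ _
        c[OF ij(3) assms(4,5,8,11)] c[OF ij(4) assms(6,7,9,12)] cross_rungs[OF ij(3,4) assms(10)]] len vs_ne(1) by simp
qed

text \<open>The path \<open>vs, r j\<close> and the rungs \<open>i\<close>, \<open>n\<close> form a
  long prism with triangles \<open>hd vs, l i, l n\<close> and \<open>r j, r i, r n\<close>.\<close>

lemma prismE:
  assumes "onL i" "onL n" "noR i" "noR n" "onR j" "adj4 i n" "adj4 i j" "adj4 n j"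
  shows False
proof -
  have ij: "i < 4" "j < 4" "n < 4" using assms att by auto
  have c: "cross E (vs @ [r j]) [l k, r k]" if "k < 4" "onL k" "noR k" "adj4 k j" for k
    using that ij att(1)[OF that(2)] att(7)[OF that(3)] vs_dis vs_ne unfolding cross_def
    by (auto simp: adj4_def)
  show False
    using noprism long_prismI[OF g pathR[OF assms(5)] rung[OF ij(1)] rung[OF ij(3)] _ _ _
        c[OF ij(1) assms(1,3,7)] c[OF ij(3) assms(2,4,8)] cross_rungs[OF ij(1,3) assms(6)]] len by simp
qed

text \<open>The three paths are \<open>l i, l m, r m, r n\<close>, then \<open>vs\<close>, then the
  rung \<open>j\<close>. The first one makes the prism long even if \<open>vs\<close> is a single
  edge.\<close>

lemma prismF:
  assumes "onL i" "onL j" "onR j" "onR n" "noL m" "noR m"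
    and "adj4 i j" "adj4 n j" "adj4 i m" "adj4 m n" "\<not> adj4 j m" "j \<noteq> m" "i \<noteq> n"
  shows False
proof -
  have ij: "i < 4" "j < 4" "m < 4" "n < 4" using assms att by auto
  have ad: "adj4 j i" "adj4 j n" "\<not> adj4 m j" "adj4 m i" "adj4 n m" "i \<noteq> j" "n \<noteq> j" "i \<noteq> m" "n \<noteq> m"
    using assms by (auto simp: adj4_def)
  let ?P = "[l i, l m, r m, r n]"
  have P: "ipath V E ?P" using ij ad assms(9,10,13) by (simp add: ipath_Cons[OF g] ipath_single[OF g])
  have c1: "cross E ?P vs"
    unfolding cross_def
  proof (intro conjI ballI)
    show "set ?P \<inter> set vs = {}" using ij vs_dis(1,2) by simp
    fix x y assume x: "x \<in> set ?P" and y: "y \<in> set vs"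
    have hl: "hd ?P = l i" "last ?P = r n" by simp_all
    consider "x = l i" | "x = l m" | "x = r m" | "x = r n" using x by auto
    then show "E x y \<longleftrightarrow> x = hd ?P \<and> y = hd vs \<or> x = last ?P \<and> y = last vs" unfolding hl
      by cases (use ij ad(9) assms(13) att(2)[OF assms(1) y] att(6)[OF assms(5) y] att(8)[OF assms(6) y] att(4)[OF assms(4) y] ad(8) in simp_all)
  qed
  have c2: "cross E ?P [l j, r j]"
    unfolding cross_def using ij ad assms(7,8,11,12,13) by simp
  have c3: "cross E vs [l j, r j]"
    using ij att(1)[OF assms(2)] att(3)[OF assms(3)] vs_dis vs_ne unfolding cross_def by auto
  show False using noprism long_prismI[OF g P p rung[OF ij(2)] _ len _ c1 c2 c3] by simp
qed

end

lemma dd_path_swap: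
  assumes "dd_path V E l r vs"
  shows "dd_path V E r l (rev vs)"
proof -
  interpret dd_path V E l r vs by fact
  have "ddiamond V E r l" unfolding ddiamond_def by auto
  then show ?thesis
    by unfold_locales (use g F5 p len dis ipath_rev[OF g p] in auto)
qed

context dd_path
begin

lemma swap: "dd_path.onL E r (rev vs) m \<longleftrightarrow> onR m" "dd_path.onR E l (rev vs) m \<longleftrightarrow> onL m"
  "dd_path.noL E r (rev vs) m \<longleftrightarrow> noR m" "dd_path.noR E l (rev vs) m \<longleftrightarrow> noL m"
  using dd_path_swap[OF dd_path_axioms]
  by (simp_all add: dd_path.onL_def dd_path.onR_def dd_path.noL_def dd_path.noR_def onL_def onR_def noL_def noR_def hd_rev last_rev)

lemma parity1': "onL j \<Longrightarrow> onR i \<Longrightarrow> adj4 i j \<Longrightarrow> noL i \<Longrightarrow> odd (length vs)"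
  using dd_path.parity1[OF dd_path_swap[OF dd_path_axioms], of i j] unfolding swap by simp

lemma prismE': "onR i \<Longrightarrow> onR n \<Longrightarrow> noL i \<Longrightarrow> noL n \<Longrightarrow> onL j \<Longrightarrow> adj4 i n \<Longrightarrow> adj4 i j \<Longrightarrow> adj4 n j \<Longrightarrow> False"
  using dd_path.prismE[OF dd_path_swap[OF dd_path_axioms], of i n j] unfolding swap by simp

lemma adj4_simps [simp]: "adj4 0 (Suc 0)" "adj4 0 2" "adj4 0 3" "adj4 (Suc 0) 0" "adj4 (Suc 0) 2" "adj4 (Suc 0) 3" "adj4 2 0" "adj4 3 0" "adj4 2 (Suc 0)" "adj4 3 (Suc 0)"
  "\<not> adj4 2 3" "\<not> adj4 3 2"
  by (auto simp: adj4_def)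

text \<open>With regular attachments only the sets \<open>I\<close> and \<open>J\<close> matter, and
  the holes and prisms above become propositional constraints on eight atoms. The survivors are
  exactly the shapes of an addition to a configuration: \<open>I = {0, 1}\<close> is that of a new
  rung for \<open>(C, D)\<close>, and \<open>I\<close> containing 2, 3 and one of 0, 1 that of a new
  rung for \<open>(A, B)\<close>, where rungs 0, 1 belong to \<open>(A, B)\<close> and 2, 3 to
  \<open>(C, D)\<close>.\<close>

lemma straight:
  assumes I: "\<And>m. m < 4 \<Longrightarrow> if I m then onL m else noL m" and J: "\<And>m. m < 4 \<Longrightarrow> if J m then onR m else noR m"
    and ij: "i < 4" "j < 4" "i \<noteq> j" "I i" "J j"
  shows "length vs = 2 \<and> (\<forall>m<4. I m = J m) \<and>
    (I 0 \<and> I 1 \<and> \<not> I 2 \<and> \<not> I 3 \<or> I 2 \<and> I 3 \<and> (I 0 \<or> I 1))"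
proof -
  have L: "onL m" if "m < 4" "I m" for m using I[OF that(1)] that by simp
  have nL: "noL m" if "m < 4" "\<not> I m" for m using I[OF that(1)] that by simp
  have R: "onR m" if "m < 4" "J m" for m using J[OF that(1)] that by simp
  have nR: "noR m" if "m < 4" "\<not> J m" for m using J[OF that(1)] that by simp
  have m4: "m = 0 \<or> m = 1 \<or> m = 2 \<or> m = 3" if "m < 4" for m :: nat using that by auto
  have ex: "(I 0 \<and> (J 1 \<or> J 2 \<or> J 3)) \<or> (I 1 \<and> (J 0 \<or> J 2 \<or> J 3)) \<or> (I 2 \<and> (J 1 \<or> J 0 \<or> J 3)) \<or> (I 3 \<and> (J 1 \<or> J 2 \<or> J 0))"
    using m4[OF ij(1)] m4[OF ij(2)] ij(3-5) by (elim disjE) simp_all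
  have C: "\<not> (I 2 \<and> J 3 \<and> \<not> I 0 \<and> \<not> J 0 \<and> \<not> I 1 \<and> \<not> J 1)" "\<not> (I 3 \<and> J 2 \<and> \<not> I 0 \<and> \<not> J 0 \<and> \<not> I 1 \<and> \<not> J 1)"
    using prismC[OF L R _ nL nR nL nR, of 2 3 0 1] prismC[OF L R _ nL nR nL nR, of 3 2 0 1] by auto
  have p1: "odd (length vs)" if "adj4 i j" "i < 4" "j < 4" "I i" "J j" "\<not> J i \<or> \<not> I j" for i j
    using parity1[OF L R that(1) nR] parity1'[OF L R, of i j] nL[OF that(3)] that by (auto simp: adj4_def)
  have E1: "\<not> (I i \<and> I n \<and> J j \<and> \<not> J i \<and> \<not> J n)" if "adj4 i n" "adj4 i j" "adj4 n j" "i < 4" "n < 4" "j < 4" for i n j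
    using prismE[OF L L nR nR R, of i n j] that by auto
  have E2: "\<not> (J i \<and> J n \<and> I j \<and> \<not> I i \<and> \<not> I n)" if "adj4 i n" "adj4 i j" "adj4 n j" "i < 4" "n < 4" "j < 4" for i n j
    using prismE'[OF R R nL nL L, of i n j] that by auto
  show ?thesis
  proof (cases "even (length vs)")
    case True
    \<comment> \<open>For even \<open>length vs\<close>, \<open>parity1\<close> makes adjacent rungs
      with \<open>I i\<close> and \<open>J j\<close> attach at both of their ends. With
      \<open>C\<close> this gives \<open>I = J\<close>, and \<open>prismA\<close> then leaves only a
      path with two vertices.\<close>
    have star: "I i \<and> J j \<Longrightarrow> J i \<and> I j" if "adj4 i j" "i < 4" "j < 4" for i j using p1[OF that] True by blast
    have "I 0 \<and> J 1 \<Longrightarrow> J 0 \<and> I 1" "I 1 \<and> J 0 \<Longrightarrow> J 1 \<and> I 0" "I 0 \<and> J 2 \<Longrightarrow> J 0 \<and> I 2" "I 2 \<and> J 0 \<Longrightarrow> J 2 \<and> I 0"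
      "I 0 \<and> J 3 \<Longrightarrow> J 0 \<and> I 3" "I 3 \<and> J 0 \<Longrightarrow> J 3 \<and> I 0" "I 1 \<and> J 2 \<Longrightarrow> J 1 \<and> I 2" "I 2 \<and> J 1 \<Longrightarrow> J 2 \<and> I 1"
      "I 1 \<and> J 3 \<Longrightarrow> J 1 \<and> I 3" "I 3 \<and> J 1 \<Longrightarrow> J 3 \<and> I 1"
      by (intro star; simp)+
    then have eq: "I 0 = J 0" "I 1 = J 1" "I 2 = J 2" "I 3 = J 3" and two: "I 0 \<or> I 1"
      and "(I 0 \<and> I 1) \<or> (I 0 \<and> I 2) \<or> (I 0 \<and> I 3) \<or> (I 1 \<and> I 2) \<or> (I 1 \<and> I 3)"
      using ex C by argo+
    then have pr: "\<exists>i j. i < 4 \<and> j < 4 \<and> adj4 i j \<and> I i \<and> J i \<and> I j \<and> J j"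
      by (elim disjE conjE) (rule exI, rule exI, intro conjI; (assumption | simp))+
    have "\<not> length vs > 2" using pr prismA[OF L R L R] by blast
    then have l2: "length vs = 2" using len by simp
    have q4: "\<not> (I i \<and> J j \<and> \<not> J m \<and> \<not> I n \<and> \<not> J n)"
      if "adj4 n i" "adj4 j m" "adj4 m n" "\<not> adj4 j n" "i \<noteq> m" "i \<noteq> n" "j \<noteq> n" "i \<noteq> j" "i < 4" "j < 4" "m < 4" "n < 4" for i j m n
      using parity4[OF L R that(8) nR nL nR that(1-7)] that True by blast
    have qF: "\<not> (I i \<and> I j \<and> J j \<and> J n \<and> \<not> I m \<and> \<not> J m)"
      if "adj4 i j" "adj4 n j" "adj4 i m" "adj4 m n" "\<not> adj4 j m" "j \<noteq> m" "i \<noteq> n" "i < 4" "j < 4" "m < 4" "n < 4" for i j m n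
      using prismF[OF L L R R nL nR that(1-7)] that by blast
    have "\<not> (I 0 \<and> J 2 \<and> \<not> J 1 \<and> \<not> I 3 \<and> \<not> J 3)" "\<not> (I 0 \<and> J 3 \<and> \<not> J 1 \<and> \<not> I 2 \<and> \<not> J 2)"
      "\<not> (I 1 \<and> J 2 \<and> \<not> J 0 \<and> \<not> I 3 \<and> \<not> J 3)" "\<not> (I 1 \<and> J 3 \<and> \<not> J 0 \<and> \<not> I 2 \<and> \<not> J 2)"
      "\<not> (I 0 \<and> I 2 \<and> J 2 \<and> J 1 \<and> \<not> I 3 \<and> \<not> J 3)" "\<not> (I 0 \<and> I 3 \<and> J 3 \<and> J 1 \<and> \<not> I 2 \<and> \<not> J 2)"
      using q4[of 3 0 2 1] q4[of 2 0 3 1] q4[of 3 1 2 0] q4[of 2 1 3 0] qF[of 0 2 1 3] qF[of 0 3 1 2] by simp_all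
    then have "I 0 \<and> I 1 \<and> \<not> I 2 \<and> \<not> I 3 \<or> I 2 \<and> I 3 \<and> (I 0 \<or> I 1)" using eq two ex by argo
    moreover have "\<forall>m<4. I m = J m" using eq m4 by metis
    ultimately show ?thesis using l2 by blast
  next
    case False
    \<comment> \<open>For odd \<open>length vs\<close>, \<open>parity2\<close> makes
      \<open>I\<close> and \<open>J\<close> disjoint; the remaining holes and the prisms
      \<open>prismC\<close> and \<open>prismE\<close> then leave no case.\<close>
    have d: "\<not> (I 0 \<and> J 0)" "\<not> (I 1 \<and> J 1)" "\<not> (I 2 \<and> J 2)" "\<not> (I 3 \<and> J 3)"
      using parity2[OF L R] False by (meson one_less_numeral_iff semiring_norm(76) zero_less_numeral numeral_less_iff semiring_norm(78,80,81))+
    have p3: "\<not> (I i \<and> J j \<and> \<not> I m \<and> \<not> J m)" if "i \<noteq> j" "adj4 i m" "adj4 m j" "i < 4" "j < 4" "m < 4" for i j m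
      using parity3[OF L R that(1) nL nR that(2,3)] that False by blast
    have "\<not> (I 0 \<and> J 1 \<and> \<not> I 2 \<and> \<not> J 2)" "\<not> (I 1 \<and> J 0 \<and> \<not> I 2 \<and> \<not> J 2)"
      "\<not> (I 0 \<and> J 2 \<and> \<not> I 1 \<and> \<not> J 1)" "\<not> (I 2 \<and> J 0 \<and> \<not> I 1 \<and> \<not> J 1)"
      "\<not> (I 0 \<and> J 3 \<and> \<not> I 1 \<and> \<not> J 1)" "\<not> (I 3 \<and> J 0 \<and> \<not> I 1 \<and> \<not> J 1)"
      "\<not> (I 1 \<and> J 2 \<and> \<not> I 0 \<and> \<not> J 0)" "\<not> (I 2 \<and> J 1 \<and> \<not> I 0 \<and> \<not> J 0)"
      "\<not> (I 1 \<and> J 3 \<and> \<not> I 0 \<and> \<not> J 0)" "\<not> (I 3 \<and> J 1 \<and> \<not> I 0 \<and> \<not> J 0)"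
      using p3[of 0 1 2] p3[of 1 0 2] p3[of 0 2 1] p3[of 2 0 1] p3[of 0 3 1] p3[of 3 0 1] p3[of 1 2 0] p3[of 2 1 0]
        p3[of 1 3 0] p3[of 3 1 0] by simp_all
    moreover have "\<not> (I 0 \<and> I 1 \<and> J 2 \<and> \<not> J 0 \<and> \<not> J 1)" "\<not> (I 0 \<and> I 1 \<and> J 3 \<and> \<not> J 0 \<and> \<not> J 1)"
      "\<not> (I 0 \<and> I 2 \<and> J 1 \<and> \<not> J 0 \<and> \<not> J 2)" "\<not> (I 0 \<and> I 3 \<and> J 1 \<and> \<not> J 0 \<and> \<not> J 3)"
      "\<not> (I 1 \<and> I 2 \<and> J 0 \<and> \<not> J 1 \<and> \<not> J 2)" "\<not> (I 1 \<and> I 3 \<and> J 0 \<and> \<not> J 1 \<and> \<not> J 3)"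
      using E1[of 0 1 2] E1[of 0 1 3] E1[of 0 2 1] E1[of 0 3 1] E1[of 1 2 0] E1[of 1 3 0] by simp_all
    moreover have "\<not> (J 0 \<and> J 1 \<and> I 2 \<and> \<not> I 0 \<and> \<not> I 1)" "\<not> (J 0 \<and> J 1 \<and> I 3 \<and> \<not> I 0 \<and> \<not> I 1)"
      "\<not> (J 0 \<and> J 2 \<and> I 1 \<and> \<not> I 0 \<and> \<not> I 2)" "\<not> (J 0 \<and> J 3 \<and> I 1 \<and> \<not> I 0 \<and> \<not> I 3)"
      "\<not> (J 1 \<and> J 2 \<and> I 0 \<and> \<not> I 1 \<and> \<not> I 2)" "\<not> (J 1 \<and> J 3 \<and> I 0 \<and> \<not> I 1 \<and> \<not> I 3)"
      using E2[of 0 1 2] E2[of 0 1 3] E2[of 0 2 1] E2[of 0 3 1] E2[of 1 2 0] E2[of 1 3 0] by simp_all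
    ultimately have False using ex C d by argo
    then show ?thesis ..
  qed
qed

end

text \<open>\<open>K\<^sub>3\<^sub>,\<^sub>3\<close> minus an edge arises from \<open>K\<^sub>4\<close> on \<open>{0, 1, 2, 3}\<close> by subdividing the opposite edges \<open>01\<close> and \<open>23\<close> with \<open>4\<close> and \<open>5\<close>.\<close>
definition K33e_E :: "nat \<Rightarrow> nat \<Rightarrow> bool" where
  "K33e_E x y \<longleftrightarrow> {x, y} \<in> {{0, 4}, {4, 1}, {0, 2}, {0, 3}, {1, 2}, {1, 3}, {2, 5}, {5, 3}}"

lemma subdiv_K33e: "subdiv_K4 {0, 1, 2, 3, 4, 5} K33e_E"
  unfolding subdiv_K4_def
proof (intro exI conjI)
  let ?P = "\<lambda>i j :: nat. if i = 0 \<and> j = 1 then [0, 4, 1] else if i = 2 \<and> j = 3 then [2, 5, 3] else [i, j]"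
  have c: "i = 0 \<and> j = 1 \<or> i = 0 \<and> j = 2 \<or> i = 0 \<and> j = 3 \<or> i = 1 \<and> j = 2 \<or> i = 1 \<and> j = 3 \<or> i = 2 \<and> j = 3"
    if "i < j" "j < 4" for i j :: nat using that by auto
  have im: "id ` {..<4} = {0, 1, 2, 3 :: nat}" by auto
  show "inj_on id {..<4 :: nat}" by simp
  show "\<forall>i j. i < j \<and> j < 4 \<longrightarrow> distinct (?P i j) \<and> length (?P i j) \<ge> 2 \<and> hd (?P i j) = id i \<and> last (?P i j) = id j \<and>
        (\<forall>x\<in>set (?P i j). x \<in> id ` {..<4} \<longrightarrow> x = id i \<or> x = id j)"
  proof (intro allI impI, elim conjE)
    fix i j :: nat assume "i < j" "j < 4"
    from c[OF this] show "distinct (?P i j) \<and> length (?P i j) \<ge> 2 \<and> hd (?P i j) = id i \<and> last (?P i j) = id j \<and>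
        (\<forall>x\<in>set (?P i j). x \<in> id ` {..<4} \<longrightarrow> x = id i \<or> x = id j)" unfolding im
      by (elim disjE conjE) simp_all
  qed
  show "\<forall>i j k l. i < j \<and> j < 4 \<and> k < l \<and> l < 4 \<and> (i, j) \<noteq> (k, l) \<longrightarrow> set (?P i j) \<inter> set (?P k l) \<subseteq> id ` {..<4}"
  proof (intro allI impI, elim conjE)
    fix i j k l :: nat assume h: "i < j" "j < 4" "k < l" "l < 4" "(i, j) \<noteq> (k, l)"
    have s: "set (?P i j) \<subseteq> {0, 1, 2, 3, 4, 5} \<and> (4 \<in> set (?P i j) \<longrightarrow> i = 0 \<and> j = 1) \<and> (5 \<in> set (?P i j) \<longrightarrow> i = 2 \<and> j = 3)"
      if "i < j" "j < 4" for i j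
      using c[OF that] by (elim disjE conjE) simp_all
    have aux: "X \<inter> Y \<subseteq> id ` {..<4}"
      if X: "X \<subseteq> {0, 1, 2, 3, 4, 5} \<and> (4 \<in> X \<longrightarrow> i = 0 \<and> j = 1) \<and> (5 \<in> X \<longrightarrow> i = 2 \<and> j = 3)"
        and Y: "Y \<subseteq> {0, 1, 2, 3, 4, 5} \<and> (4 \<in> Y \<longrightarrow> k = 0 \<and> l = 1) \<and> (5 \<in> Y \<longrightarrow> k = 2 \<and> l = 3)" for X Y :: "nat set"
    proof
      fix x assume x: "x \<in> X \<inter> Y"
      have "x \<in> {0, 1, 2, 3, 4, 5}" using X x by blast
      moreover have "x \<noteq> 4"
      proof
        assume "x = 4"
        then have "4 \<in> X" "4 \<in> Y" using x by auto
        then show False using X Y h(5) by simp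
      qed
      moreover have "x \<noteq> 5"
      proof
        assume "x = 5"
        then have "5 \<in> X" "5 \<in> Y" using x by auto
        then show False using X Y h(5) by simp
      qed
      ultimately show "x \<in> id ` {..<4}" unfolding im by simp
    qed
    show "set (?P i j) \<inter> set (?P k l) \<subseteq> id ` {..<4}" by (rule aux[OF s[OF h(1,2)] s[OF h(3,4)]])
  qed
  have I: "{..<4} = {0, 1, 2, 3 :: nat}" "{0<..<4} = {1, 2, 3 :: nat}" "{1<..<4} = {2, 3 :: nat}" "{2<..<4} = {3 :: nat}" "{3<..<4} = ({} :: nat set)"
    by auto
  show "{0, 1, 2, 3, 4, 5} = (\<Union>i<4. \<Union>j\<in>{i<..<4}. set (?P i j))"
    unfolding I(1) using I(2-5) by auto
  show "\<forall>x y. K33e_E x y \<longleftrightarrow> (\<exists>i j k. i < j \<and> j < 4 \<and> Suc k < length (?P i j) \<and> {x, y} = {?P i j ! k, ?P i j ! Suc k})"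
  proof (intro allI iffI)
    fix x y assume "K33e_E x y"
    then have "{x, y} = {0, 4} \<or> {x, y} = {4, 1} \<or> {x, y} = {0, 2} \<or> {x, y} = {0, 3} \<or> {x, y} = {1, 2}
      \<or> {x, y} = {1, 3} \<or> {x, y} = {2, 5} \<or> {x, y} = {5, 3}"
      unfolding K33e_E_def insert_iff empty_iff by (simp only: simp_thms)
    then show "\<exists>i j k. i < j \<and> j < 4 \<and> Suc k < length (?P i j) \<and> {x, y} = {?P i j ! k, ?P i j ! Suc k}"
    proof (elim disjE, goal_cases)
      case 1 show ?case unfolding 1 by (rule exI[of _ 0], rule exI[of _ 1], rule exI[of _ 0]) simp
    next
      case 2 show ?case unfolding 2 by (rule exI[of _ 0], rule exI[of _ 1], rule exI[of _ 1]) simp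
    next
      case 3 show ?case unfolding 3 by (rule exI[of _ 0], rule exI[of _ 2], rule exI[of _ 0]) simp
    next
      case 4 show ?case unfolding 4 by (rule exI[of _ 0], rule exI[of _ 3], rule exI[of _ 0]) simp
    next
      case 5 show ?case unfolding 5 by (rule exI[of _ 1], rule exI[of _ 2], rule exI[of _ 0]) simp
    next
      case 6 show ?case unfolding 6 by (rule exI[of _ 1], rule exI[of _ 3], rule exI[of _ 0]) simp
    next
      case 7 show ?case unfolding 7 by (rule exI[of _ 2], rule exI[of _ 3], rule exI[of _ 0]) simp
    next
      case 8 show ?case unfolding 8 by (rule exI[of _ 2], rule exI[of _ 3], rule exI[of _ 1]) simp
    qed
  next
    fix x y assume "\<exists>i j k. i < j \<and> j < 4 \<and> Suc k < length (?P i j) \<and> {x, y} = {?P i j ! k, ?P i j ! Suc k}"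
    then obtain i j k where h: "i < j" "j < 4" "Suc k < length (?P i j)" "{x, y} = {?P i j ! k, ?P i j ! Suc k}" by blast
    have two: "{[p, q] ! k, [p, q] ! Suc k} = {p, q}" if "Suc k < length [p, q]" for p q :: nat
      using that by simp
    have three: "{[p, q, s] ! k, [p, q, s] ! Suc k} = {p, q} \<or> {[p, q, s] ! k, [p, q, s] ! Suc k} = {q, s}"
      if "Suc k < length [p, q, s]" for p q s :: nat
    proof -
      have "k = 0 \<or> k = Suc 0" using that by auto
      then show ?thesis by (elim disjE) simp_all
    qed
    consider "i = 0" "j = 1" | "i = 2" "j = 3" | "\<not> (i = 0 \<and> j = 1)" "\<not> (i = 2 \<and> j = 3)" by blast
    then have "{x, y} \<in> {{0, 4}, {4, 1}, {0, 2}, {0, 3}, {1, 2}, {1, 3}, {2, 5}, {5, 3}}"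
    proof cases
      case 1
      then have w: "?P i j = [0, 4, 1]" by simp
      show ?thesis using three[OF h(3)[unfolded w]] unfolding h(4)[unfolded w] by (elim disjE) (simp_all only: insert_iff simp_thms)
    next
      case 2
      then have w: "?P i j = [2, 5, 3]" by simp
      show ?thesis using three[OF h(3)[unfolded w]] unfolding h(4)[unfolded w] by (elim disjE) (simp_all only: insert_iff simp_thms)
    next
      case 3
      then have w: "?P i j = [i, j]" by (simp only: if_False)
      have "i = 0 \<and> j = 2 \<or> i = 0 \<and> j = 3 \<or> i = 1 \<and> j = 2 \<or> i = 1 \<and> j = 3" using c[OF h(1,2)] 3 by blast
      then show ?thesis unfolding h(4)[unfolded w] two[OF h(3)[unfolded w]] by (elim disjE conjE) (simp_all only: insert_iff simp_thms)
    qed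
    then show "K33e_E x y" unfolding K33e_E_def .
  qed
qed

lemma bipartite_K33e: "bipartite X K33e_E"
  unfolding bipartite_def K33e_E_def
  by (rule exI[of _ "\<lambda>x. x \<in> {0, 1, 5}"]) (auto simp: doubleton_eq_iff)

text \<open>The eight vertices stand for the edges of \<open>K33e_E\<close>. The branch vertices 0,
  1, 2, 3 give the triangles \<open>v a b\<close>, \<open>w c d\<close>, \<open>a c e\<close>,
  \<open>b d f\<close>; the subdividing vertices 4 and 5 give the edges \<open>v w\<close> and
  \<open>e f\<close>.\<close>

lemma no_K33e:
  assumes g: "graph V E" and F: "F5 V E"
    and tri: "E v a" "E v b" "E a b" "E w c" "E w d" "E c d" "E a c" "E a e" "E c e" "E b d" "E b f" "E d f" and ed: "E v w" "E e f"
    and non: "\<not> E v c" "\<not> E v d" "\<not> E v e" "\<not> E v f" "\<not> E w a" "\<not> E w b" "\<not> E w e" "\<not> E w f"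
      "\<not> E a d" "\<not> E a f" "\<not> E b c" "\<not> E b e" "\<not> E c f" "\<not> E d e"
    and ne: "distinct [v, a, b, w, c, d, e, f]"
  shows False
proof -
  let ?L = "[({0, 4}, v), ({0, 2}, a), ({0, 3}, b), ({4, 1}, w), ({1, 2}, c), ({1, 3}, d), ({2, 5}, e), ({5, 3::nat}, f)]"
  have sym: "E y x" if "E x y" for x y using graph_sym[OF g that] .
  have irr: "\<not> E x x" for x by (rule graph_irrefl[OF g])
  define S :: "nat set set" where "S = {{0, 4}, {4, 1}, {0, 2}, {0, 3}, {1, 2}, {1, 3}, {2, 5}, {5, 3}}"
  have K: "K33e_E x y \<longleftrightarrow> {x, y} \<in> S" for x y by (simp only: K33e_E_def S_def)
  have dbl: "\<exists>x y. X = {x, y}" if "X \<in> S" for X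
    using that unfolding S_def insert_iff empty_iff by (elim disjE) blast+
  have lV: "lineV K33e_E = S"
    unfolding lineV_def K using dbl by blast
  define h where "h X = the (map_of ?L X)" for X
  have h: "h {0, 4} = v" "h {0, 2} = a" "h {0, 3} = b" "h {4, 1} = w" "h {1, 2} = c" "h {1, 3} = d" "h {2, 5} = e" "h {5, 3} = f"
    unfolding h_def by (simp_all add: doubleton_eq_iff)
  have V: "v \<in> V" "a \<in> V" "b \<in> V" "w \<in> V" "c \<in> V" "d \<in> V" "e \<in> V" "f \<in> V"
    using tri ed graph_in1[OF g] graph_in2[OF g] by blast+
  note e1 = tri ed tri[THEN sym] ed[THEN sym]
  have n2: "\<not> E y x" if "\<not> E x y" for x y using that sym by blast
  note n1 = non non[THEN n2]
  have "embeds V E (lineV K33e_E) (lineE K33e_E)"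
    unfolding embeds_def
  proof (intro exI[of _ h] conjI)
    show "inj_on h (lineV K33e_E)" unfolding lV S_def inj_on_def using ne by (auto simp: h doubleton_eq_iff simp del: One_nat_def)
    show "h ` lineV K33e_E \<subseteq> V" unfolding lV S_def by (simp add: h V del: One_nat_def)
    show "\<forall>x\<in>lineV K33e_E. \<forall>y\<in>lineV K33e_E. E (h x) (h y) \<longleftrightarrow> lineE K33e_E x y"
      unfolding lineE_def lV S_def by (simp add: h e1 n1 irr doubleton_eq_iff del: One_nat_def)
  qed
  then show False using F subdiv_K33e bipartite_K33e unfolding F5_def by blast
qed

section \<open>Irregular attachments of a shortest violating path\<close>

context dd_path
begin

text \<open>The head sees the rung \<open>i\<close> and the last vertex the rung \<open>j\<close>.
  If the rungs are joined, a path with more than two vertices is part of a long prism whose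
  triangles are \<open>hd vs\<close> with rung \<open>i\<close> and \<open>last vs\<close> with rung
  \<open>j\<close>, and an edge gives the line graph excluded by \<open>no_K33e\<close>. For the
  unjoined rungs 2 and 3, a hole through \<open>l 0\<close> rules out a single edge, and the prism
  uses \<open>l 0\<close> and \<open>r 1\<close> as connections.\<close>

lemma not_crossed:
  assumes ij: "i < 4" "j < 4" "i \<noteq> j" and i: "onL i" "\<And>z. z \<in> set vs \<Longrightarrow> E z (r i) \<longleftrightarrow> z = hd vs"
    and j: "onR j" "\<And>z. z \<in> set vs \<Longrightarrow> E z (l j) \<longleftrightarrow> z = last vs"
    and cl: "\<And>m. m < 4 \<Longrightarrow> m \<noteq> i \<Longrightarrow> m \<noteq> j \<Longrightarrow> noL m \<and> noR m"
  shows False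
proof (cases "adj4 i j")
  case True
  have ad: "adj4 j i" using True by (auto simp: adj4_def)
  show False
  proof (cases "length vs > 2")
    case True
    have P: "ipath V E [l i, l j]" "ipath V E [r i, r j]"
      using ij \<open>adj4 i j\<close> ad by (simp_all add: ipath_Cons[OF g] ipath_single[OF g])
    have c1: "cross E vs [l i, l j]" "cross E vs [r i, r j]"
      using ij att(1)[OF i(1)] i(2) att(3)[OF j(1)] j(2) vs_dis vs_ne unfolding cross_def by auto
    have c2: "cross E [l i, l j] [r i, r j]" unfolding cross_def using ij by auto
    show False using noprism long_prismI[OF g p P True _ _ c1 c2] by simp
  next
    case False
    then have "length vs = 2" using len by simp
    then obtain v w where vw: "vs = [v, w]" by (cases vs; cases "tl vs") auto
    \<comment> \<open>A third rung joined to both \<open>i\<close> and \<open>j\<close>: the other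
      one of 0 and 1 if a rung 2 or 3 is involved, and 2 if \<open>{i, j} = {0, 1}\<close>.\<close>
    define m where "m = (if i \<in> {2, 3} then 1 - j else if j \<in> {2, 3} then 1 - i else 2)"
    have i4: "i = 0 \<or> i = 1 \<or> i = 2 \<or> i = 3" "j = 0 \<or> j = 1 \<or> j = 2 \<or> j = 3" using ij by auto
    have m: "m < 4" "m \<noteq> i" "m \<noteq> j" "adj4 i m" "adj4 j m" "adj4 m i" "adj4 m j"
      using i4 ij(3) \<open>adj4 i j\<close> unfolding m_def by (elim disjE; simp add: adj4_def)+
    have cm: "noL m" "noR m" using cl[OF m(1-3)] by auto
    have vws: "v \<in> set vs" "w \<in> set vs" "v \<noteq> w" "hd vs = v" "last vs = w" using vw vs_ne(4) by auto
    have Evw: "E v w" using p vw by (simp add: ipath_Cons[OF g])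
    show False
      by (rule no_K33e[OF g F5, of v "l i" "r i" w "l j" "r j" "l m" "r m"])
        (use ij m Evw vws att(1)[OF i(1)] i(2) att(3)[OF j(1)] j(2) att(5)[OF cm(1)] att(7)[OF cm(2)] vs_dis(3-6) \<open>adj4 i j\<close> ad in auto)
  qed
next
  case False
  then have ij2: "i = 2 \<and> j = 3 \<or> i = 3 \<and> j = 2" using ij by (auto simp: adj4_def)
  have ad: "adj4 0 i" "adj4 0 j" "adj4 i 0" "adj4 j 0" "adj4 1 i" "adj4 1 j" "adj4 i 1" "adj4 j 1" "\<not> adj4 i j" "\<not> adj4 j i"
    using ij2 by (auto simp: adj4_def)
  have c0: "noL 0" "noR 1" using cl[of 0] cl[of 1] ij2 by auto
  have nz: "i \<noteq> 0" "j \<noteq> 0" "i \<noteq> 1" "j \<noteq> 1" using ij2 by auto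
  have w: "ipath V E ((l i # vs) @ [l j])"
    using ij ad j(2) sym vs_dis vs_ne by (intro ipath_snocI[OF g pathL[OF i(1)]]) auto
  have "odd (length ((l i # vs) @ [l j]))"
  proof (rule berge_close[OF g b w])
    show "l 0 \<in> V" "l 0 \<notin> set ((l i # vs) @ [l j])" "3 \<le> length ((l i # vs) @ [l j])"
      using ij ij2 vs_dis len by auto
    show "E (l 0) x \<longleftrightarrow> x = hd ((l i # vs) @ [l j]) \<or> x = last ((l i # vs) @ [l j])" if "x \<in> set ((l i # vs) @ [l j])" for x
      using that ij ad att(6)[OF c0(1)] vs_dis by auto
  qed
  then have l3: "length vs > 2" using len by (cases "length vs = 2") auto
  have P: "ipath V E [l i, l 0, l j]" "ipath V E [r i, r 1, r j]"
    using ij ad ij2 by (auto simp: ipath_Cons[OF g] ipath_single[OF g])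
  have c1: "cross E vs [l i, l 0, l j]" "cross E vs [r i, r 1, r j]"
    using ij nz att(1)[OF i(1)] i(2) att(3)[OF j(1)] j(2) att(5)[OF c0(1)] att(7)[OF c0(2)] vs_dis(3,4) vs_ne(4) vs_dis(1,2)
    unfolding cross_def by auto
  have c2: "cross E [l i, l 0, l j] [r i, r 1, r j]" unfolding cross_def using ij nz by auto
  show False using noprism long_prismI[OF g p P l3 _ _ c1 c2] by simp
qed

text \<open>Nothing is known about the neighbours of \<open>l j\<close> on the path, so only holes
  and prisms avoiding \<open>l j\<close> are used: \<open>parity1\<close>, \<open>parity3\<close>,
  \<open>prismC\<close> and \<open>prismE\<close>.\<close>

lemma not_lopsided:
  assumes j: "onR j" and nR: "\<And>m. m < 4 \<Longrightarrow> m \<noteq> j \<Longrightarrow> noR m"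
    and L: "\<And>m. m < 4 \<Longrightarrow> m \<noteq> j \<Longrightarrow> if I m then onL m else noL m" and i0: "i0 < 4" "i0 \<noteq> j" "I i0"
  shows False
proof -
  have j4: "j < 4" using att(10)[OF j] .
  have on: "onL m" if "m < 4" "m \<noteq> j" "I m" for m using L[OF that(1,2)] that by simp
  have no: "noL m" if "m < 4" "m \<noteq> j" "\<not> I m" for m using L[OF that(1,2)] that by simp
  have noadj: False if i: "i < 4" "i \<noteq> j" "I i" "adj4 i j" for i
  proof -
    have o: "odd (length vs)" using parity1[OF on[OF i(1-3)] j i(4) nR[OF i(1,2)]] .
    define m where "m = (if i \<in> {2, 3} then 1 - j else if j \<in> {2, 3} then 1 - i else 2)"
    have i4: "i = 0 \<or> i = 1 \<or> i = 2 \<or> i = 3" "j = 0 \<or> j = 1 \<or> j = 2 \<or> j = 3" using i j4 by auto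
    have m: "m < 4" "m \<noteq> i" "m \<noteq> j" "adj4 i m" "adj4 j m" "adj4 m i" "adj4 m j"
      using i4 i(2,4) unfolding m_def by (elim disjE; simp add: adj4_def)+
    show False
    proof (cases "I m")
      case True
      show False using prismE[OF on[OF i(1-3)] on[OF m(1,3) True] nR[OF i(1,2)] nR[OF m(1,3)] j m(4) i(4) m(7)] .
    next
      case False
      show False using parity3[OF on[OF i(1-3)] j i(2) no[OF m(1,3) False] nR[OF m(1,3)] m(4,7)] o by simp
    qed
  qed
  then have "\<not> adj4 i0 j" using i0 by blast
  then have c: "i0 = 2 \<and> j = 3 \<or> i0 = 3 \<and> j = 2" using i0 by (auto simp: adj4_def)
  have ad: "adj4 i0 0" "adj4 i0 1" "adj4 j 0" "adj4 j 1" "adj4 0 j" "adj4 1 j" "(0::nat) \<noteq> j" "(1::nat) \<noteq> j" "(0::nat) < 4" "(1::nat) < 4" "adj4 0 1"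
    using c by (auto simp: adj4_def)
  have "\<not> I 0" "\<not> I 1" using noadj[of 0] noadj[of 1] ad by blast+
  then show False
    using prismC[OF on[OF i0] j i0(2) no[OF ad(9,7)] nR[OF ad(9,7)] no[OF ad(10,8)] nR[OF ad(10,8)] ad(1,2,11,3,4)] by blast
qed

lemma onL_or_noL:
  assumes "m < 4" "\<And>z. z \<in> set vs \<Longrightarrow> E z (l m) \<Longrightarrow> z = hd vs"
  shows "if E (hd vs) (l m) then onL m else noL m"
proof (cases "E (hd vs) (l m)")
  case True
  then have "onL m" unfolding onL_def using assms by blast
  then show ?thesis using True by simp
next
  case False
  then have "noL m" unfolding noL_def using assms by blast
  then show ?thesis using False by simp
qed

lemma onR_or_noR:
  assumes "m < 4" "\<And>z. z \<in> set vs \<Longrightarrow> E z (r m) \<Longrightarrow> z = last vs"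
  shows "if E (last vs) (r m) then onR m else noR m"
proof (cases "E (last vs) (r m)")
  case True
  then have "onR m" unfolding onR_def using assms by blast
  then show ?thesis using True by simp
next
  case False
  then have "noR m" unfolding noR_def using assms by blast
  then show ?thesis using False by simp
qed

text \<open>\<open>M\<close> is the form in which minimality of the path enters: a violating pair of
  path vertices must be its two ends. It makes all attachments regular except those of
  \<open>l j0\<close> and \<open>r i0\<close>; these two are settled by \<open>not_crossed\<close>
  and \<open>not_lopsided\<close>, and \<open>straight\<close> applies to the rest.\<close>

lemma path_main:
  assumes M: "\<And>z z' i j. z \<in> set vs \<Longrightarrow> z' \<in> set vs \<Longrightarrow> i < 4 \<Longrightarrow> j < 4 \<Longrightarrow> i \<noteq> j \<Longrightarrow> E z (l i) \<Longrightarrow> E z' (r j) \<Longrightarrow>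
      z = hd vs \<and> z' = last vs \<or> z = last vs \<and> z' = hd vs"
    and ij: "i0 < 4" "j0 < 4" "i0 \<noteq> j0" "E (hd vs) (l i0)" "E (last vs) (r j0)"
  shows "\<exists>I. length vs = 2 \<and> (I 0 \<and> I 1 \<and> \<not> I 2 \<and> \<not> I 3 \<or> I 2 \<and> I 3 \<and> (I 0 \<or> I (1::nat))) \<and>
    (\<forall>m<4. (E (hd vs) (l m) \<longleftrightarrow> I m) \<and> (E (last vs) (r m) \<longleftrightarrow> I m) \<and> \<not> E (last vs) (l m) \<and> \<not> E (hd vs) (r m))"
proof -
  note he = vs_ne(2,3,4)
  have Lh: "z = hd vs" if "z \<in> set vs" "m < 4" "m \<noteq> j0" "E z (l m)" for z m
    using M[OF that(1) he(2) that(2) ij(2) that(3,4) ij(5)] he by auto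
  have Re: "z = last vs" if "z \<in> set vs" "m < 4" "m \<noteq> i0" "E z (r m)" for z m
    using M[OF he(1) that(1) ij(1) that(2) that(3)[symmetric] ij(4) that(4)] he by auto
  have onL0: "if E (hd vs) (l m) then onL m else noL m" if "m < 4" "m \<noteq> j0" for m
    using Lh[OF _ that] by (intro onL_or_noL that(1)) blast
  have onR0: "if E (last vs) (r m) then onR m else noR m" if "m < 4" "m \<noteq> i0" for m
    using Re[OF _ that] by (intro onR_or_noR that(1)) blast
  have oj: "onR j0" and oi: "onL i0" using onR0[OF ij(2)] onL0[OF ij(1)] ij by auto
  have crossed: False if z: "z \<in> set vs" "z = last vs" "E z (l j0)" and z': "z' \<in> set vs" "z' = hd vs" "E z' (r i0)" for z z'
  proof (rule not_crossed[OF ij(1-3) oi _ oj])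
    show "E y (r i0) \<longleftrightarrow> y = hd vs" if "y \<in> set vs" for y
      using M[OF z(1) that ij(2,1) ij(3)[symmetric] z(3)] z z' he by auto
    show "E y (l j0) \<longleftrightarrow> y = last vs" if "y \<in> set vs" for y
      using M[OF that z'(1) ij(2,1) ij(3)[symmetric] _ z'(3)] z z' he by auto
    show "noL m \<and> noR m" if m: "m < 4" "m \<noteq> i0" "m \<noteq> j0" for m
      using M[OF he(1) z'(1) m(1) ij(1) m(2) _ z'(3)] M[OF z(1) he(2) ij(2) m(1) m(3)[symmetric] z(3)]
        onL0[OF m(1,3)] onR0[OF m(1,2)] z(2) z'(2) he by (auto split: if_splits)
  qed
  have Lj: "z = hd vs" if z: "z \<in> set vs" "E z (l j0)" for z
  proof (rule ccontr)
    assume zh: "z \<noteq> hd vs"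
    have a: "z = last vs \<and> z' = hd vs" if "z' \<in> set vs" "m < 4" "m \<noteq> j0" "E z' (r m)" for z' m
      using M[OF z(1) that(1) ij(2) that(2) that(3)[symmetric] z(2) that(4)] zh by auto
    have "noR m" if m: "m < 4" "m \<noteq> j0" for m
    proof (cases "m = i0")
      case True
      have "\<not> E z' (r i0)" if "z' \<in> set vs" for z'
        using a[OF that ij(1,3)] crossed[OF z(1) _ z(2) that] by blast
      then show ?thesis using True m by (simp add: noR_def)
    next
      case False
      have "\<not> E z' (r m)" if "z' \<in> set vs" for z' using a[OF that m] Re[OF that m(1) False] he by auto
      then show ?thesis using m by (simp add: noR_def)
    qed
    from not_lopsided[OF oj this onL0 ij(1,3,4)] show False by blast
  qed
  have Ri: "z = last vs" if z: "z \<in> set vs" "E z (r i0)" for z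
  proof (rule ccontr)
    assume zh: "z \<noteq> last vs"
    have a: "z = hd vs \<and> z' = last vs" if "z' \<in> set vs" "m < 4" "m \<noteq> i0" "E z' (l m)" for z' m
      using M[OF that(1) z(1) that(2) ij(1) that(3,4) z(2)] zh by auto
    have "noL m" if m: "m < 4" "m \<noteq> i0" for m
    proof (cases "m = j0")
      case True
      have "\<not> E z' (l j0)" if "z' \<in> set vs" for z'
        using a[OF that ij(2) ij(3)[symmetric]] Lj[OF that] he by auto
      then show ?thesis using True m by (simp add: noL_def)
    next
      case False
      have "\<not> E z' (l m)" if "z' \<in> set vs" for z' using a[OF that m] Lh[OF that m(1) False] he by auto
      then show ?thesis using m by (simp add: noL_def)
    qed
    then have nl: "\<And>m. m < 4 \<Longrightarrow> m \<noteq> i0 \<Longrightarrow> dd_path.noR E l (rev vs) m" unfolding swap by blast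
    have oi': "dd_path.onR E l (rev vs) i0" unfolding swap by (rule oi)
    show False
      by (rule dd_path.not_lopsided[OF dd_path_swap[OF dd_path_axioms] oi' nl, of "\<lambda>m. E (last vs) (r m)" j0])
        (use onR0 ij in \<open>auto simp: swap\<close>)
  qed
  have I: "if E (hd vs) (l m) then onL m else noL m" if "m < 4" for m
    using Lh[OF _ that] Lj by (intro onL_or_noL that(1)) blast
  have J: "if E (last vs) (r m) then onR m else noR m" if "m < 4" for m
    using Re[OF _ that] Ri by (intro onR_or_noR that(1)) blast
  from straight[OF I J ij]
  have S: "length vs = 2" "\<forall>m<4. E (hd vs) (l m) = E (last vs) (r m)"
    "E (hd vs) (l 0) \<and> E (hd vs) (l 1) \<and> \<not> E (hd vs) (l 2) \<and> \<not> E (hd vs) (l 3) \<or>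
     E (hd vs) (l 2) \<and> E (hd vs) (l 3) \<and> (E (hd vs) (l 0) \<or> E (hd vs) (l 1))" by auto
  have "\<not> E (last vs) (l m)" "\<not> E (hd vs) (r m)" if "m < 4" for m
    using I[OF that] J[OF that] he by (auto simp: onL_def noL_def onR_def noR_def split: if_splits)
  then show ?thesis using S by (intro exI[of _ "\<lambda>m. E (hd vs) (l m)"]) auto
qed

end

lemma ipath_slice:
  assumes g: "graph V E" and p: "ipath V E vs" and ab: "a < length vs" "b < length vs"
  shows "\<exists>ws. ipath V E ws \<and> set ws \<subseteq> set vs \<and> hd ws = vs ! a \<and> last ws = vs ! b \<and> length ws = Suc (max a b - min a b)"
proof -
  have *: "\<exists>ws. ipath V E ws \<and> set ws \<subseteq> set vs \<and> hd ws = vs ! a \<and> last ws = vs ! b \<and> length ws = Suc (b - a)"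
    if "a \<le> b" "b < length vs" for a b
  proof (intro exI conjI)
    let ?w = "take (Suc (b - a)) (drop a vs)"
    show "ipath V E ?w" using that by (intro ipath_take ipath_drop[OF p]) auto
    show "set ?w \<subseteq> set vs" by (meson order_trans set_drop_subset set_take_subset)
    show "hd ?w = vs ! a" "length ?w = Suc (b - a)" using that by (auto simp: hd_drop_conv_nth)
    show "last ?w = vs ! b" using that by (subst last_conv_nth) auto
  qed
  show ?thesis
  proof (cases "a \<le> b")
    case True then show ?thesis using *[of a b] ab by auto
  next
    case False
    then obtain ws where ws: "ipath V E ws" "set ws \<subseteq> set vs" "hd ws = vs ! b" "last ws = vs ! a" "length ws = Suc (a - b)"
      using *[of b a] ab by auto
    then have "ws \<noteq> []" by auto
    then show ?thesis using ws False ipath_rev[OF g ws(1)]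
      by (intro exI[of _ "rev ws"]) (auto simp: hd_rev last_rev)
  qed
qed

text \<open>The path is chosen shortest over all violated pairs of diamond vertices. Every subpath
  joining a violating pair is then a competitor, which yields the hypothesis \<open>M\<close> of
  \<open>path_main\<close>; a single vertex cannot violate because of \<open>minor\<close>.\<close>

lemma ddiamond_connected:
  assumes g: "graph V E" and F5: "F5 V E" and D: "ddiamond V E l r"
    and F: "F \<subseteq> V" "conn F E" "\<And>z m. z \<in> F \<Longrightarrow> m < 4 \<Longrightarrow> z \<noteq> l m \<and> z \<noteq> r m"
    and minor: "\<And>z i j. z \<in> F \<Longrightarrow> i < 4 \<Longrightarrow> j < 4 \<Longrightarrow> i \<noteq> j \<Longrightarrow> \<not> (E z (l i) \<and> E z (r j))"
    and bad: "x \<in> F" "y \<in> F" "i0 < 4" "j0 < 4" "i0 \<noteq> j0" "E x (l i0)" "E y (r j0)"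
  shows "\<exists>v\<in>F. \<exists>w\<in>F. \<exists>I. E v w \<and> (I 0 \<and> I 1 \<and> \<not> I 2 \<and> \<not> I 3 \<or> I 2 \<and> I 3 \<and> (I 0 \<or> I (1::nat))) \<and>
    (\<forall>m<4. (E v (l m) \<longleftrightarrow> I m) \<and> (E w (r m) \<longleftrightarrow> I m) \<and> \<not> E w (l m) \<and> \<not> E v (r m))"
proof -
  define Q where "Q vs i j \<longleftrightarrow> ipath V E vs \<and> set vs \<subseteq> F \<and> i < 4 \<and> j < 4 \<and> i \<noteq> j \<and> E (hd vs) (l i) \<and> E (last vs) (r j)" for vs i j
  obtain vs0 where "ipath V E vs0" "set vs0 \<subseteq> F" "hd vs0 = x" "last vs0 = y"
    using conn_ipath[OF g F(1,2) bad(1,2)] by blast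
  then have Q0: "\<exists>vs i j. Q vs i j \<and> length vs = length vs0" using bad unfolding Q_def by blast
  define k where "k = (LEAST k. \<exists>vs i j. Q vs i j \<and> length vs = k)"
  obtain vs i j where Q: "Q vs i j" "length vs = k"
    using LeastI_ex[of "\<lambda>k. \<exists>vs i j. Q vs i j \<and> length vs = k"] Q0 unfolding k_def by blast
  have least: "k \<le> length ws" if "Q ws i' j'" for ws i' j'
    unfolding k_def by (rule Least_le) (use that in blast)
  have p: "ipath V E vs" and sub: "set vs \<subseteq> F" and ij: "i < 4" "j < 4" "i \<noteq> j" "E (hd vs) (l i)" "E (last vs) (r j)"
    using Q unfolding Q_def by auto
  have ne: "vs \<noteq> []" using p ipath_Nil by auto
  have len: "length vs \<ge> 2"
  proof (rule ccontr)
    assume "\<not> 2 \<le> length vs"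
    moreover have "length vs \<noteq> 0" using ne by simp
    ultimately have "length vs = Suc 0" by linarith
    then obtain z where "vs = [z]" by (auto simp: length_Suc_conv)
    then show False using minor[of z i j] ij sub by auto
  qed
  interpret dd_path V E l r vs
    by unfold_locales (use g F5 D p len F(3) sub in auto)
  have M: "z = hd vs \<and> z' = last vs \<or> z = last vs \<and> z' = hd vs"
    if h: "z \<in> set vs" "z' \<in> set vs" "i' < 4" "j' < 4" "i' \<noteq> j'" "E z (l i')" "E z' (r j')" for z z' i' j'
  proof -
    obtain a a' where a: "a < length vs" "z = vs ! a" "a' < length vs" "z' = vs ! a'"
      using h(1,2) by (metis in_set_conv_nth)
    obtain ws where ws: "ipath V E ws" "set ws \<subseteq> set vs" "hd ws = z" "last ws = z'" "length ws = Suc (max a a' - min a a')"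
      using ipath_slice[OF g p a(1,3)] a by blast
    then have "Q ws i' j'" using h sub unfolding Q_def by auto
    from least[OF this] have "length vs \<le> Suc (max a a' - min a a')" using ws Q by simp
    then have "a = 0 \<and> a' = length vs - 1 \<or> a = length vs - 1 \<and> a' = 0"
      using a(1,3) by (auto simp: min_def max_def split: if_splits)
    then show ?thesis using a ne by (auto simp: hd_conv_nth last_conv_nth)
  qed
  obtain I where "length vs = 2 \<and> (I 0 \<and> I 1 \<and> \<not> I 2 \<and> \<not> I 3 \<or> I 2 \<and> I 3 \<and> (I 0 \<or> I (1::nat))) \<and>
    (\<forall>m<4. (E (hd vs) (l m) \<longleftrightarrow> I m) \<and> (E (last vs) (r m) \<longleftrightarrow> I m) \<and> \<not> E (last vs) (l m) \<and> \<not> E (hd vs) (r m))"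
    using path_main[OF M ij] by (rule exE)
  then have I: "length vs = 2" "I 0 \<and> I 1 \<and> \<not> I 2 \<and> \<not> I 3 \<or> I 2 \<and> I 3 \<and> (I 0 \<or> I (1::nat))"
    "\<forall>m<4. (E (hd vs) (l m) \<longleftrightarrow> I m) \<and> (E (last vs) (r m) \<longleftrightarrow> I m) \<and> \<not> E (last vs) (l m) \<and> \<not> E (hd vs) (r m)"
    by (rule conjunct1, rule conjunct2[THEN conjunct1], rule conjunct2[THEN conjunct2])
  obtain v w where vw: "vs = [v, w]" using I(1) by (cases vs; cases "tl vs") auto
  then have "E v w" using p by (simp add: ipath_Cons[OF g])
  moreover have "v \<in> F" "w \<in> F" "hd vs = v" "last vs = w" using vw sub by auto
  ultimately show ?thesis using I(2,3) by metis
qed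

section \<open>Square-connected pairs\<close>

definition square :: "('a \<Rightarrow> 'a \<Rightarrow> bool) \<Rightarrow> 'a \<Rightarrow> 'a \<Rightarrow> 'a \<Rightarrow> 'a \<Rightarrow> bool" where
  "square E a1 a2 b1 b2 \<longleftrightarrow> E a1 a2 \<and> E b1 b2 \<and> E a1 b1 \<and> E a2 b2 \<and> \<not> E a1 b2 \<and> \<not> E a2 b1"

definition squares :: "('a \<Rightarrow> 'a \<Rightarrow> bool) \<Rightarrow> 'a set \<Rightarrow> 'a set \<Rightarrow> 'a \<Rightarrow> 'a \<Rightarrow> 'a \<Rightarrow> 'a \<Rightarrow> bool" where
  "squares E A B a1 a2 b1 b2 \<longleftrightarrow> a1 \<in> A \<and> a2 \<in> A \<and> b1 \<in> B \<and> b2 \<in> B \<and> square E a1 a2 b1 b2"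

text \<open>Connectivity in cut form: no proper nonempty subset of \<open>A\<close> or of
  \<open>B\<close> is respected by all squares. Thus a property that holds for one vertex and fails
  for another on the same side changes within a single square. The first conjunct puts at least two
  vertices on each side.\<close>

definition sqconn :: "('a \<Rightarrow> 'a \<Rightarrow> bool) \<Rightarrow> 'a set \<Rightarrow> 'a set \<Rightarrow> bool" where
  "sqconn E A B \<longleftrightarrow> (\<exists>a1 a2 b1 b2. squares E A B a1 a2 b1 b2) \<and>
     (\<forall>X\<subseteq>A. X \<noteq> {} \<and> X \<noteq> A \<longrightarrow> (\<exists>a1 a2 b1 b2. squares E A B a1 a2 b1 b2 \<and> a1 \<in> X \<and> a2 \<notin> X)) \<and>
     (\<forall>Y\<subseteq>B. Y \<noteq> {} \<and> Y \<noteq> B \<longrightarrow> (\<exists>a1 a2 b1 b2. squares E A B a1 a2 b1 b2 \<and> b1 \<in> Y \<and> b2 \<notin> Y))"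

lemma squares_flip: "graph V E \<Longrightarrow> squares E A B a1 a2 b1 b2 \<Longrightarrow> squares E B A b1 b2 a1 a2"
  using graph_sym_iff[of V E] unfolding squares_def square_def by metis

lemma squares_swap: "graph V E \<Longrightarrow> squares E A B a1 a2 b1 b2 \<Longrightarrow> squares E A B a2 a1 b2 b1"
  using graph_sym_iff[of V E] unfolding squares_def square_def by metis

lemma sqconn_flip:
  assumes g: "graph V E" and "sqconn E A B"
  shows "sqconn E B A"
proof -
  have h: "\<exists>a1 a2 b1 b2. squares E A B a1 a2 b1 b2"
    "\<And>X. X \<subseteq> A \<Longrightarrow> X \<noteq> {} \<and> X \<noteq> A \<Longrightarrow> \<exists>a1 a2 b1 b2. squares E A B a1 a2 b1 b2 \<and> a1 \<in> X \<and> a2 \<notin> X"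
    "\<And>Y. Y \<subseteq> B \<Longrightarrow> Y \<noteq> {} \<and> Y \<noteq> B \<Longrightarrow> \<exists>a1 a2 b1 b2. squares E A B a1 a2 b1 b2 \<and> b1 \<in> Y \<and> b2 \<notin> Y"
    using assms(2) unfolding sqconn_def by simp_all
  show ?thesis
    unfolding sqconn_def
  proof (intro conjI allI impI, goal_cases)
    case 1 show ?case using h(1) squares_flip[OF g, of A B] by meson
  next
    case (2 X) from h(3)[OF this] show ?case using squares_flip[OF g, of A B] by meson
  next
    case (3 Y) from h(2)[OF this] show ?case using squares_flip[OF g, of A B] by meson
  qed
qed

lemma sqconn_cross:
  assumes "sqconn E A B" "a \<in> A" "P a" "a' \<in> A" "\<not> P a'"
  obtains a1 a2 b1 b2 where "squares E A B a1 a2 b1 b2" "P a1" "\<not> P a2"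
proof -
  let ?X = "{x\<in>A. P x}"
  have "?X \<subseteq> A" "?X \<noteq> {}" "?X \<noteq> A" using assms by auto
  then obtain a1 a2 b1 b2 where s: "squares E A B a1 a2 b1 b2" "a1 \<in> ?X" "a2 \<notin> ?X"
    using assms(1)[unfolded sqconn_def, THEN conjunct2, THEN conjunct1, rule_format, of ?X] by blast
  then have "a2 \<in> A" by (simp add: squares_def)
  then show thesis using that s by blast
qed

lemma sqconn_cover:
  assumes g: "graph V E" and c: "sqconn E A B" and a: "a \<in> A"
  obtains a2 b1 b2 where "squares E A B a a2 b1 b2"
proof -
  obtain x1 x2 y1 y2 where s: "squares E A B x1 x2 y1 y2" using c[unfolded sqconn_def, THEN conjunct1] by blast
  then have x: "x1 \<in> A" "x2 \<in> A" "x1 \<noteq> x2" using graph_irrefl[OF g] unfolding squares_def square_def by auto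
  then obtain a' where "a' \<in> A" "a' \<noteq> a" by (cases "x1 = a") auto
  then obtain z1 z2 b1 b2 where "squares E A B z1 z2 b1 b2" "z1 = a"
    using sqconn_cross[OF c a, of "\<lambda>z. z = a" a'] by metis
  then show thesis using that by simp
qed

lemma sqconn_closed:
  assumes c: "sqconn E A B" and a: "a \<in> A" "P a" and cl: "\<And>a1 a2 b1 b2. squares E A B a1 a2 b1 b2 \<Longrightarrow> P a1 \<Longrightarrow> P a2"
    and z: "z \<in> A"
  shows "P z"
proof (rule ccontr)
  assume "\<not> P z"
  from sqconn_cross[OF c a z this] cl show False by metis
qed

lemma squares_mono: "squares E A B a1 a2 b1 b2 \<Longrightarrow> A \<subseteq> A' \<Longrightarrow> B \<subseteq> B' \<Longrightarrow> squares E A' B' a1 a2 b1 b2"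
  unfolding squares_def by blast

text \<open>Allows for a second new vertex on the right; if there is none, take \<open>B' = B\<close>.\<close>
lemma sqconn_extend_left:
  assumes g: "graph V E" and c: "sqconn E A B" and B: "B \<subseteq> B'" and a: "a \<in> A"
    and s: "squares E (insert v A) B' v a x y" and X: "X \<subseteq> insert v A" "X \<noteq> {}" "X \<noteq> insert v A"
  shows "\<exists>a1 a2 b1 b2. squares E (insert v A) B' a1 a2 b1 b2 \<and> a1 \<in> X \<and> a2 \<notin> X"
proof (cases "X \<inter> A = {}")
  case True
  then have "X = {v}" "a \<notin> X" using X a by auto
  then show ?thesis using s by blast
next
  case F: False
  show ?thesis
  proof (cases "A \<subseteq> X")
    case True
    then have "v \<notin> X" "a \<in> X" using X a by auto
    then show ?thesis using squares_swap[OF g s] by blast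
  next
    case False
    then obtain p q where "p \<in> A" "p \<in> X" "q \<in> A" "q \<notin> X" using F by blast
    then obtain a1 a2 b1 b2 where "squares E A B a1 a2 b1 b2" "a1 \<in> X" "a2 \<notin> X"
      using sqconn_cross[OF c, of p "\<lambda>z. z \<in> X" q] by metis
    then show ?thesis using squares_mono[OF _ _ B, of E A a1 a2 b1 b2 "insert v A"] by blast
  qed
qed

lemma sqconn_insert:
  assumes g: "graph V E" and c: "sqconn E A B" and s: "squares E (insert v A) B v a b1 b2" and a: "a \<in> A"
  shows "sqconn E (insert v A) B"
  unfolding sqconn_def
proof (intro conjI allI impI, goal_cases)
  case 1 then show ?case using s by blast
next
  case (2 X) then show ?case using sqconn_extend_left[OF g c order_refl a s, of X] by blast
next
  case (3 Y)
  then obtain a1 a2 b1 b2 where "squares E A B a1 a2 b1 b2" "b1 \<in> Y" "b2 \<notin> Y"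
    using c[unfolded sqconn_def, THEN conjunct2, THEN conjunct2, rule_format, of Y] by blast
  then show ?case using squares_mono[of E A B a1 a2 b1 b2 "insert v A" B] by blast
qed

text \<open>Both new vertices lie in the same square, so they enter together; each side is handled
  with the other one already enlarged. The two alternatives are needed because a new adjacent pair
  is joined in \<open>E\<close>, for \<open>(A, B)\<close>, but not in the complement, for
  \<open>(C, D)\<close>.\<close>

lemma sqconn_insert2:
  assumes g: "graph V E" and c: "sqconn E A B" and ab: "a \<in> A" "b \<in> B"
    and s: "square E v a w b \<or> square E v a b w"
  shows "sqconn E (insert v A) (insert w B)"
proof -
  have c': "sqconn E B A" by (rule sqconn_flip[OF g c])
  obtain x y where s1: "squares E (insert v A) (insert w B) v a x y"
    using s ab unfolding squares_def by blast
  have sy: "E p q \<longleftrightarrow> E q p" for p q by (rule graph_sym_iff[OF g])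
  have "square E w b v a \<or> square E w b a v" using s sy unfolding square_def by metis
  then obtain x' y' where s2: "squares E (insert w B) (insert v A) w b x' y'"
    using ab unfolding squares_def by blast
  show ?thesis
    unfolding sqconn_def
  proof (intro conjI allI impI, goal_cases)
    case 1 then show ?case using s1 by blast
  next
    case (2 X) then show ?case using sqconn_extend_left[OF g c subset_insertI ab(1) s1, of X] by blast
  next
    case (3 Y)
    then obtain b1 b2 a1 a2 where "squares E (insert w B) (insert v A) b1 b2 a1 a2" "b1 \<in> Y" "b2 \<notin> Y"
      using sqconn_extend_left[OF g c' subset_insertI ab(2) s2, of Y] by blast
    then show ?case using squares_flip[OF g, of "insert w B" "insert v A"] by blast
  qed
qed

definition config :: "'a set \<Rightarrow> ('a \<Rightarrow> 'a \<Rightarrow> bool) \<Rightarrow> 'a set \<Rightarrow> 'a set \<Rightarrow> 'a set \<Rightarrow> 'a set \<Rightarrow> bool" where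
  "config V E A B C D \<longleftrightarrow> A \<union> B \<union> C \<union> D \<subseteq> V \<and> A \<inter> B = {} \<and> A \<inter> C = {} \<and> A \<inter> D = {} \<and> B \<inter> C = {} \<and> B \<inter> D = {} \<and> C \<inter> D = {} \<and>
     sqconn E A B \<and> sqconn (compl V E) C D \<and>
     (\<forall>a\<in>A. \<forall>c\<in>C. E a c) \<and> (\<forall>b\<in>B. \<forall>d\<in>D. E b d) \<and> (\<forall>a\<in>A. \<forall>d\<in>D. \<not> E a d) \<and> (\<forall>b\<in>B. \<forall>c\<in>C. \<not> E b c)"

lemma config_swap:
  assumes g: "graph V E" and c: "config V E A B C D"
  shows "config V E B A D C"
proof -
  have "sqconn E B A" "sqconn (compl V E) D C"
    using c sqconn_flip[OF g, of A B] sqconn_flip[OF graph_compl[OF g], of C D] unfolding config_def by blast+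
  then show ?thesis using c unfolding config_def by blast
qed

text \<open>The last two sets appear as \<open>B\<close>, \<open>A\<close> because in the complement
  \<open>C\<close> is complete to \<open>B\<close> and \<open>D\<close> is complete to
  \<open>A\<close>.\<close>

lemma config_dual:
  assumes g: "graph V E" and c: "config V E A B C D"
  shows "config V (compl V E) C D B A"
proof -
  have sub: "A \<union> B \<union> C \<union> D \<subseteq> V" and dis: "A \<inter> B = {}" "A \<inter> C = {}" "A \<inter> D = {}" "B \<inter> C = {}" "B \<inter> D = {}" "C \<inter> D = {}"
    and sq: "sqconn E A B" "sqconn (compl V E) C D"
    and e: "\<And>a c. a \<in> A \<Longrightarrow> c \<in> C \<Longrightarrow> E a c" "\<And>b d. b \<in> B \<Longrightarrow> d \<in> D \<Longrightarrow> E b d"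
      "\<And>a d. a \<in> A \<Longrightarrow> d \<in> D \<Longrightarrow> \<not> E a d" "\<And>b c. b \<in> B \<Longrightarrow> c \<in> C \<Longrightarrow> \<not> E b c"
    using c unfolding config_def by blast+
  have sy: "E p q \<longleftrightarrow> E q p" for p q by (rule graph_sym_iff[OF g])
  have sq': "sqconn (compl V (compl V E)) B A" unfolding compl_compl[OF g] by (rule sqconn_flip[OF g sq(1)])
  have ne: "p \<noteq> q" if "p \<in> X" "q \<in> Y" "X \<inter> Y = {}" for p q :: 'a and X Y using that by auto
  have V: "z \<in> V" if "z \<in> A \<or> z \<in> B \<or> z \<in> C \<or> z \<in> D" for z using that sub by blast
  have "compl V E c b" if "c \<in> C" "b \<in> B" for b c
    using V[of b] V[of c] that e(4)[OF that(2,1)] sy[of b c] ne[OF that(2,1) dis(4)] by (auto simp: compl_def)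
  then have 1: "\<forall>c\<in>C. \<forall>b\<in>B. compl V E c b" by blast
  have "compl V E d a" if "d \<in> D" "a \<in> A" for a d
    using V[of a] V[of d] that e(3)[OF that(2,1)] sy[of a d] ne[OF that(2,1) dis(3)] by (auto simp: compl_def)
  then have 2: "\<forall>d\<in>D. \<forall>a\<in>A. compl V E d a" by blast
  have "\<not> compl V E c a" if "c \<in> C" "a \<in> A" for a c
    using e(1)[OF that(2,1)] sy[of a c] by (simp add: compl_def)
  then have 3: "\<forall>c\<in>C. \<forall>a\<in>A. \<not> compl V E c a" by blast
  have "\<not> compl V E d b" if "d \<in> D" "b \<in> B" for b d
    using e(2)[OF that(2,1)] sy[of b d] by (simp add: compl_def)
  then have 4: "\<forall>d\<in>D. \<forall>b\<in>B. \<not> compl V E d b" by blast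
  have 5: "C \<union> D \<union> B \<union> A \<subseteq> V" "C \<inter> D = {}" "C \<inter> B = {}" "C \<inter> A = {}" "D \<inter> B = {}" "D \<inter> A = {}" "B \<inter> A = {}"
    using sub dis by blast+
  show ?thesis unfolding config_def by (intro conjI 1 2 3 4 5 sq(2) sq')
qed

locale maximal_config =
  fixes V :: "'a set" and E :: "'a \<Rightarrow> 'a \<Rightarrow> bool" and A B C D :: "'a set"
  assumes g: "graph V E" and F5: "F5 V E" and config: "config V E A B C D"
    and maximal: "\<And>A' B' C' D'. config V E A' B' C' D' \<Longrightarrow> card (A' \<union> B' \<union> C' \<union> D') \<le> card (A \<union> B \<union> C \<union> D)"

lemma maximal_config_swap: "maximal_config V E A B C D \<Longrightarrow> maximal_config V E B A D C"
  unfolding maximal_config_def using config_swap by (metis Un_commute Un_assoc)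

lemma maximal_config_dual:
  assumes "maximal_config V E A B C D"
  shows "maximal_config V (compl V E) C D B A"
proof -
  interpret maximal_config V E A B C D by fact
  have "card (A' \<union> B' \<union> C' \<union> D') \<le> card (C \<union> D \<union> B \<union> A)" if "config V (compl V E) A' B' C' D'" for A' B' C' D'
  proof -
    have "config V E C' D' B' A'" using config_dual[OF graph_compl[OF g] that] unfolding compl_compl[OF g] .
    from maximal[OF this] show ?thesis by (simp add: Un_ac)
  qed
  then show ?thesis using graph_compl[OF g] F5_compl[OF g F5] config_dual[OF g config] by unfold_locales
qed

context maximal_config
begin

abbreviation L where "L \<equiv> A \<union> C"
abbreviation R where "R \<equiv> B \<union> D"

lemma b: "berge V E" using F5 by (simp add: F5_def)
lemma gc: "graph V (compl V E)" by (rule graph_compl[OF g])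
lemma sym: "E x y \<longleftrightarrow> E y x" by (rule graph_sym_iff[OF g])

lemma parts: "A \<subseteq> V" "B \<subseteq> V" "C \<subseteq> V" "D \<subseteq> V" "A \<inter> B = {}" "A \<inter> C = {}" "A \<inter> D = {}" "B \<inter> C = {}" "B \<inter> D = {}" "C \<inter> D = {}"
  and sqAB: "sqconn E A B" and sqCD: "sqconn (compl V E) C D"
  using config unfolding config_def Un_subset_iff by simp_all

lemma AC: "a \<in> A \<Longrightarrow> c \<in> C \<Longrightarrow> E a c" "a \<in> A \<Longrightarrow> c \<in> C \<Longrightarrow> E c a"
  and BD: "b \<in> B \<Longrightarrow> d \<in> D \<Longrightarrow> E b d" "b \<in> B \<Longrightarrow> d \<in> D \<Longrightarrow> E d b"
  and AD: "a \<in> A \<Longrightarrow> d \<in> D \<Longrightarrow> \<not> E a d" "a \<in> A \<Longrightarrow> d \<in> D \<Longrightarrow> \<not> E d a"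
  and BC: "b \<in> B \<Longrightarrow> c \<in> C \<Longrightarrow> \<not> E b c" "b \<in> B \<Longrightarrow> c \<in> C \<Longrightarrow> \<not> E c b"
  using config sym[of a c] sym[of b d] sym[of a d] sym[of b c] unfolding config_def by blast+

abbreviation sq where "sq \<equiv> squares E A B"
text \<open>The last two arguments are exchanged so that \<open>c\<^sub>i\<close> and \<open>d\<^sub>i\<close> are adjacent in \<open>E\<close>.\<close>
definition asq where "asq c1 c2 d1 d2 \<longleftrightarrow> squares (compl V E) C D c1 c2 d2 d1"

lemma sqD: "sq a1 a2 b1 b2 \<Longrightarrow> a1 \<in> A \<and> a2 \<in> A \<and> b1 \<in> B \<and> b2 \<in> B \<and> E a1 a2 \<and> E b1 b2 \<and> E a1 b1 \<and> E a2 b2 \<and> \<not> E a1 b2 \<and> \<not> E a2 b1 \<and> a1 \<noteq> a2 \<and> b1 \<noteq> b2"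
  using graph_neq[OF g] unfolding squares_def square_def by blast

lemma asqD:
  assumes "asq c1 c2 d1 d2"
  shows "c1 \<in> C \<and> c2 \<in> C \<and> d1 \<in> D \<and> d2 \<in> D \<and> \<not> E c1 c2 \<and> \<not> E d1 d2 \<and> E c1 d1 \<and> E c2 d2 \<and> \<not> E c1 d2 \<and> \<not> E c2 d1 \<and> c1 \<noteq> c2 \<and> d1 \<noteq> d2"
proof -
  have m: "c1 \<in> C" "c2 \<in> C" "d1 \<in> D" "d2 \<in> D" and h: "compl V E c1 c2" "compl V E d2 d1" "compl V E c1 d2" "compl V E c2 d1"
    "\<not> compl V E c1 d1" "\<not> compl V E c2 d2"
    using assms unfolding asq_def squares_def square_def by simp_all
  have n: "c1 \<noteq> d1" "c2 \<noteq> d2" using m parts(10) by auto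
  have V: "c1 \<in> V" "c2 \<in> V" "d1 \<in> V" "d2 \<in> V" using m parts(3,4) by auto
  show ?thesis using h n V m sym[of d1 d2] by (auto simp: compl_def)
qed

lemma asqI:
  assumes "c1 \<in> C" "c2 \<in> C" "d1 \<in> D" "d2 \<in> D" "\<not> E c1 c2" "\<not> E d1 d2" "E c1 d1" "E c2 d2" "\<not> E c1 d2" "\<not> E c2 d1" "c1 \<noteq> c2" "d1 \<noteq> d2"
  shows "asq c1 c2 d1 d2"
proof -
  have n: "c1 \<noteq> d2" "c2 \<noteq> d1" using assms parts(10) by auto
  have V: "c1 \<in> V" "c2 \<in> V" "d1 \<in> V" "d2 \<in> V" using assms parts(3,4) by auto
  show ?thesis using assms n V sym[of d1 d2] by (simp add: asq_def squares_def square_def compl_def)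
qed

lemma asq_swap: "asq c1 c2 d1 d2 \<Longrightarrow> asq c2 c1 d2 d1"
  unfolding asq_def by (rule squares_swap[OF gc])

lemma sq_swap: "sq a1 a2 b1 b2 \<Longrightarrow> sq a2 a1 b2 b1"
  by (rule squares_swap[OF g])

lemma sq_ex: obtains a1 a2 b1 b2 where "sq a1 a2 b1 b2"
  using sqAB[unfolded sqconn_def, THEN conjunct1] by (elim exE)

lemma asq_ex: obtains c1 c2 d1 d2 where "asq c1 c2 d1 d2"
proof -
  obtain c1 c2 d2 d1 where "squares (compl V E) C D c1 c2 d2 d1"
    using sqCD[unfolded sqconn_def, THEN conjunct1] by (elim exE)
  then show thesis using that[unfolded asq_def] by blast
qed

lemma A_cover: assumes "a \<in> A" obtains a2 b1 b2 where "sq a a2 b1 b2"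
  using sqconn_cover[OF g sqAB assms] .

lemma B_cover: assumes "y \<in> B" obtains a1 a2 b2 where "sq a1 a2 y b2"
  using sqconn_cover[OF g sqconn_flip[OF g sqAB] assms] squares_flip[OF g, of B A] by metis

lemma C_cover: assumes "c \<in> C" obtains c2 d1 d2 where "asq c c2 d1 d2"
  using sqconn_cover[OF gc sqCD assms] unfolding asq_def by metis

lemma D_cover: assumes "d \<in> D" obtains c1 c2 d2 where "asq c1 c2 d d2"
  using sqconn_cover[OF gc sqconn_flip[OF gc sqCD] assms] squares_flip[OF gc, of D C] squares_swap[OF gc, of C D]
  unfolding asq_def by metis

lemma A_cross: assumes "a \<in> A" "P a" "a' \<in> A" "\<not> P a'" obtains a1 a2 b1 b2 where "sq a1 a2 b1 b2" "P a1" "\<not> P a2"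
  using sqconn_cross[OF sqAB assms] by metis

lemma B_cross: assumes "y \<in> B" "P y" "y' \<in> B" "\<not> P y'" obtains a1 a2 b1 b2 where "sq a1 a2 b1 b2" "P b1" "\<not> P b2"
  using sqconn_cross[OF sqconn_flip[OF g sqAB] assms] squares_flip[OF g, of B A] by metis

lemma C_cross: assumes "c \<in> C" "P c" "c' \<in> C" "\<not> P c'" obtains c1 c2 d1 d2 where "asq c1 c2 d1 d2" "P c1" "\<not> P c2"
  using sqconn_cross[OF sqCD assms] unfolding asq_def by metis

lemma D_cross: assumes "d \<in> D" "P d" "d' \<in> D" "\<not> P d'" obtains c1 c2 d1 d2 where "asq c1 c2 d1 d2" "P d1" "\<not> P d2"
  using sqconn_cross[OF sqconn_flip[OF gc sqCD] assms] squares_flip[OF gc, of D C] squares_swap[OF gc, of C D]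
  unfolding asq_def by metis

end

section \<open>Attachments of a single vertex to a maximal configuration\<close>

text \<open>For the diamond with rungs \<open>a1 b1\<close>, \<open>a2 b2\<close>, \<open>c1 d1\<close>, \<open>c2 d2\<close>: no two non-adjacent vertices on opposite sides are both neighbours.\<close>
definition minor_on :: "('a \<Rightarrow> 'a \<Rightarrow> bool) \<Rightarrow> 'a \<Rightarrow> 'a \<Rightarrow> 'a \<Rightarrow> 'a \<Rightarrow> 'a \<Rightarrow> 'a \<Rightarrow> 'a \<Rightarrow> 'a \<Rightarrow> 'a \<Rightarrow> bool" where
  "minor_on E v a1 a2 b1 b2 c1 c2 d1 d2 \<longleftrightarrow>
     (E v a1 \<longrightarrow> \<not> E v b2 \<and> \<not> E v d1 \<and> \<not> E v d2) \<and> (E v a2 \<longrightarrow> \<not> E v b1 \<and> \<not> E v d1 \<and> \<not> E v d2) \<and>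
     (E v c1 \<longrightarrow> \<not> E v d2 \<and> \<not> E v b1 \<and> \<not> E v b2) \<and> (E v c2 \<longrightarrow> \<not> E v d1 \<and> \<not> E v b1 \<and> \<not> E v b2)"

text \<open>The same condition in the complement, where the opposite sides are \<open>{b1, b2, c1, c2}\<close> and \<open>{a1, a2, d1, d2}\<close>.\<close>
definition major_on :: "('a \<Rightarrow> 'a \<Rightarrow> bool) \<Rightarrow> 'a \<Rightarrow> 'a \<Rightarrow> 'a \<Rightarrow> 'a \<Rightarrow> 'a \<Rightarrow> 'a \<Rightarrow> 'a \<Rightarrow> 'a \<Rightarrow> 'a \<Rightarrow> bool" where
  "major_on E v a1 a2 b1 b2 c1 c2 d1 d2 \<longleftrightarrow>
     (\<not> E v b1 \<longrightarrow> E v a1 \<and> E v d1 \<and> E v d2) \<and> (\<not> E v b2 \<longrightarrow> E v a2 \<and> E v d1 \<and> E v d2) \<and>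
     (\<not> E v c1 \<longrightarrow> E v d1 \<and> E v a1 \<and> E v a2) \<and> (\<not> E v c2 \<longrightarrow> E v d2 \<and> E v a1 \<and> E v a2)"

context maximal_config
begin

definition K where "K = A \<union> B \<union> C \<union> D"

lemma outside: "v \<notin> K \<Longrightarrow> x \<in> A \<union> B \<union> C \<union> D \<Longrightarrow> v \<noteq> x" "v \<notin> K \<Longrightarrow> v \<notin> A" "v \<notin> K \<Longrightarrow> v \<notin> B" "v \<notin> K \<Longrightarrow> v \<notin> C" "v \<notin> K \<Longrightarrow> v \<notin> D"
  unfolding K_def by blast+

lemma C5_rung:
  assumes "E v x" "E x y" "E y z" "E z w" "E v w" "\<not> E v y" "\<not> E x z" "\<not> E x w" "\<not> E y w"
  shows "E v z"
proof (rule ccontr)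
  assume "\<not> E v z"
  then show False
    using no_C5[OF g b, of v x y z w] assms sym[of v w] by blast
qed

text \<open>Each implication in \<open>P\<close> is \<open>C5_rung\<close> for an induced path on
  four vertices of the diamond; the rest is propositional. The four extra alternatives are the
  attachments of a vertex fit to be added to \<open>A\<close>, \<open>B\<close>, \<open>C\<close>
  and \<open>D\<close>, in this order.\<close>

lemma vertex_types:
  assumes s: "sq a1 a2 b1 b2" and q: "asq c1 c2 d1 d2"
  shows "minor_on E v a1 a2 b1 b2 c1 c2 d1 d2 \<or> major_on E v a1 a2 b1 b2 c1 c2 d1 d2 \<or>
    (E v c1 \<and> E v c2 \<and> \<not> E v d1 \<and> \<not> E v d2 \<and> (E v a2 \<and> E v b1 \<and> \<not> E v b2 \<or> E v a1 \<and> E v b2 \<and> \<not> E v b1)) \<or>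
    (E v d1 \<and> E v d2 \<and> \<not> E v c1 \<and> \<not> E v c2 \<and> (E v b2 \<and> E v a1 \<and> \<not> E v a2 \<or> E v b1 \<and> E v a2 \<and> \<not> E v a1)) \<or>
    (E v a1 \<and> E v a2 \<and> \<not> E v b1 \<and> \<not> E v b2 \<and> (\<not> E v c2 \<and> \<not> E v d2 \<and> E v d1 \<or> \<not> E v c1 \<and> \<not> E v d1 \<and> E v d2)) \<or>
    (E v b1 \<and> E v b2 \<and> \<not> E v a1 \<and> \<not> E v a2 \<and> (\<not> E v d1 \<and> \<not> E v c1 \<and> E v c2 \<or> \<not> E v d2 \<and> \<not> E v c2 \<and> E v c1))"
proof -
  note S = sqD[OF s] and Q = asqD[OF q]
  have e: "E a1 a2" "E a2 a1" "E b1 b2" "E b2 b1" "E a1 b1" "E b1 a1" "E a2 b2" "E b2 a2" "\<not> E a1 b2" "\<not> E b2 a1" "\<not> E a2 b1" "\<not> E b1 a2"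
    "\<not> E c1 c2" "\<not> E c2 c1" "\<not> E d1 d2" "\<not> E d2 d1" "E c1 d1" "E d1 c1" "E c2 d2" "E d2 c2" "\<not> E c1 d2" "\<not> E d2 c1" "\<not> E c2 d1" "\<not> E d1 c2"
    using S Q sym[of a1 a2] sym[of b1 b2] sym[of a1 b1] sym[of a2 b2] sym[of a1 b2] sym[of a2 b1]
      sym[of c1 c2] sym[of d1 d2] sym[of c1 d1] sym[of c2 d2] sym[of c1 d2] sym[of c2 d1] by simp_all
  have ac: "E a c" "E c a" if "a \<in> {a1, a2}" "c \<in> {c1, c2}" for a c using that S Q AC[of a c] by auto
  have bd: "E y d" "E d y" if "y \<in> {b1, b2}" "d \<in> {d1, d2}" for y d using that S Q BD[of y d] by auto
  have ad: "\<not> E a d" "\<not> E d a" if "a \<in> {a1, a2}" "d \<in> {d1, d2}" for a d using that S Q AD[of a d] by auto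
  have bc: "\<not> E y c" "\<not> E c y" if "y \<in> {b1, b2}" "c \<in> {c1, c2}" for y c using that S Q BC[of y c] by auto
  have R: "E v x \<and> E v w \<longrightarrow> E v y \<or> E v z" if "E x y" "E y z" "E z w" "\<not> E x z" "\<not> E x w" "\<not> E y w" for x y z w
    using C5_rung[OF _ that(1,2,3) _ _ that(4-6)] by blast
  have P:
    "E v a1 \<and> E v b2 \<longrightarrow> E v c1 \<or> E v d1" "E v a1 \<and> E v b2 \<longrightarrow> E v c2 \<or> E v d2"
    "E v a2 \<and> E v b1 \<longrightarrow> E v c1 \<or> E v d1" "E v a2 \<and> E v b1 \<longrightarrow> E v c2 \<or> E v d2"
    "E v a1 \<and> E v d1 \<longrightarrow> E v a2 \<or> E v b2" "E v a1 \<and> E v d2 \<longrightarrow> E v a2 \<or> E v b2"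
    "E v a2 \<and> E v d1 \<longrightarrow> E v a1 \<or> E v b1" "E v a2 \<and> E v d2 \<longrightarrow> E v a1 \<or> E v b1"
    "E v c1 \<and> E v b1 \<longrightarrow> E v a2 \<or> E v b2" "E v c1 \<and> E v b2 \<longrightarrow> E v a1 \<or> E v b1"
    "E v c2 \<and> E v b1 \<longrightarrow> E v a2 \<or> E v b2" "E v c2 \<and> E v b2 \<longrightarrow> E v a1 \<or> E v b1"
    "E v c1 \<and> E v d2 \<longrightarrow> E v a1 \<or> E v b1" "E v c1 \<and> E v d2 \<longrightarrow> E v a2 \<or> E v b2"
    "E v c2 \<and> E v d1 \<longrightarrow> E v a1 \<or> E v b1" "E v c2 \<and> E v d1 \<longrightarrow> E v a2 \<or> E v b2"
    "E v c1 \<and> E v d2 \<longrightarrow> E v a1 \<or> E v c2" "E v c1 \<and> E v d2 \<longrightarrow> E v a2 \<or> E v c2"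
    "E v c2 \<and> E v d1 \<longrightarrow> E v a1 \<or> E v c1" "E v c2 \<and> E v d1 \<longrightarrow> E v a2 \<or> E v c1"
    "E v d1 \<and> E v c2 \<longrightarrow> E v b1 \<or> E v d2" "E v d1 \<and> E v c2 \<longrightarrow> E v b2 \<or> E v d2"
    "E v d2 \<and> E v c1 \<longrightarrow> E v b1 \<or> E v d1" "E v d2 \<and> E v c1 \<longrightarrow> E v b2 \<or> E v d1"
    by (rule R; (simp add: e ac bd ad bc; fail))+
  show ?thesis
    unfolding minor_on_def major_on_def using P by argo
qed

text \<open>On this diamond \<open>v\<close> behaves like a vertex of \<open>A\<close> and forms a
  square with \<open>a2\<close>, \<open>b2\<close>, \<open>b1\<close>. With the square kept and the
  pair in \<open>(C, D)\<close> varied, \<open>vertex_types\<close> allows no change of behaviour.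
  So \<open>v\<close> is complete to \<open>C\<close> and anticomplete to \<open>D\<close> and could
  be inserted into \<open>A\<close>, against maximality.\<close>

lemma no_enlarge_A:
  assumes v: "v \<in> V" "v \<notin> K" and s: "sq a1 a2 b1 b2" and q: "asq c1 c2 d1 d2"
  shows "\<not> (E v c1 \<and> E v c2 \<and> \<not> E v d1 \<and> \<not> E v d2 \<and> E v a2 \<and> E v b1 \<and> \<not> E v b2)"
proof
  assume h: "E v c1 \<and> E v c2 \<and> \<not> E v d1 \<and> \<not> E v d2 \<and> E v a2 \<and> E v b1 \<and> \<not> E v b2"
  note S = sqD[OF s] and Q = asqD[OF q]
  have t: "E v d1' \<longleftrightarrow> E v d2'" "\<not> E v d1' \<Longrightarrow> E v c1' \<and> E v c2'" if "asq c1' c2' d1' d2'" for c1' c2' d1' d2'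
    using vertex_types[OF s that, of v] h unfolding minor_on_def major_on_def by argo+
  have vD: "\<not> E v d" if d: "d \<in> D" for d
  proof
    assume "E v d"
    then obtain c1' c2' d1' d2' where "asq c1' c2' d1' d2'" "E v d1'" "\<not> E v d2'"
      using D_cross[OF d, of "E v" d1] Q h by metis
    then show False using t(1) by blast
  qed
  have vC: "E v c" if c: "c \<in> C" for c
  proof -
    obtain c2' d1' d2' where q': "asq c c2' d1' d2'" using C_cover[OF c] by blast
    then show ?thesis using t(2)[OF q'] vD asqD[OF q'] by blast
  qed
  have "sqconn E (insert v A) B"
    by (rule sqconn_insert[OF g sqAB, of v a2 b1 b2]) (use S h in \<open>auto simp: squares_def square_def\<close>)
  then have "config V E (insert v A) B C D"
    unfolding config_def using parts sqCD AC BD AD BC v outside[OF v(2)] vC vD by auto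
  from maximal[OF this] have "card (insert v K) \<le> card K" by (simp add: K_def)
  moreover have "finite K" using parts graph_finite[OF g] unfolding K_def by (meson finite_Un finite_subset)
  ultimately show False using v(2) by simp
qed

lemma swap_asq: "maximal_config.asq V E D C d1 d2 c1 c2 \<longleftrightarrow> asq c1 c2 d1 d2"
proof -
  interpret s: maximal_config V E B A D C by (rule maximal_config_swap[OF maximal_config_axioms])
  show ?thesis unfolding s.asq_def asq_def
    using squares_flip[OF gc] squares_swap[OF gc] by metis
qed

lemma dual_asq: "maximal_config.asq V (compl V E) B A b1 b2 a2 a1 \<longleftrightarrow> sq a1 a2 b1 b2"
proof -
  interpret d: maximal_config V "compl V E" C D B A by (rule maximal_config_dual[OF maximal_config_axioms])
  show ?thesis unfolding d.asq_def compl_compl[OF g] using squares_flip[OF g] by metis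
qed

text \<open>\<open>no_enlarge_A\<close> is applied to the configuration, to its mirror image and to
  the complements of both, which rules out additions to \<open>A\<close>, \<open>B\<close>,
  \<open>C\<close> and \<open>D\<close>.\<close>

lemma minor_or_major:
  assumes v: "v \<in> V" "v \<notin> K" and s: "sq a1 a2 b1 b2" and q: "asq c1 c2 d1 d2"
  shows "minor_on E v a1 a2 b1 b2 c1 c2 d1 d2 \<or> major_on E v a1 a2 b1 b2 c1 c2 d1 d2"
proof -
  interpret s: maximal_config V E B A D C by (rule maximal_config_swap[OF maximal_config_axioms])
  interpret d: maximal_config V "compl V E" C D B A by (rule maximal_config_dual[OF maximal_config_axioms])
  interpret e: maximal_config V "compl V E" D C A B by (rule maximal_config_dual[OF maximal_config_swap[OF maximal_config_axioms]])
  have vK: "v \<notin> s.K" "v \<notin> d.K" "v \<notin> e.K" using v(2) unfolding K_def s.K_def d.K_def e.K_def by blast+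
  note S = sqD[OF s] and Q = asqD[OF q]
  have "a1 \<in> A" "a2 \<in> A" "b1 \<in> B" "b2 \<in> B" "c1 \<in> C" "c2 \<in> C" "d1 \<in> D" "d2 \<in> D" using S Q by blast+
  then have c: "compl V E v x \<longleftrightarrow> \<not> E v x" if "x \<in> {a1, a2, b1, b2, c1, c2, d1, d2}" for x
    using that v outside(1)[OF v(2), of x] parts(1-4) by (auto simp: compl_def)
  have c: "compl V E v a1 \<longleftrightarrow> \<not> E v a1" "compl V E v a2 \<longleftrightarrow> \<not> E v a2" "compl V E v b1 \<longleftrightarrow> \<not> E v b1" "compl V E v b2 \<longleftrightarrow> \<not> E v b2"
    "compl V E v c1 \<longleftrightarrow> \<not> E v c1" "compl V E v c2 \<longleftrightarrow> \<not> E v c2" "compl V E v d1 \<longleftrightarrow> \<not> E v d1" "compl V E v d2 \<longleftrightarrow> \<not> E v d2"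
    by (rule c; simp)+
  have sf: "squares E B A b1 b2 a1 a2" "squares E B A b2 b1 a2 a1"
    using squares_flip[OF g s] squares_flip[OF g sq_swap[OF s]] by blast+
  have sa: "s.asq d1 d2 c1 c2" using q swap_asq by blast
  have dq: "squares (compl V E) C D c1 c2 d2 d1" "squares (compl V E) C D c2 c1 d1 d2"
    using q asq_swap[OF q] by (simp_all add: asq_def)
  have da: "d.asq b1 b2 a2 a1" using s dual_asq by blast
  have eq: "squares (compl V E) D C d2 d1 c1 c2" "squares (compl V E) D C d1 d2 c2 c1"
    using squares_flip[OF gc dq(1)] squares_flip[OF gc dq(2)] by blast+
  have ea: "e.asq a1 a2 b2 b1" unfolding e.asq_def compl_compl[OF g] using s by blast
  have n1: "\<not> (E v c1 \<and> E v c2 \<and> \<not> E v d1 \<and> \<not> E v d2 \<and> (E v a2 \<and> E v b1 \<and> \<not> E v b2 \<or> E v a1 \<and> E v b2 \<and> \<not> E v b1))"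
    using no_enlarge_A[OF v s q] no_enlarge_A[OF v sq_swap[OF s] q] by blast
  have n2: "\<not> (E v d1 \<and> E v d2 \<and> \<not> E v c1 \<and> \<not> E v c2 \<and> (E v b2 \<and> E v a1 \<and> \<not> E v a2 \<or> E v b1 \<and> E v a2 \<and> \<not> E v a1))"
    using s.no_enlarge_A[OF v(1) vK(1) sf(1) sa] s.no_enlarge_A[OF v(1) vK(1) sf(2) sa] by blast
  have n3: "\<not> (E v a1 \<and> E v a2 \<and> \<not> E v b1 \<and> \<not> E v b2 \<and> (\<not> E v c2 \<and> \<not> E v d2 \<and> E v d1 \<or> \<not> E v c1 \<and> \<not> E v d1 \<and> E v d2))"
    using d.no_enlarge_A[OF v(1) vK(2) dq(1) da] d.no_enlarge_A[OF v(1) vK(2) dq(2) da] unfolding c by blast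
  have n4: "\<not> (E v b1 \<and> E v b2 \<and> \<not> E v a1 \<and> \<not> E v a2 \<and> (\<not> E v d1 \<and> \<not> E v c1 \<and> E v c2 \<or> \<not> E v d2 \<and> \<not> E v c2 \<and> E v c1))"
    using e.no_enlarge_A[OF v(1) vK(3) eq(1) ea] e.no_enlarge_A[OF v(1) vK(3) eq(2) ea] unfolding c by blast
  show ?thesis using vertex_types[OF s q, of v] n1 n2 n3 n4 by argo
qed

definition minor where "minor v \<longleftrightarrow> (\<forall>x\<in>L. \<forall>y\<in>R. E v x \<and> E v y \<longrightarrow> E x y)"

text \<open>A pair from \<open>A\<close> and \<open>D\<close>, or from \<open>C\<close> and
  \<open>B\<close>, always lies in a common diamond. A non-adjacent pair from \<open>A\<close> and
  \<open>B\<close> need not, but if \<open>v\<close> saw both, it would form a 5-hole with them and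
  an edge \<open>c1 d1\<close>; for \<open>C\<close> and \<open>D\<close> an edge
  \<open>a1 b1\<close> serves.\<close>

lemma minor_if_all_minor:
  assumes v: "v \<in> V" "v \<notin> K"
    and all: "\<And>a1 a2 b1 b2 c1 c2 d1 d2. sq a1 a2 b1 b2 \<Longrightarrow> asq c1 c2 d1 d2 \<Longrightarrow> minor_on E v a1 a2 b1 b2 c1 c2 d1 d2"
  shows "minor v"
proof -
  have ad: False if h: "a \<in> A" "d \<in> D" "E v a" "E v d" for a d
  proof -
    obtain a2 b1 b2 where s: "sq a a2 b1 b2" using A_cover[OF h(1)] by blast
    obtain c1 c2 d2 where q: "asq c1 c2 d d2" using D_cover[OF h(2)] by blast
    show False using all[OF s q] that unfolding minor_on_def by blast
  qed
  have cb: False if h: "c \<in> C" "y \<in> B" "E v c" "E v y" for c y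
  proof -
    obtain a1 a2 b2 where s: "sq a1 a2 y b2" using B_cover[OF h(2)] by blast
    obtain c2 d1 d2 where q: "asq c c2 d1 d2" using C_cover[OF h(1)] by blast
    show False using all[OF s q] that unfolding minor_on_def by blast
  qed
  have ab: "E a y" if "a \<in> A" "y \<in> B" "E v a" "E v y" for a y
  proof (rule ccontr)
    assume n: "\<not> E a y"
    obtain c1 c2 d1 d2 where q: "asq c1 c2 d1 d2" using asq_ex by blast
    have m: "c1 \<in> C" "d1 \<in> D" "E c1 d1" using asqD[OF q] by blast+
    have vn: "\<not> E v c1" "\<not> E v d1" using cb[OF m(1) that(2) _ that(4)] ad[OF that(1) m(2) that(3)] by blast+
    show False
      using no_C5[OF g b that(3) AC(1)[OF that(1) m(1)] m(3) BD(2)[OF that(2) m(2)] _ vn AD(1)[OF that(1) m(2)] n BC(2)[OF that(2) m(1)]]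
        that(4) sym[of v y] by blast
  qed
  have cd: "E c d" if "c \<in> C" "d \<in> D" "E v c" "E v d" for c d
  proof (rule ccontr)
    assume n: "\<not> E c d"
    obtain a1 a2 b1 b2 where s: "sq a1 a2 b1 b2" using sq_ex by blast
    have m: "a1 \<in> A" "b1 \<in> B" "E a1 b1" using sqD[OF s] by blast+
    have vn: "\<not> E v a1" "\<not> E v b1" using ad[OF m(1) that(2) _ that(4)] cb[OF that(1) m(2) that(3)] by blast+
    show False
      using no_C5[OF g b that(3) AC(2)[OF m(1) that(1)] m(3) BD(1)[OF m(2) that(2)] _ vn BC(2)[OF m(2) that(1)] n AD(1)[OF m(1) that(2)]]
        that(4) sym[of v d] by blast
  qed
  show ?thesis unfolding minor_def using ad cb ab cd by blast
qed

text \<open>The square is exchanged first, then the pair in \<open>(C, D)\<close>. A change of type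
  would make an adjacency of \<open>v\<close> change within one of the four sets, hence along a
  single square, and on that diamond \<open>v\<close> would be of neither type.\<close>

lemma same_type:
  assumes v: "v \<in> V" "v \<notin> K" and s: "sq a1 a2 b1 b2" "sq a1' a2' b1' b2'" and q: "asq c1 c2 d1 d2" "asq c1' c2' d1' d2'"
    and m: "minor_on E v a1 a2 b1 b2 c1 c2 d1 d2"
  shows "minor_on E v a1' a2' b1' b2' c1' c2' d1' d2'"
proof -
  have step1: "minor_on E v a1' a2' b1' b2' c1 c2 d1 d2" if s: "sq a1 a2 b1 b2" "sq a1' a2' b1' b2'" and q: "asq c1 c2 d1 d2"
    and m: "minor_on E v a1 a2 b1 b2 c1 c2 d1 d2" for a1 a2 b1 b2 a1' a2' b1' b2' c1 c2 d1 d2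
  proof (rule ccontr)
    assume n: "\<not> minor_on E v a1' a2' b1' b2' c1 c2 d1 d2"
    note M = m[unfolded minor_on_def] and M' = minor_or_major[OF v s(2) q, unfolded major_on_def]
    note S = sqD[OF s(1)] and S' = sqD[OF s(2)]
    have "E v c1 \<and> E v c2 \<and> \<not> E v d1 \<and> \<not> E v d2 \<and> \<not> E v b1 \<and> E v b1' \<or> E v d1 \<and> E v d2 \<and> \<not> E v c1 \<and> \<not> E v c2 \<and> \<not> E v a1 \<and> E v a1'"
      using M M' n by argo
    then show False
    proof
      assume h: "E v c1 \<and> E v c2 \<and> \<not> E v d1 \<and> \<not> E v d2 \<and> \<not> E v b1 \<and> E v b1'"
      obtain x1 x2 y1 y2 where t: "sq x1 x2 y1 y2" "E v y1" "\<not> E v y2" using B_cross[of b1' "E v" b1] S S' h by metis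
      show False using minor_or_major[OF v t(1) q] t h unfolding minor_on_def major_on_def by argo
    next
      assume h: "E v d1 \<and> E v d2 \<and> \<not> E v c1 \<and> \<not> E v c2 \<and> \<not> E v a1 \<and> E v a1'"
      obtain x1 x2 y1 y2 where t: "sq x1 x2 y1 y2" "E v x1" "\<not> E v x2" using A_cross[of a1' "E v" a1] S S' h by metis
      show False using minor_or_major[OF v t(1) q] t h unfolding minor_on_def major_on_def by argo
    qed
  qed
  have m1: "minor_on E v a1' a2' b1' b2' c1 c2 d1 d2" by (rule step1[OF s q(1) m])
  show ?thesis
  proof (rule ccontr)
    assume n: "\<not> minor_on E v a1' a2' b1' b2' c1' c2' d1' d2'"
    note M = m1[unfolded minor_on_def] and M' = minor_or_major[OF v s(2) q(2), unfolded major_on_def]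
    note Q = asqD[OF q(1)] and Q' = asqD[OF q(2)]
    have "E v a1' \<and> E v a2' \<and> \<not> E v b1' \<and> \<not> E v b2' \<and> \<not> E v d1 \<and> E v d1' \<or> E v b1' \<and> E v b2' \<and> \<not> E v a1' \<and> \<not> E v a2' \<and> \<not> E v c1 \<and> E v c1'"
      using M M' n by argo
    then show False
    proof
      assume h: "E v a1' \<and> E v a2' \<and> \<not> E v b1' \<and> \<not> E v b2' \<and> \<not> E v d1 \<and> E v d1'"
      obtain x1 x2 y1 y2 where t: "asq x1 x2 y1 y2" "E v y1" "\<not> E v y2" using D_cross[of d1' "E v" d1] Q Q' h by metis
      show False using minor_or_major[OF v s(2) t(1)] t h unfolding minor_on_def major_on_def by argo
    next
      assume h: "E v b1' \<and> E v b2' \<and> \<not> E v a1' \<and> \<not> E v a2' \<and> \<not> E v c1 \<and> E v c1'"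
      obtain x1 x2 y1 y2 where t: "asq x1 x2 y1 y2" "E v x1" "\<not> E v x2" using C_cross[of c1' "E v" c1] Q Q' h by metis
      show False using minor_or_major[OF v s(2) t(1)] t h unfolding minor_on_def major_on_def by argo
    qed
  qed
qed

text \<open>One diamond on which \<open>v\<close> is not minor makes it major on all diamonds by
  \<open>same_type\<close>, and major is minor in the complement.\<close>

lemma minor_or_dual_minor:
  assumes v: "v \<in> V" "v \<notin> K"
  shows "minor v \<or> maximal_config.minor (compl V E) C D B A v"
proof (cases "minor v")
  case False
  interpret d: maximal_config V "compl V E" C D B A by (rule maximal_config_dual[OF maximal_config_axioms])
  have vd: "v \<notin> d.K" using v(2) unfolding K_def d.K_def by blast
  obtain a1 a2 b1 b2 c1 c2 d1 d2 where nm: "sq a1 a2 b1 b2" "asq c1 c2 d1 d2" "\<not> minor_on E v a1 a2 b1 b2 c1 c2 d1 d2"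
    using minor_if_all_minor[OF v] False by blast
  have "d.minor v"
  proof (rule d.minor_if_all_minor[OF v(1) vd])
    fix c1' c2' d2' d1' b1' b2' a2' a1'
    assume "squares (compl V E) C D c1' c2' d2' d1'" "d.asq b1' b2' a2' a1'"
    then have q: "asq c1' c2' d1' d2'" and s: "sq a1' a2' b1' b2'" using dual_asq by (simp_all add: asq_def)
    have "\<not> minor_on E v a1' a2' b1' b2' c1' c2' d1' d2'" using same_type[OF v s nm(1) q nm(2)] nm(3) by blast
    then have mj: "major_on E v a1' a2' b1' b2' c1' c2' d1' d2'" using minor_or_major[OF v s q] by blast
    have c: "compl V E v x \<Longrightarrow> \<not> E v x" for x by (simp add: compl_def)
    show "minor_on (compl V E) v c1' c2' d2' d1' b1' b2' a2' a1'"
      using mj c unfolding minor_on_def major_on_def by meson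
  qed
  then show ?thesis ..
qed simp

end

text \<open>The outcome of \<open>ddiamond_connected\<close> in terms of squares. In the last line
  the first alternative is a candidate rung for \<open>(C, D)\<close>, the second one for
  \<open>(A, B)\<close>.\<close>

definition pair_on :: "('a \<Rightarrow> 'a \<Rightarrow> bool) \<Rightarrow> 'a \<Rightarrow> 'a \<Rightarrow> 'a \<Rightarrow> 'a \<Rightarrow> 'a \<Rightarrow> 'a \<Rightarrow> 'a \<Rightarrow> 'a \<Rightarrow> 'a \<Rightarrow> 'a \<Rightarrow> bool" where
  "pair_on E v w a1 a2 b1 b2 c1 c2 d1 d2 \<longleftrightarrow> E v w \<and>
     \<not> E v b1 \<and> \<not> E v b2 \<and> \<not> E v d1 \<and> \<not> E v d2 \<and> \<not> E w a1 \<and> \<not> E w a2 \<and> \<not> E w c1 \<and> \<not> E w c2 \<and>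
     (E v a1 \<longleftrightarrow> E w b1) \<and> (E v a2 \<longleftrightarrow> E w b2) \<and> (E v c1 \<longleftrightarrow> E w d1) \<and> (E v c2 \<longleftrightarrow> E w d2) \<and>
     (E v a1 \<and> E v a2 \<and> \<not> E v c1 \<and> \<not> E v c2 \<or> E v c1 \<and> E v c2 \<and> (E v a1 \<or> E v a2))"

lemma all_less_4: "(\<forall>i<4. P i) \<longleftrightarrow> P 0 \<and> P 1 \<and> P 2 \<and> P (3::nat)"
proof
  assume "P 0 \<and> P 1 \<and> P 2 \<and> P (3::nat)"
  moreover have "i = 0 \<or> i = 1 \<or> i = 2 \<or> i = 3" if "i < 4" for i :: nat using that by auto
  ultimately show "\<forall>i<4. P i" by metis
qed simp

section \<open>Connected sets of minor vertices\<close>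

context maximal_config
begin

lemma ddiamond_squares:
  assumes s: "sq a1 a2 b1 b2" and q: "asq c1 c2 d1 d2"
  shows "ddiamond V E (\<lambda>i. [a1, a2, c1, c2] ! i) (\<lambda>i. [b1, b2, d1, d2] ! i)"
proof -
  note S = sqD[OF s] and Q = asqD[OF q]
  have e: "E a1 a2" "E a2 a1" "E b1 b2" "E b2 b1" "E a1 b1" "E a2 b2" "\<not> E a1 b2" "\<not> E a2 b1"
    "\<not> E c1 c2" "\<not> E c2 c1" "\<not> E d1 d2" "\<not> E d2 d1" "E c1 d1" "E c2 d2" "\<not> E c1 d2" "\<not> E c2 d1"
    using S Q sym[of a1 a2] sym[of b1 b2] sym[of c1 c2] sym[of d1 d2] by simp_all
  have m: "a1 \<in> A" "a2 \<in> A" "b1 \<in> B" "b2 \<in> B" "c1 \<in> C" "c2 \<in> C" "d1 \<in> D" "d2 \<in> D" using S Q by blast+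
  have V: "a1 \<in> V" "a2 \<in> V" "b1 \<in> V" "b2 \<in> V" "c1 \<in> V" "c2 \<in> V" "d1 \<in> V" "d2 \<in> V" using m parts(1-4) by blast+
  have ne: "x \<noteq> y" "y \<noteq> x" if "x \<in> X" "y \<in> Y" "X \<inter> Y = {}" for x y :: 'a and X Y using that by auto
  have n: "a1 \<noteq> a2" "a2 \<noteq> a1" "b1 \<noteq> b2" "b2 \<noteq> b1" "c1 \<noteq> c2" "c2 \<noteq> c1" "d1 \<noteq> d2" "d2 \<noteq> d1" using S Q by auto
  note n2 = ne[OF m(1) m(3) parts(5)] ne[OF m(1) m(4) parts(5)] ne[OF m(2) m(3) parts(5)] ne[OF m(2) m(4) parts(5)]
    ne[OF m(1) m(5) parts(6)] ne[OF m(1) m(6) parts(6)] ne[OF m(2) m(5) parts(6)] ne[OF m(2) m(6) parts(6)]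
    ne[OF m(1) m(7) parts(7)] ne[OF m(1) m(8) parts(7)] ne[OF m(2) m(7) parts(7)] ne[OF m(2) m(8) parts(7)]
    ne[OF m(3) m(5) parts(8)] ne[OF m(3) m(6) parts(8)] ne[OF m(4) m(5) parts(8)] ne[OF m(4) m(6) parts(8)]
    ne[OF m(3) m(7) parts(9)] ne[OF m(3) m(8) parts(9)] ne[OF m(4) m(7) parts(9)] ne[OF m(4) m(8) parts(9)]
    ne[OF m(5) m(7) parts(10)] ne[OF m(5) m(8) parts(10)] ne[OF m(6) m(7) parts(10)] ne[OF m(6) m(8) parts(10)]
  show ?thesis
    unfolding ddiamond_def all_less_4
    by (simp add: e V n n2 m AC BD AD BC graph_irrefl[OF g] adj4_def)
qed

text \<open>Minority is required only on this one diamond, and \<open>F\<close> has to avoid only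
  its eight vertices. So \<open>F\<close> may contain another vertex of \<open>K\<close>, which is
  exploited when a vertex of \<open>B\<close> or \<open>D\<close> is adjoined to it.\<close>

lemma bad_pair:
  assumes s: "sq a1 a2 b1 b2" and q: "asq c1 c2 d1 d2" and F: "F \<subseteq> V" "conn F E"
    and dis: "F \<inter> {a1, a2, b1, b2, c1, c2, d1, d2} = {}" and minor: "\<And>z. z \<in> F \<Longrightarrow> minor_on E z a1 a2 b1 b2 c1 c2 d1 d2"
    and bad: "x \<in> F" "y \<in> F" "l \<in> {a1, a2, c1, c2}" "r \<in> {b1, b2, d1, d2}" "\<not> E l r" "E x l" "E y r"
  shows "\<exists>v\<in>F. \<exists>w\<in>F. pair_on E v w a1 a2 b1 b2 c1 c2 d1 d2"
proof -
  let ?l = "\<lambda>i. [a1, a2, c1, c2] ! i" and ?r = "\<lambda>i. [b1, b2, d1, d2] ! i"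
  note S = sqD[OF s] and Q = asqD[OF q]
  have i4: "i = 0 \<or> i = 1 \<or> i = 2 \<or> i = 3" if "i < 4" for i :: nat using that by auto
  have "\<exists>i<4. l = ?l i" "\<exists>j<4. r = ?r j"
    using bad(3,4) by (auto intro: exI[of _ 0] exI[of _ 1] exI[of _ 2] exI[of _ 3])
  then obtain i j where ij: "i < 4" "l = ?l i" "j < 4" "r = ?r j" by blast
  have "E (?l i) (?r i)" using i4[OF ij(1)] S Q by (elim disjE) simp_all
  then have neq: "i \<noteq> j" using ij bad(5) by auto
  have "\<exists>v\<in>F. \<exists>w\<in>F. \<exists>I. E v w \<and> (I 0 \<and> I 1 \<and> \<not> I 2 \<and> \<not> I 3 \<or> I 2 \<and> I 3 \<and> (I 0 \<or> I (1::nat))) \<and>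
    (\<forall>m<4. (E v (?l m) \<longleftrightarrow> I m) \<and> (E w (?r m) \<longleftrightarrow> I m) \<and> \<not> E w (?l m) \<and> \<not> E v (?r m))"
  proof (rule ddiamond_connected[OF g F5 ddiamond_squares[OF s q] F _ _ bad(1,2) ij(1,3) neq])
    show "z \<noteq> ?l m \<and> z \<noteq> ?r m" if "z \<in> F" "m < 4" for z m
      using i4[OF that(2)] that(1) dis by (elim disjE) auto
    show "\<not> (E z (?l i) \<and> E z (?r j))" if "z \<in> F" "i < 4" "j < 4" "i \<noteq> j" for z i j
      using i4[OF that(2)] i4[OF that(3)] that(4) minor[OF that(1)] unfolding minor_on_def
      by (elim disjE) simp_all
    show "E x (?l i)" "E y (?r j)" using ij bad by simp_all
  qed
  then obtain v w I where vw: "v \<in> F" "w \<in> F" "E v w" "I 0 \<and> I 1 \<and> \<not> I 2 \<and> \<not> I 3 \<or> I 2 \<and> I 3 \<and> (I 0 \<or> I (1::nat))"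
    and I: "\<forall>m<4. (E v (?l m) \<longleftrightarrow> I m) \<and> (E w (?r m) \<longleftrightarrow> I m) \<and> \<not> E w (?l m) \<and> \<not> E v (?r m)" by metis
  have "pair_on E v w a1 a2 b1 b2 c1 c2 d1 d2"
    using I[unfolded all_less_4] vw(3,4) unfolding pair_on_def by simp
  then show ?thesis using vw by blast
qed

lemma minor_on_if_minor:
  assumes "minor v" and s: "sq a1 a2 b1 b2" and q: "asq c1 c2 d1 d2"
  shows "minor_on E v a1 a2 b1 b2 c1 c2 d1 d2"
proof -
  note S = sqD[OF s] and Q = asqD[OF q]
  have h: "\<not> (E v x \<and> E v y)" if "x \<in> {a1, a2, c1, c2}" "y \<in> {b1, b2, d1, d2}" "\<not> E x y" for x y
    using assms(1) that S Q unfolding minor_def by blast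
  have "\<not> E v a1 \<or> \<not> E v b2" "\<not> E v a2 \<or> \<not> E v b1" "\<not> E v c1 \<or> \<not> E v d2" "\<not> E v c2 \<or> \<not> E v d1"
    using h[of a1 b2] h[of a2 b1] h[of c1 d2] h[of c2 d1] S Q by simp_all
  moreover have "\<not> E a1 d1" "\<not> E a1 d2" "\<not> E a2 d1" "\<not> E a2 d2" "\<not> E c1 b1" "\<not> E c1 b2" "\<not> E c2 b1" "\<not> E c2 b2"
    using S Q AD(1) BC(2) by blast+
  then have "\<not> E v a1 \<or> \<not> E v d1" "\<not> E v a1 \<or> \<not> E v d2" "\<not> E v a2 \<or> \<not> E v d1" "\<not> E v a2 \<or> \<not> E v d2"
    "\<not> E v c1 \<or> \<not> E v b1" "\<not> E v c1 \<or> \<not> E v b2" "\<not> E v c2 \<or> \<not> E v b1" "\<not> E v c2 \<or> \<not> E v b2"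
    using h[of a1 d1] h[of a1 d2] h[of a2 d1] h[of a2 d2] h[of c1 b1] h[of c1 b2] h[of c2 b1] h[of c2 b2] by simp_all
  ultimately show ?thesis unfolding minor_on_def by blast
qed

lemma outside_set: "F \<inter> K = {} \<Longrightarrow> sq a1 a2 b1 b2 \<Longrightarrow> asq c1 c2 d1 d2 \<Longrightarrow> F \<inter> {a1, a2, b1, b2, c1, c2, d1, d2} = {}"
  using sqD[of a1 a2 b1 b2] asqD[of c1 c2 d1 d2] unfolding K_def by blast

lemma finite_K: "finite K"
  using parts(1-4) graph_finite[OF g] unfolding K_def by (meson finite_Un finite_subset)

text \<open>Carries a pair over to any diamond on which the edge \<open>v w\<close> violates. The
  orientation is kept because \<open>v\<close> is the one that sees a left vertex.\<close>

lemma pair_closed: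
  assumes v: "v \<in> V" "v \<notin> K" "minor v" and w: "w \<in> V" "w \<notin> K" "minor w" and vw: "E v w"
    and s: "sq a1 a2 b1 b2" and q: "asq c1 c2 d1 d2"
    and bad: "l \<in> {a1, a2, c1, c2}" "r \<in> {b1, b2, d1, d2}" "\<not> E l r" "E v l" "E w r"
  shows "pair_on E v w a1 a2 b1 b2 c1 c2 d1 d2"
proof -
  have c: "conn {v, w} E" using conn_insert[OF g conn_singleton[of w E], of w v] vw sym[of v w] by simp
  have "{v, w} \<inter> K = {}" "{v, w} \<subseteq> V" using v w by auto
  moreover have "minor_on E z a1 a2 b1 b2 c1 c2 d1 d2" if "z \<in> {v, w}" for z
    using that minor_on_if_minor[OF _ s q] v w by blast
  ultimately obtain x y where xy: "x \<in> {v, w}" "y \<in> {v, w}" "pair_on E x y a1 a2 b1 b2 c1 c2 d1 d2"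
    using bad_pair[OF s q _ c outside_set[OF _ s q] _ _ _ bad(1,2,3,4,5)] by blast
  have "x \<noteq> y" using xy(3) graph_irrefl[OF g] unfolding pair_on_def by blast
  moreover have "\<not> E y l" using xy(3) bad(1) unfolding pair_on_def by blast
  ultimately show ?thesis using xy bad(4) by auto
qed

text \<open>The square is kept fixed, and \<open>c1'\<close> with the neighbour \<open>y\<close> of
  \<open>w\<close> in \<open>B\<close> is a violation on every further diamond reached. So the pair
  persists on all of \<open>C\<close> and \<open>D\<close>, and \<open>v\<close>, \<open>w\<close>
  could be inserted into \<open>A\<close>, \<open>B\<close>.\<close>

lemma no_pair_C:
  assumes v: "v \<in> V" "v \<notin> K" "minor v" and w: "w \<in> V" "w \<notin> K" "minor w"
    and s: "sq a1 a2 b1 b2" and q: "asq c1 c2 d1 d2" and P: "pair_on E v w a1 a2 b1 b2 c1 c2 d1 d2" and vc: "E v c1"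
  shows False
proof -
  note S = sqD[OF s] and Q = asqD[OF q]
  have vw: "E v w" using P unfolding pair_on_def by blast
  have "E v a1 \<and> E w b1 \<and> \<not> E v b1 \<and> \<not> E w a1 \<or> E v a2 \<and> E w b2 \<and> \<not> E v b2 \<and> \<not> E w a2"
    using P vc unfolding pair_on_def by argo
  then obtain a y where ay: "a \<in> A" "y \<in> B" "y \<in> {b1, b2}" "E a y" "E v a" "E w y" "\<not> E v y" "\<not> E w a"
    using S by blast
  have cl: "pair_on E v w a1 a2 b1 b2 c1' c2' d1' d2'" if q': "asq c1' c2' d1' d2'" and "E v c1'" for c1' c2' d1' d2'
  proof (rule pair_closed[OF v w vw s q'])
    show "\<not> E c1' y" using asqD[OF q'] ay(2) BC(2) by blast
  qed (use ay that in auto)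
  have vC: "E v c" if c: "c \<in> C" for c
  proof (rule ccontr)
    assume "\<not> E v c"
    then obtain c1' c2' d1' d2' where q': "asq c1' c2' d1' d2'" "E v c1'" "\<not> E v c2'"
      using C_cross[of c1 "E v" c] vc c Q by metis
    then show False using cl[OF q'(1,2)] unfolding pair_on_def by blast
  qed
  have wC: "\<not> E w c" if c: "c \<in> C" for c
  proof -
    obtain c2' d1' d2' where q': "asq c c2' d1' d2'" using C_cover[OF c] by blast
    show ?thesis using cl[OF q' vC[OF c]] unfolding pair_on_def by blast
  qed
  have D': "E w d" "\<not> E v d" if d: "d \<in> D" for d
  proof -
    obtain c1' c2' d2' where q': "asq c1' c2' d d2'" using D_cover[OF d] by blast
    have "E v c1'" using vC asqD[OF q'] by blast
    then show "E w d" "\<not> E v d" using cl[OF q'] unfolding pair_on_def by blast+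
  qed
  have "sqconn E (insert v A) (insert w B)"
  proof (rule sqconn_insert2[OF g sqAB ay(1,2)])
    have "\<not> E a w" using ay(8) sym[of a w] by simp
    then show "square E v a w y \<or> square E v a y w" using ay vw unfolding square_def by blast
  qed
  moreover have "v \<noteq> w" using vw graph_irrefl[OF g] by blast
  ultimately have "config V E (insert v A) (insert w B) C D"
    unfolding config_def using parts sqCD AC BD AD BC v w outside[OF v(2)] outside[OF w(2)] vC wC D' by auto
  from maximal[OF this] have "card (insert w (insert v K)) \<le> card K" by (simp add: K_def insert_commute)
  then show False using v w finite_K \<open>v \<noteq> w\<close> by simp
qed

text \<open>By \<open>no_pair_C\<close> neither vertex sees \<open>C\<close> or \<open>D\<close>, so
  the pair is a candidate for insertion into \<open>(C, D)\<close>. What remains is that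
  \<open>v\<close> is complete to \<open>A\<close> and \<open>w\<close> to \<open>B\<close>, with no
  cross edges; this is carried along squares.\<close>

lemma no_pair:
  assumes v: "v \<in> V" "v \<notin> K" "minor v" and w: "w \<in> V" "w \<notin> K" "minor w"
    and s: "sq a1 a2 b1 b2" and q: "asq c1 c2 d1 d2" and P: "pair_on E v w a1 a2 b1 b2 c1 c2 d1 d2"
  shows False
proof -
  note S = sqD[OF s] and Q = asqD[OF q]
  have vc: "\<not> E v c1" using no_pair_C[OF v w s q P] by blast
  then have h: "E v w" "E v a1" "E v a2" "E w b1" "E w b2" using P unfolding pair_on_def by auto
  have vw: "E v w" "E w v" "v \<noteq> w" using h sym[of v w] graph_irrefl[OF g] by auto
  have CD: "\<not> E v c1' \<and> \<not> E w c1' \<and> \<not> E v d1' \<and> \<not> E w d1'" if q': "asq c1' c2' d1' d2'" for c1' c2' d1' d2'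
  proof -
    have p: "pair_on E v w a1 a2 b1 b2 c1' c2' d1' d2'"
      by (rule pair_closed[OF v w vw(1) s q', of a1 b2]) (use S h in auto)
    then have "\<not> E v c1'" using no_pair_C[OF v w s q'] by blast
    then show ?thesis using p unfolding pair_on_def by blast
  qed
  have noC: "\<not> E v c" "\<not> E w c" if c: "c \<in> C" for c using C_cover[OF c] CD by metis+
  have noD: "\<not> E v d" "\<not> E w d" if d: "d \<in> D" for d using D_cover[OF d] CD by metis+
  \<comment> \<open>The invariant carried along squares: besides \<open>E v a\<close> it remembers a
    neighbour of \<open>w\<close> in \<open>B\<close> that misses \<open>a\<close>, because
    \<open>pair_closed\<close> needs such a violation in the next square.\<close>
  define P where "P a \<longleftrightarrow> E v a \<and> (\<exists>y\<in>B. E w y \<and> \<not> E a y)" for a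
  have key: "\<not> E w a \<and> \<not> E v y1 \<and> E w y1 \<and> P a'" if s': "sq a a' y1 y2" and Pa: "P a" for a a' y1 y2
  proof -
    note S' = sqD[OF s']
    obtain y where y: "y \<in> B" "E w y" "\<not> E a y" "E v a" using Pa unfolding P_def by blast
    have conc: "\<not> E w a \<and> \<not> E v y1 \<and> E w y1 \<and> P a'" if "pair_on E v w a a' y1 y' c1 c2 d1 d2" for y'
    proof -
      have "E v a'" "E w y1" "\<not> E w a" "\<not> E v y1"
        using that noC[of c1] Q y(4) unfolding pair_on_def by auto
      then show ?thesis using S' unfolding P_def by blast
    qed
    have y1: "y \<noteq> y1" using y S' by auto
    show ?thesis
    proof (cases "y = y2")
      case True
      show ?thesis
        by (rule conc, rule pair_closed[OF v w vw(1) s' q, of a y2]) (use True y S' in auto)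
    next
      \<comment> \<open>Here \<open>y\<close> is not in the given square. If \<open>a'\<close> sees
        \<open>y\<close>, then \<open>y\<close> can replace \<open>y2\<close>. Otherwise
        \<open>y\<close> is minor on this diamond and is adjoined to \<open>{v, w}\<close>, with
        \<open>a\<close> and \<open>d1\<close> as the violated pair; as \<open>y\<close> misses
        \<open>a\<close> and sees \<open>d1\<close>, the pair found is still \<open>v\<close>,
        \<open>w\<close>.\<close>
      case F: False
      show ?thesis
      proof (cases "E a' y")
        case True
        have d: "d1 \<in> D" "E y d1" "E y1 d1" using Q BD y(1) S' by auto
        have "E y y1"
        proof (rule ccontr)
          assume n: "\<not> E y y1"
          have "\<not> E y a" "E y a'" "E a' a" "E d1 y" "\<not> E a' d1" "\<not> E a d1"
            using y(3) True S' sym[of y a] sym[of y a'] sym[of a a'] sym[of y d1] d AD by auto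
          then show False using no_C5[OF g b, of y a' a y1 d1] S' d(3) n by blast
        qed
        then have "sq a a' y1 y" using S' y True sym[of y y1] unfolding squares_def square_def by blast
        then show ?thesis
          by (intro conc, intro pair_closed[OF v w vw(1) _ q, of _ _ _ _ a y]) (use y in auto)
      next
        case False
        let ?F = "insert y {v, w}"
        have cv: "conn {v, w} E" using conn_insert[OF g conn_singleton[of w E], of w v] vw by simp
        have c: "conn ?F E" using conn_insert[OF g cv, of w y] y by simp
        have yn: "\<not> E y a" "\<not> E y a'" using y False sym[of y a] sym[of y a'] by simp_all
        have yc: "\<not> E y c1" "\<not> E y c2" "E y d1" using BC BD y(1) Q by blast+
        have yo: "y \<notin> {a, a', y1, y2, c1, c2, d1, d2}" using y1 F y(1) parts(5,8,9) S' Q by blast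
        have "{v, w} \<inter> K = {}" using v w by blast
        from outside_set[OF this s' q] have dis: "?F \<inter> {a, a', y1, y2, c1, c2, d1, d2} = {}" using yo by blast
        have mn: "minor_on E z a a' y1 y2 c1 c2 d1 d2" if "z \<in> ?F" for z
          using that minor_on_if_minor[OF _ s' q] v w yn yc unfolding minor_on_def by blast
        have sub: "?F \<subseteq> V" using v w y parts(2) by blast
        have na: "\<not> E a d1" using S' Q AD by blast
        obtain p p' where pp: "p \<in> ?F" "p' \<in> ?F" "pair_on E p p' a a' y1 y2 c1 c2 d1 d2"
          using bad_pair[OF s' q sub c dis mn, of v y a d1] na y(4) yc by blast
        have nc: "\<not> E p c1" using pp(1) noC Q yc by blast
        have "E p a" "\<not> E p' a" "\<not> E p' d1" using pp(3) nc unfolding pair_on_def by auto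
        moreover have "E p p'" using pp(3) unfolding pair_on_def by blast
        ultimately have "p = v" "p' = w" using pp(1,2) yn yc y(4) graph_irrefl[OF g] by auto
        then show ?thesis using pp conc by blast
      qed
    qed
  qed
  have "P a1" using h S unfolding P_def by blast
  have allP: "P a" if "a \<in> A" for a
    by (rule sqconn_closed[OF sqAB, of a1 P]) (use S \<open>P a1\<close> key that in blast)+
  have vA: "E v a" if "a \<in> A" for a using allP[OF that] unfolding P_def by blast
  have wA: "\<not> E w a" if "a \<in> A" for a using A_cover[OF that] key allP[OF that] by metis
  have wB: "E w y" "\<not> E v y" if y: "y \<in> B" for y
  proof -
    obtain x x' y' where t: "sq x x' y y'" using B_cover[OF y] by blast
    then show "E w y" "\<not> E v y" using key[OF t allP] sqD[OF t] by blast+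
  qed
  have "sqconn (compl V E) (insert v C) (insert w D)"
  proof (rule sqconn_insert2[OF gc sqCD, of c1 d1])
    have m: "c1 \<in> C" "d1 \<in> D" "E c1 d1" using Q by blast+
    have "v \<noteq> c1" "v \<noteq> d1" "w \<noteq> c1" "w \<noteq> d1" using outside v(2) w(2) m by blast+
    moreover have "c1 \<in> V" "d1 \<in> V" using m parts by blast+
    ultimately show "square (compl V E) v c1 w d1 \<or> square (compl V E) v c1 d1 w"
      using noC[OF m(1)] noD[OF m(2)] m vw v(1) w(1) sym[of d1 w] sym[of c1 w] unfolding square_def
      by (auto simp: compl_def)
  qed (use Q in auto)
  then have "config V E A B (insert v C) (insert w D)"
    unfolding config_def using parts sqAB AC BD AD BC v w outside[OF v(2)] outside[OF w(2)] vA wA wB vw(3) sym by auto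
  from maximal[OF this] have "card (insert w (insert v K)) \<le> card K" by (simp add: K_def insert_commute)
  then show False using v w finite_K vw(3) by simp
qed

text \<open>A violated pair from \<open>A\<close> and \<open>D\<close>, or from \<open>C\<close> and
  \<open>B\<close>, lies in one diamond, so \<open>bad_pair\<close> and \<open>no_pair\<close>
  apply. Non-adjacent \<open>l\<close> in \<open>A\<close> and \<open>r\<close> in \<open>B\<close>,
  or in \<open>C\<close> and \<open>D\<close>, need not lie in one; then \<open>r\<close> either
  fits into a square with \<open>l\<close> or is adjoined to \<open>F\<close>, which moves the
  violation to a pair inside a diamond.\<close>

lemma connected_minor:
  assumes F: "F \<subseteq> V" "F \<inter> K = {}" "conn F E" and mn: "\<And>z. z \<in> F \<Longrightarrow> minor z"
    and xy: "x \<in> F" "y \<in> F" and lr: "l \<in> L" "r \<in> R" "E x l" "E y r"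
  shows "E l r"
proof (rule ccontr)
  assume nlr: "\<not> E l r"
  have np: False if "v \<in> F" "w \<in> F" "sq a1 a2 b1 b2" "asq c1 c2 d1 d2" "pair_on E v w a1 a2 b1 b2 c1 c2 d1 d2"
    for v w a1 a2 b1 b2 c1 c2 d1 d2
    using no_pair[OF _ _ mn[OF that(1)] _ _ mn[OF that(2)] that(3-5)] that(1,2) F(1,2) by blast
  have viol: False if s: "sq a1 a2 b1 b2" and q: "asq c1 c2 d1 d2"
    and "x \<in> F" "y \<in> F" "l \<in> {a1, a2, c1, c2}" "r \<in> {b1, b2, d1, d2}" "\<not> E l r" "E x l" "E y r"
    for x y l r a1 a2 b1 b2 c1 c2 d1 d2
  proof -
    have "minor_on E z a1 a2 b1 b2 c1 c2 d1 d2" if "z \<in> F" for z using minor_on_if_minor[OF mn[OF that] s q] .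
    from bad_pair[OF s q F(1,3) outside_set[OF F(2) s q] this that(3-9)] np[OF _ _ s q] show False by blast
  qed
  have ad: False if h: "a \<in> A" "d \<in> D" "x \<in> F" "y \<in> F" "E x a" "E y d" for a d x y
  proof -
    obtain a2 b1 b2 where s: "sq a a2 b1 b2" using A_cover[OF h(1)] by blast
    obtain c1 c2 d2 where q: "asq c1 c2 d d2" using D_cover[OF h(2)] by blast
    show False by (rule viol[OF s q h(3,4) _ _ AD(1)[OF h(1,2)] h(5,6)]) auto
  qed
  have cb: False if h: "c \<in> C" "u \<in> B" "x \<in> F" "y \<in> F" "E x c" "E y u" for c u x y
  proof -
    obtain a1 a2 b2 where s: "sq a1 a2 u b2" using B_cover[OF h(2)] by blast
    obtain c2 d1 d2 where q: "asq c c2 d1 d2" using C_cover[OF h(1)] by blast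
    show False by (rule viol[OF s q h(3,4) _ _ BC(2)[OF h(2,1)] h(5,6)]) auto
  qed
  consider "l \<in> A" "r \<in> D" | "l \<in> C" "r \<in> B" | "l \<in> A" "r \<in> B" | "l \<in> C" "r \<in> D" using lr by blast
  then show False
  proof cases
    case 1 then show False using ad xy lr by blast
  next
    case 2 then show False using cb xy lr by blast
  next
    case 3
    obtain a2 b1 b2 where s: "sq l a2 b1 b2" using A_cover[OF 3(1)] by blast
    obtain c1 c2 d1 d2 where q: "asq c1 c2 d1 d2" using asq_ex by blast
    note S = sqD[OF s] and Q = asqD[OF q]
    have noC: "\<not> E z c1" if "z \<in> F" for z using cb[of c1 r z y] that xy lr 3 Q by blast
    have r1: "r \<noteq> b1" "r \<noteq> b2" using S nlr viol[OF s q xy _ _ nlr lr(3,4)] by auto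
    have rd: "E r d1" "E d1 r" "E b1 d1" "\<not> E l d1" "\<not> E a2 d1" "\<not> E r c1" "\<not> E r c2" using Q S BD AD BC 3 by blast+
    have rl: "\<not> E r l" using nlr sym[of r l] by blast
    show False
    proof (cases "E a2 r")
      case True
      have "E r b1"
      proof (rule ccontr)
        assume n: "\<not> E r b1"
        have "E r a2" "E a2 l" using True S sym[of r a2] sym[of l a2] by auto
        then show False using no_C5[OF g b, of r a2 l b1 d1] S rd rl n by blast
      qed
      then have "sq l a2 b1 r" using S 3 nlr True sym[of r b1] unfolding squares_def square_def by blast
      from viol[OF this q xy, of l r] show False using nlr lr by blast
    next
      case False
      then have ra: "\<not> E r a2" using sym[of r a2] by blast
      let ?F = "insert r F"
      have c: "conn ?F E" by (rule conn_insert[OF g F(3) xy(2) lr(4)])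
      have "r \<notin> {l, a2, b1, b2, c1, c2, d1, d2}" using r1 3 parts(5,8,9) S Q by blast
      then have dis: "?F \<inter> {l, a2, b1, b2, c1, c2, d1, d2} = {}" using outside_set[OF F(2) s q] by blast
      have mo: "minor_on E z l a2 b1 b2 c1 c2 d1 d2" if "z \<in> ?F" for z
        using that minor_on_if_minor[OF mn s q] rl ra rd unfolding minor_on_def by blast
      have sub: "?F \<subseteq> V" using F 3 parts(2) by blast
      obtain p p' where pp: "p \<in> ?F" "p' \<in> ?F" "pair_on E p p' l a2 b1 b2 c1 c2 d1 d2"
        using bad_pair[OF s q sub c dis mo, of x r l d1] xy lr rd by blast
      have nc: "\<not> E p c1" using pp(1) noC rd by blast
      have "E p l" "\<not> E p' d1" using pp(3) nc unfolding pair_on_def by auto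
      then have "p \<in> F" "p' \<in> F" using pp(1,2) rl rd by blast+
      then show False using np[OF _ _ s q pp(3)] by blast
    qed
  next
    case 4
    obtain a1 a2 b1 b2 where s: "sq a1 a2 b1 b2" using sq_ex by blast
    obtain c2 d1 d2 where q: "asq l c2 d1 d2" using C_cover[OF 4(1)] by blast
    note S = sqD[OF s] and Q = asqD[OF q]
    have m: "a1 \<in> A" "a2 \<in> A" "b1 \<in> B" "c2 \<in> C" "d1 \<in> D" using S Q by simp_all
    have noA: "\<not> E z a" if "z \<in> F" "a \<in> A" for z a using ad[OF that(2) 4(2) that(1) xy(2) _ lr(4)] by blast
    have r1: "r \<noteq> d1" "r \<noteq> d2" using Q nlr viol[OF s q xy _ _ nlr lr(3,4)] by auto
    have rl: "\<not> E r l" using nlr sym[of r l] by blast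
    have ar: "\<not> E r a1" "\<not> E r a2" "\<not> E a1 r" "\<not> E a1 d1" "E l a1" "E a1 c2" "E r b1" "\<not> E l b1"
      by (rule AD(2)[OF m(1) 4(2)] AD(2)[OF m(2) 4(2)] AD(1)[OF m(1) 4(2)] AD(1)[OF m(1) m(5)] AC(2)[OF m(1) 4(1)]
          AC(1)[OF m(1) m(4)] BD(2)[OF m(3) 4(2)] BC(2)[OF m(3) 4(1)])+
    show False
    proof (cases "E c2 r")
      case True
      have "\<not> E d1 r"
      proof
        assume n: "E d1 r"
        then show False using no_C5[OF g b, of l a1 c2 r d1] ar Q True nlr sym[of d1 r] sym[of l d1] by blast
      qed
      then have "asq l c2 d1 r" using Q 4 nlr True r1 by (intro asqI) auto
      from viol[OF s this xy, of l r] show False using nlr lr by blast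
    next
      case False
      then have rc: "\<not> E r c2" using sym[of r c2] by blast
      let ?F = "insert r F"
      have c: "conn ?F E" by (rule conn_insert[OF g F(3) xy(2) lr(4)])
      have "r \<notin> {a1, a2, b1, b2, l, c2, d1, d2}" using r1 4 parts(7,9,10) S Q by blast
      then have dis: "?F \<inter> {a1, a2, b1, b2, l, c2, d1, d2} = {}" using outside_set[OF F(2) s q] by blast
      have mo: "minor_on E z a1 a2 b1 b2 l c2 d1 d2" if "z \<in> ?F" for z
        using that minor_on_if_minor[OF mn s q] rl rc ar unfolding minor_on_def by blast
      have sub: "?F \<subseteq> V" using F 4 parts(4) by blast
      obtain p p' where pp: "p \<in> ?F" "pair_on E p p' a1 a2 b1 b2 l c2 d1 d2"
        using bad_pair[OF s q sub c dis mo, of x r l b1] xy lr ar by blast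
      \<comment> \<open>The first vertex of a pair always sees \<open>a1\<close> or
        \<open>a2\<close>, but neither the vertices of \<open>F\<close> nor \<open>r\<close> see
        \<open>A\<close>.\<close>
      have "\<not> E p a1" "\<not> E p a2" using pp(1) noA ar S by blast+
      then show False using pp(2) unfolding pair_on_def by blast
    qed
  qed
qed

end

section \<open>From a component of minor vertices to a balanced skew partition\<close>

lemma conn_star:
  assumes g: "graph V E" and e: "\<And>d. d \<in> S \<Longrightarrow> E z d"
  shows "conn (insert z S) E"
  unfolding conn_iff[OF g]
proof (intro allI impI, elim conjE)
  fix U assume U: "U \<subseteq> insert z S" "U \<noteq> {}" "U \<noteq> insert z S"
  show "\<exists>u\<in>U. \<exists>w\<in>insert z S - U. E u w"
  proof (cases "z \<in> U")
    case True
    then obtain w where "w \<in> insert z S - U" "w \<in> S" using U by blast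
    then show ?thesis using e True by blast
  next
    case False
    then obtain u where "u \<in> U" "u \<in> S" using U by blast
    then show ?thesis using graph_sym[OF g e] False by blast
  qed
qed

text \<open>If \<open>p\<close> and \<open>p'\<close> are adjacent, \<open>u x p p' y\<close> is a
  5-hole. Otherwise \<open>x p t p' y\<close> is an induced path with three interior vertices, and
  \<open>I\<close> has an even number, against \<open>two_paths_parity\<close>.\<close>

lemma private_neighbours:
  assumes g: "graph V E" and b: "berge V E" and P: "odd_path V E x I y"
    and e: "E x p" "E y p'" "\<not> E y p" "\<not> E x p'" "E u x" "E u y" "\<not> E u p" "\<not> E u p'" "E t p" "E t p'" "\<not> E t x" "\<not> E t y"
    and I: "\<And>z. z \<in> {p, p', t} \<Longrightarrow> z \<notin> set I" "\<And>z i. z \<in> {p, p', t} \<Longrightarrow> i \<in> set I \<Longrightarrow> \<not> E i z"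
  shows False
proof -
  note D = odd_pathD[OF g P]
  have sym: "E a c \<longleftrightarrow> E c a" for a c by (rule graph_sym_iff[OF g])
  have irr: "\<not> E a a" for a by (rule graph_irrefl[OF g])
  have pp: "p \<noteq> p'" using e by auto
  show False
  proof (cases "E p p'")
    case True
    then show False using no_C5[OF g b, of u x p p' y] e sym D(7) by blast
  next
    case False
    have V: "x \<in> V" "y \<in> V" "p \<in> V" "p' \<in> V" "t \<in> V" using e graph_in1[OF g] graph_in2[OF g] by blast+
    have sw: "E p x" "E p' y" "\<not> E p y" "\<not> E p' x" "E p t" "E p' t" "\<not> E x t" "\<not> E y t" "\<not> E p' p" "\<not> E x y" "\<not> E y x"
      using e sym[of p x] sym[of p' y] sym[of p y] sym[of p' x] sym[of p t] sym[of p' t] sym[of x t] sym[of y t] sym[of p' p] False D(7) sym[of x y]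
      by simp_all
    have n: "x \<noteq> p" "x \<noteq> t" "x \<noteq> p'" "x \<noteq> y" "p \<noteq> t" "p \<noteq> y" "t \<noteq> p'" "t \<noteq> y" "p' \<noteq> y"
      using e sw D(6) irr pp by auto
    have J: "ipath V E (x # [p, t, p'] @ [y])"
      using e sw V n pp False irr by (simp add: ipath_Cons[OF g] ipath_single[OF g])
    have "even (length I + length [p, t, p'])"
    proof (rule two_paths_parity[OF g b _ J D(9)])
      show "ipath V E (x # I @ [y])" using P by (simp add: odd_path_def)
      show "set I \<inter> set [p, t, p'] = {}" using I(1) by auto
      show "\<not> E i j" if "i \<in> set I" "j \<in> set [p, t, p']" for i j using I(2)[of j i] that by auto
    qed simp
    then show False using D(10) by simp
  qed
qed

lemma sqconn_two:
  assumes g: "graph V E" and s: "square E a1 a2 b1 b2"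
  shows "sqconn E {a1, a2} {b1, b2}"
proof -
  have s1: "squares E {a1, a2} {b1, b2} a1 a2 b1 b2" using s unfolding squares_def by blast
  have s2: "squares E {a1, a2} {b1, b2} a2 a1 b2 b1" by (rule squares_swap[OF g s1])
  have two: "p \<in> X \<and> q \<notin> X \<or> q \<in> X \<and> p \<notin> X" if "X \<subseteq> {p, q}" "X \<noteq> {}" "X \<noteq> {p, q}" for X and p q :: 'a
    using that by blast
  show ?thesis
    unfolding sqconn_def
  proof (intro conjI allI impI, goal_cases)
    case 1 show ?case using s1 by blast
  next
    case (2 X) then show ?case using two[of X a1 a2] s1 s2 by blast
  next
    case (3 Y) then show ?case using two[of Y b1 b2] s1 s2 by blast
  qed
qed

text \<open>The union of those anticomponents of \<open>M\<close> that contain a non-neighbour of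
  some vertex of \<open>N\<close>. Adding it to \<open>N\<close> leaves the rest of \<open>M\<close>
  complete to everything collected, which is how the cutset is split into two mutually complete
  parts.\<close>

definition linked :: "'a set \<Rightarrow> ('a \<Rightarrow> 'a \<Rightarrow> bool) \<Rightarrow> 'a set \<Rightarrow> 'a set \<Rightarrow> 'a set" where
  "linked V E M N = {m \<in> M. \<exists>S\<subseteq>M. m \<in> S \<and> conn S (compl V E) \<and> (\<exists>s\<in>S. \<exists>n\<in>N. \<not> E s n)}"

lemma linked_unlinked:
  assumes g: "graph V E" and M: "M \<subseteq> V" and m: "m \<in> M - linked V E M N"
  shows "n \<in> N \<Longrightarrow> E m n" and "m' \<in> linked V E M N \<Longrightarrow> E m m'"
proof -
  have mM: "m \<in> M" "m \<notin> linked V E M N" using m by auto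
  show "E m n" if "n \<in> N"
  proof (rule ccontr)
    assume "\<not> E m n"
    then have "m \<in> linked V E M N" unfolding linked_def
      using mM(1) that conn_singleton[of m "compl V E"] by (intro CollectI conjI exI[of _ "{m}"]) auto
    then show False using mM by blast
  qed
  show "E m m'" if m': "m' \<in> linked V E M N"
  proof (rule ccontr)
    assume n: "\<not> E m m'"
    obtain S where S: "S \<subseteq> M" "m' \<in> S" "conn S (compl V E)" "\<exists>s\<in>S. \<exists>n\<in>N. \<not> E s n" using m' unfolding linked_def by blast
    have "m \<noteq> m'" using mM m' by blast
    then have "compl V E m' m" using n mM S(1,2) M graph_sym[OF g, of m' m] unfolding compl_def by blast
    from conn_insert[OF graph_compl[OF g] S(3,2) this] have "m \<in> linked V E M N" unfolding linked_def
      using S mM by (intro CollectI conjI exI[of _ "insert m S"]) auto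
    then show False using mM by blast
  qed
qed

context maximal_config
begin

abbreviation major where "major \<equiv> maximal_config.minor (compl V E) C D B A"

lemma connected_major:
  assumes S: "S \<subseteq> V" "S \<inter> K = {}" "conn S (compl V E)" "\<And>z. z \<in> S \<Longrightarrow> major z"
    and xy: "x \<in> S" "y \<in> S" and lr: "l \<in> B \<union> C" "r \<in> A \<union> D" "\<not> E x l" "\<not> E y r"
  shows "\<not> E l r"
proof -
  interpret d: maximal_config V "compl V E" C D B A by (rule maximal_config_dual[OF maximal_config_axioms])
  have SK: "S \<inter> d.K = {}" using S(2) unfolding K_def d.K_def by blast
  have "x \<in> V" "y \<in> V" "x \<notin> K" "y \<notin> K" using xy S(1,2) by blast+
  moreover have "l \<in> K" "r \<in> K" "l \<in> V" "r \<in> V" using lr(1,2) parts(1-4) unfolding K_def by blast+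
  ultimately have "compl V E x l" "compl V E y r" using lr(3,4) unfolding compl_def by blast+
  then have "compl V E l r"
    using d.connected_minor[OF S(1) SK S(3,4) xy, of l r] lr(1,2) by blast
  then show ?thesis by (simp add: compl_def)
qed

lemma nbr_A: assumes "a \<in> A" obtains y where "y \<in> B" "E a y"
  using A_cover[OF assms] sqD by metis

lemma nbr_C: assumes "c \<in> C" obtains d where "d \<in> D" "E c d"
  using C_cover[OF assms] asqD by metis

text \<open>The cutset is \<open>A \<union> C \<union> M\<close>. Anticomponents of \<open>M\<close>
  that miss a vertex of \<open>C\<close> go with \<open>C\<close>, the others with \<open>A\<close>;
  \<open>connected_major\<close> ensures that none misses vertices of both. If some cutset vertex
  has no neighbour in \<open>F\<close>, the partition is loose. Otherwise balance is proved
  directly, with vertices of \<open>B \<union> D\<close> as auxiliary vertices, because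
  \<open>F\<close> sees none of them.\<close>

lemma one_sided:
  assumes F: "F \<subseteq> V" "F \<inter> K = {}" "conn F E" "F \<noteq> {}" and FR: "\<And>x y. x \<in> F \<Longrightarrow> y \<in> B \<union> D \<Longrightarrow> \<not> E x y"
    and M: "M \<subseteq> V" "M \<inter> K = {}" "M \<inter> F = {}" "\<And>m. m \<in> M \<Longrightarrow> major m"
    and FW: "\<And>x y. x \<in> F \<Longrightarrow> y \<in> V - F - (A \<union> C \<union> M) \<Longrightarrow> \<not> E x y"
  shows "balanced_skew_partition V E"
proof -
  let ?C = "compl V E"
  define W where "W = V - F - (A \<union> C \<union> M)"
  define Q where "Q = C \<union> linked V E M C"
  define P where "P = A \<union> (M - linked V E M C)"
  note bc = berge_compl[OF g b]
  have U: "\<not> E l r" if "S \<subseteq> M" "conn S ?C" "x \<in> S" "y \<in> S" "l \<in> B \<union> C" "r \<in> A \<union> D" "\<not> E x l" "\<not> E y r" for S x y l r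
  proof (rule connected_major[OF _ _ that(2) _ that(3-8)])
    show "S \<subseteq> V" "S \<inter> K = {}" using that(1) M by blast+
    show "major z" if "z \<in> S" for z using that \<open>S \<subseteq> M\<close> M(4) by blast
  qed
  have U1: "\<not> E l r" if "m \<in> M" "l \<in> B \<union> C" "r \<in> A \<union> D" "\<not> E m l" "\<not> E m r" for m l r
    using U[of "{m}" m m l r] that conn_singleton[of m ?C] by blast
  have FA: "x \<notin> F" if "x \<in> A \<union> B \<union> C \<union> D" for x using that F(2) unfolding K_def by blast
  have MA: "x \<notin> M" if "x \<in> A \<union> B \<union> C \<union> D" for x using that M(2) unfolding K_def by blast
  have lM: "linked V E M C \<subseteq> M" unfolding linked_def by blast
  have BW: "B \<union> D \<subseteq> W" using parts FA MA unfolding W_def by blast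
  have part: "F \<union> W \<union> (P \<union> Q) = V" "F \<inter> W = {}" "(F \<union> W) \<inter> (P \<union> Q) = {}" "P \<inter> Q = {}"
  proof -
    show "F \<union> W \<union> (P \<union> Q) = V" unfolding W_def P_def Q_def using F(1) M(1) parts(1,3) lM by blast
    show "F \<inter> W = {}" unfolding W_def by blast
    show "(F \<union> W) \<inter> (P \<union> Q) = {}" unfolding W_def P_def Q_def using FA M(3) lM by blast
    show "P \<inter> Q = {}" unfolding P_def Q_def using parts(6) MA lM by blast
  qed
  have PQ: "E x y" if x: "x \<in> P" and y: "y \<in> Q" for x y
  proof -
    have "E x y" if h: "x \<in> A" "y \<in> linked V E M C"
    proof (rule ccontr)
      assume n: "\<not> E x y"
      obtain S s c where S: "S \<subseteq> M" "y \<in> S" "conn S ?C" "s \<in> S" "c \<in> C" "\<not> E s c" using h(2) unfolding linked_def by blast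
      have "\<not> E c x" using U[OF S(1,3,4,2), of c x] S(5,6) h(1) n sym[of x y] by blast
      then show False using AC h(1) S(5) by blast
    qed
    then show ?thesis using x y AC(1) linked_unlinked[OF g M(1)] unfolding P_def Q_def by blast
  qed
  have QP: "E x y" if "x \<in> Q" "y \<in> P" for x y using PQ[OF that(2,1)] sym[of x y] by blast
  have FW': "\<not> E x y" "\<not> E y x" if "x \<in> F" "y \<in> W" for x y using FW that sym[of x y] unfolding W_def by blast+
  obtain a1 a2 b1 b2 where s: "sq a1 a2 b1 b2" using sq_ex .
  obtain c1 c2 d1 d2 where q: "asq c1 c2 d1 d2" using asq_ex .
  note S = sqD[OF s] and AQ = asqD[OF q]
  have ne: "W \<noteq> {}" "P \<noteq> {}" "Q \<noteq> {}" using S AQ BW unfolding P_def Q_def by blast+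
  show ?thesis
  proof (cases "\<exists>x\<in>P \<union> Q. \<forall>z\<in>F. \<not> E x z")
    case True
    then obtain x where x: "x \<in> P \<union> Q" "\<And>z. z \<in> F \<Longrightarrow> \<not> E x z" by blast
    show ?thesis
    proof (cases "x \<in> P")
      case True
      have "loose V E F W P Q x"
        unfolding loose_def
        by (intro conjI ballI part F(4) ne FW' PQ x(2) UnI2 True)
      then show ?thesis by (rule loose_balanced[OF g b])
    next
      case False
      then have xQ: "x \<in> Q" using x by blast
      have part': "F \<union> W \<union> (Q \<union> P) = V" "(F \<union> W) \<inter> (Q \<union> P) = {}" "Q \<inter> P = {}" using part by blast+
      have "loose V E F W Q P x"
        unfolding loose_def
        by (intro conjI ballI part(2) part' F(4) ne FW' QP x(2) UnI2 xQ)
      then show ?thesis by (rule loose_balanced[OF g b])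
    qed
  next
    case False
    then have att: "\<exists>z\<in>F. E x z" if "x \<in> P \<union> Q" for x using that by blast
    have PQsub: "P \<union> Q = A \<union> C \<union> M" unfolding P_def Q_def using lM by blast
    \<comment> \<open>As \<open>F\<close> sees nothing of \<open>B \<union> D\<close>, a common
      neighbour of the ends there closes an odd hole. Two ends in \<open>A\<close>, or two in
      \<open>C\<close>, without a common neighbour have private ones, and
      \<open>private_neighbours\<close> applies.\<close>
    have pathF: False if O: "odd_path V E x I y" and xy: "x \<in> P \<union> Q" "y \<in> P \<union> Q" and I: "set I \<subseteq> F" for x I y
    proof -
      note D = odd_pathD[OF g O]
      have common: False if "z \<in> B \<union> D" "E x z" "E y z" for z
      proof (rule odd_path_close[OF g b O])
        show "z \<in> V" "z \<notin> set I" using that(1) parts(2,4) I FA by blast+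
        show "E z x" "E z y" using that sym by blast+
        show "\<not> E z i" if "i \<in> set I" for i using FR[of i z] that I \<open>z \<in> B \<union> D\<close> sym[of i z] by blast
      qed
      have priv: False if e: "E x p" "E y p'" "\<not> E y p" "\<not> E x p'" "E u x" "E u y" "\<not> E u p" "\<not> E u p'" "E t p" "E t p'" "\<not> E t x" "\<not> E t y"
        and "{p, p', t} \<subseteq> B \<union> D" for p p' u t
      proof (rule private_neighbours[OF g b O e])
        show "z \<notin> set I" if "z \<in> {p, p', t}" for z using that \<open>{p, p', t} \<subseteq> B \<union> D\<close> I FA by blast
        show "\<not> E i z" if "z \<in> {p, p', t}" "i \<in> set I" for z i using that \<open>{p, p', t} \<subseteq> B \<union> D\<close> I FR by blast
      qed
      have AM: False if h: "u \<in> A" "m \<in> M" "\<not> E m u" "{u, m} = {x, y}" for u m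
      proof -
        obtain z where z: "z \<in> B" "E u z" using nbr_A[OF h(1)] .
        have "E m z" using U1[OF h(2), of z u] z h(1,3) sym[of u z] by blast
        then show False using common[of z] z h(4) by (auto simp: doubleton_eq_iff)
      qed
      have CM: False if h: "u \<in> C" "m \<in> M" "\<not> E m u" "{u, m} = {x, y}" for u m
      proof -
        obtain z where z: "z \<in> D" "E u z" using nbr_C[OF h(1)] .
        have "E m z" using U1[OF h(2), of u z] z h(1,3) by blast
        then show False using common[of z] z h(4) by (auto simp: doubleton_eq_iff)
      qed
      have nyx: "\<not> E y x" using D(7) sym[of x y] by blast
      consider "x \<in> A" "y \<in> A" | "x \<in> C" "y \<in> C" | "x \<in> A" "y \<in> M" | "x \<in> M" "y \<in> A" | "x \<in> C" "y \<in> M" | "x \<in> M" "y \<in> C"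
        | "x \<in> M" "y \<in> M" | "x \<in> A" "y \<in> C" | "x \<in> C" "y \<in> A"
        using xy unfolding PQsub by blast
      then show False
      proof cases
        case 1
        obtain p where p: "p \<in> B" "E x p" using nbr_A[OF 1(1)] .
        obtain p' where p': "p' \<in> B" "E y p'" using nbr_A[OF 1(2)] .
        have "\<not> E y p" "\<not> E x p'" using common p p' by blast+
        then show False
          using priv[OF p(2) p'(2) _ _ AC(2)[OF 1(1)] AC(2)[OF 1(2)], of c1 d1] p p' 1 AQ BC AD BD by blast
      next
        case 2
        obtain p where p: "p \<in> D" "E x p" using nbr_C[OF 2(1)] .
        obtain p' where p': "p' \<in> D" "E y p'" using nbr_C[OF 2(2)] .
        have "\<not> E y p" "\<not> E x p'" using common p p' by blast+
        then show False
          using priv[OF p(2) p'(2) _ _ AC(1)[OF _ 2(1)] AC(1)[OF _ 2(2)], of a1 b1] p p' 2 S BC AD BD by blast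
      next
        case 3 then show False using AM nyx by blast
      next
        case 4 then show False using AM[of y x] D(7) by blast
      next
        case 5 then show False using CM nyx by blast
      next
        case 6 then show False using CM[of y x] D(7) by blast
      next
        case 7
        \<comment> \<open>\<open>{x, y}\<close> is anticonnected. If neither \<open>b1\<close> nor
          \<open>d1\<close> is a common neighbour, both are missed by this set although they are
          adjacent, against \<open>connected_major\<close>.\<close>
        have "?C y x" using nyx D(2,3,6) by (auto simp: compl_def)
        then have c: "conn {x, y} ?C" using conn_insert[OF gc conn_singleton[of y ?C], of y x] by simp
        have "b1 \<in> B \<union> C" "d1 \<in> A \<union> D" "E b1 d1" "b1 \<in> B \<union> D" "d1 \<in> B \<union> D" using S AQ BD by blast+
        moreover have "\<exists>u\<in>{x, y}. \<not> E u b1" "\<exists>u\<in>{x, y}. \<not> E u d1" using common calculation by blast+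
        ultimately show False using U[OF _ c] 7 by (metis empty_subsetI insert_subset)
      next
        case 8 then show False using AC D(7) by blast
      next
        case 9 then show False using AC D(7) by blast
      qed
    qed
    have path: False if O: "odd_path V E x I y" and xy: "x \<in> P \<union> Q" "y \<in> P \<union> Q" and I: "set I \<subseteq> F \<union> W" for x I y
    proof -
      note D = odd_pathD[OF g O]
      show False
      proof (rule set_two_sides[OF g D(14) I part(2) FW'(1)])
        assume "set I \<subseteq> F" then show False using pathF[OF O xy] by blast
      next
        assume IW: "set I \<subseteq> W"
        obtain z z' where z: "z \<in> F" "E x z" "z' \<in> F" "E y z'" using att[OF xy(1)] att[OF xy(2)] by blast
        have n: "x \<notin> F" "y \<notin> F" "set I \<inter> F = {}" using xy part(2,3) IW by blast+
        have "\<exists>J. odd_path V E x J y \<and> set J \<subseteq> F"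
        proof (rule odd_path_conn[OF g b O F(1,3) n(1,2) z n(3)])
          show "\<not> E i j" if "i \<in> set I" "j \<in> F" for i j using FW'(2)[of j i] that IW by blast
        qed
        then show False using pathF xy by blast
      qed
    qed
    have cc: "compl V ?C = E" by (rule compl_compl[OF g])
    \<comment> \<open>Roussel-Rubio in the complement with a connected set \<open>X\<close> on the
      side that \<open>F\<close> does not see. The path outcome has its interior in \<open>W\<close>
      and contradicts \<open>path\<close>; a leap has both ends in \<open>X\<close> and is closed in
      the complement by \<open>z\<close>, which misses \<open>X\<close> and is complete to
      \<open>R'\<close>.\<close>
    have antiX: False if O: "odd_path V ?C u R' w" and uw: "u \<in> F" "w \<in> F" and R': "set R' \<subseteq> P \<union> Q"
      and X: "X \<subseteq> B \<union> D" "X \<noteq> {}" "conn X E" "\<And>r'. r' \<in> set R' \<Longrightarrow> \<exists>t\<in>X. E r' t"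
      and z: "z \<in> V" "z \<notin> X" "\<And>r'. r' \<in> set R' \<Longrightarrow> E z r'" "\<And>t. t \<in> X \<Longrightarrow> \<not> E z t" for u R' w X z
    proof -
      note D = odd_pathD[OF gc O]
      have XV: "X \<subseteq> V" "X \<subseteq> W" using X(1) BW part(1) by blast+
      have XF: "?C t v" if "t \<in> X" "v \<in> F" for t v
        using that FW'(2)[of v t] XV F(1) part(2) unfolding compl_def by blast
      show False
      proof (rule Roussel_Rubio_weak[OF gc bc XV(1) X(2) _ O])
        show "conn X (compl V ?C)" unfolding cc by (rule X(3))
        show "u \<notin> X" "w \<notin> X" "set R' \<inter> X = {}" using uw XV part(2,3) R' by blast+
        show "?C t u" "?C t w" if "t \<in> X" for t using XF that uw by blast+
        show "\<exists>t\<in>X. \<not> ?C t r'" if r: "r' \<in> set R'" for r' using X(4)[OF r] sym unfolding compl_def by blast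
      next
        fix I assume I: "odd_path V (compl V ?C) (hd R') I (last R')" "set I \<subseteq> X"
        show False by (rule path[OF I(1)[unfolded cc]]) (use D(11,12) R' I(2) XV in blast)+
      next
        fix t t' assume t: "t \<in> X" "t' \<in> X" and O': "odd_path V ?C t R' t'"
        have zX: "?C z t" if "t \<in> X" for t using that z(1,2,4) XV unfolding compl_def by blast
        show False
        proof (rule odd_path_close[OF gc bc O' z(1)])
          show "z \<notin> set R'" using z(3) graph_irrefl[OF g] by blast
          show "?C z t" "?C z t'" using zX t by blast+
          show "\<not> ?C z i" if "i \<in> set R'" for i using z(3)[OF that] by (simp add: compl_def)
        qed
      qed
    qed
    have Mnbr: "E m b' \<or> E m d'" if "m \<in> M" "b' \<in> B" "d' \<in> D" for m b' d'
      using U1[OF that(1), of b' d'] that BD by blast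
    have antiF: False if O: "odd_path V ?C u R' w" and uw: "u \<in> F" "w \<in> F" and R': "set R' \<subseteq> P \<union> Q" for u R' w
    proof -
      note D = odd_pathD[OF gc O]
      have PQC: "\<not> ?C x y" if "x \<in> P" "y \<in> Q" for x y using PQ[OF that] by (simp add: compl_def)
      show False
      proof (rule set_two_sides[OF gc D(14) R' part(4) PQC])
        assume RP: "set R' \<subseteq> P"
        show False
        \<comment> \<open>\<open>d2\<close> is adjoined for two reasons: it makes the set connected,
          and a vertex of \<open>M\<close> must see one of the adjacent vertices \<open>b1\<close>
          and \<open>d2\<close>.\<close>
        proof (rule antiX[OF O uw R', of "insert d2 B" c1])
          show "insert d2 B \<subseteq> B \<union> D" "insert d2 B \<noteq> {}" using AQ by blast+
          show "conn (insert d2 B) E" using conn_star[OF g, of B d2] BD AQ by blast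
          show "\<exists>t\<in>insert d2 B. E r' t" if "r' \<in> set R'" for r'
          proof (cases "r' \<in> A")
            case True then show ?thesis using nbr_A by blast
          next
            case False
            then have "r' \<in> M" using that RP unfolding P_def by blast
            then show ?thesis using Mnbr[of r' b1 d2] S AQ by blast
          qed
          show "c1 \<in> V" "c1 \<notin> insert d2 B" using AQ parts(3,8,10) by blast+
          show "E c1 r'" if "r' \<in> set R'" for r' using QP[of c1 r'] that RP AQ unfolding Q_def by blast
          show "\<not> E c1 t" if "t \<in> insert d2 B" for t using that AQ BC by blast
        qed
      next
        assume RQ: "set R' \<subseteq> Q"
        show False
        proof (rule antiX[OF O uw R', of "insert b2 D" a1])
          show "insert b2 D \<subseteq> B \<union> D" "insert b2 D \<noteq> {}" using S by blast+
          show "conn (insert b2 D) E" using conn_star[OF g, of D b2] BD S by blast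
          show "\<exists>t\<in>insert b2 D. E r' t" if "r' \<in> set R'" for r'
          proof (cases "r' \<in> C")
            case True then show ?thesis using nbr_C by blast
          next
            case False
            then have "r' \<in> M" using that RQ lM unfolding Q_def by blast
            then show ?thesis using Mnbr[of r' b2 d1] S AQ by blast
          qed
          show "a1 \<in> V" "a1 \<notin> insert b2 D" using S parts(1,5,7) by blast+
          show "E a1 r'" if "r' \<in> set R'" for r' using PQ[of a1 r'] that RQ S unfolding P_def by blast
          show "\<not> E a1 t" if "t \<in> insert b2 D" for t using that S AD by blast
        qed
      qed
    qed
    have antipath: False if O: "odd_path V ?C u R' w" and uw: "u \<in> F \<union> W" "w \<in> F \<union> W" and R': "set R' \<subseteq> P \<union> Q" for u R' w
    proof -
      note D = odd_pathD[OF gc O]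
      have Euw: "E u w" using D(2,3,6,7) by (auto simp: compl_def)
      show False
      proof (cases "u \<in> F")
        case True
        then have "w \<in> F" using Euw uw FW' by blast
        then show False using antiF[OF O True _ R'] by blast
      next
        case False
        then have uW: "u \<in> W" "w \<in> W" using Euw uw FW' by blast+
        have WV: "W \<subseteq> V" unfolding W_def by blast
        have FWc: "?C t v" if "t \<in> F" "v \<in> W" for t v
          using that FW'(1)[of t v] F(1) WV part(2) unfolding compl_def by blast
        show False
        proof (rule Roussel_Rubio_weak[OF gc bc F(1,4) _ O])
          show "conn F (compl V ?C)" unfolding cc by (rule F(3))
          show "u \<notin> F" "w \<notin> F" "set R' \<inter> F = {}" using uW part(2,3) R' by blast+
          show "?C t u" "?C t w" if "t \<in> F" for t using FWc that uW by blast+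
          show "\<exists>t\<in>F. \<not> ?C t r'" if r: "r' \<in> set R'" for r'
            using att[of r'] r R' sym unfolding compl_def by blast
        next
          fix I assume I: "odd_path V (compl V ?C) (hd R') I (last R')" "set I \<subseteq> F"
          show False by (rule path[OF I(1)[unfolded cc]]) (use D(11,12) R' I(2) in blast)+
        next
          fix t t' assume "t \<in> F" "t' \<in> F" "odd_path V ?C t R' t'"
          then show False using antiF R' by blast
        qed
      qed
    qed
    show ?thesis
    proof (rule balanced_skew_partitionI[OF part(1,3) _ _ path antipath g])
      obtain f w p' q' where "f \<in> F" "w \<in> W" "p' \<in> P" "q' \<in> Q" using F(4) ne by blast
      moreover have "\<not> ?C x y" if "x \<in> P" "y \<in> Q" for x y using PQ[OF that] by (simp add: compl_def)
      ultimately show "disconnected (F \<union> W) E" "disconnected (P \<union> Q) ?C"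
        using disconnectedI[OF g refl _ _ part(2) FW'(1)] disconnectedI[OF gc refl _ _ part(4)] by blast+
    qed
  qed
qed


text \<open>The neighbours of \<open>F\<close> in \<open>L\<close> and in \<open>R\<close> are
  complete to each other by \<open>connected_minor\<close>, so they lie in \<open>A\<close> and
  \<open>B\<close> or in \<open>C\<close> and \<open>D\<close>. This leaves a vertex
  \<open>v\<close> of the other left set outside the cutset and complete to \<open>Q\<close>, which
  makes the partition loose.\<close>

lemma two_sided:
  assumes F: "F \<subseteq> V" "F \<inter> K = {}" "conn F E" "\<And>z. z \<in> F \<Longrightarrow> minor z" and f: "x0 \<in> F" "l0 \<in> L" "E x0 l0" "y0 \<in> F" "r0 \<in> R" "E y0 r0"
    and M: "M \<subseteq> V" "M \<inter> K = {}" "M \<inter> F = {}" "\<And>m. m \<in> M \<Longrightarrow> major m"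
    and FW: "\<And>x y. x \<in> F \<Longrightarrow> y \<in> V - F - (K \<union> M) \<Longrightarrow> \<not> E x y"
  shows "balanced_skew_partition V E"
proof -
  let ?C = "compl V E"
  define NL where "NL = {l\<in>L. \<exists>x\<in>F. E x l}"
  define NR where "NR = {r\<in>R. \<exists>x\<in>F. E x r}"
  have LR: "E l r" if "l \<in> NL" "r \<in> NR" for l r
    using that connected_minor[OF F] unfolding NL_def NR_def by blast
  have lr: "l0 \<in> NL" "r0 \<in> NR" using f unfolding NL_def NR_def by blast+
  obtain a1 a2 b1 b2 where s: "sq a1 a2 b1 b2" using sq_ex .
  obtain c1 c2 d1 d2 where q: "asq c1 c2 d1 d2" using asq_ex .
  have ac: "a1 \<in> A" "c1 \<in> C" using sqD[OF s] asqD[OF q] by simp_all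
  have cases: "NL \<subseteq> A \<and> NR \<subseteq> B \<or> NL \<subseteq> C \<and> NR \<subseteq> D"
  proof (cases "l0 \<in> A")
    case True
    have "NR \<subseteq> B" using LR[OF lr(1)] AD(1)[OF True] unfolding NR_def by blast
    then have "r0 \<in> B" using lr by blast
    then have "NL \<subseteq> A" using LR[OF _ lr(2)] BC(2) unfolding NL_def by blast
    then show ?thesis using \<open>NR \<subseteq> B\<close> by blast
  next
    case False
    then have l: "l0 \<in> C" using f(2) by blast
    have "NR \<subseteq> D" using LR[OF lr(1)] BC(2)[OF _ l] unfolding NR_def by blast
    then have "r0 \<in> D" using lr by blast
    then have "NL \<subseteq> C" using LR[OF _ lr(2)] AD(1) unfolding NL_def by blast
    then show ?thesis using \<open>NR \<subseteq> D\<close> by blast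
  qed
  \<comment> \<open>A vertex of the part of \<open>L\<close> that does not contain
    \<open>NL\<close>: complete to \<open>NL\<close>, but without neighbours in
    \<open>F\<close>.\<close>
  define v where "v = (if NL \<subseteq> A then c1 else a1)"
  have NLA: "\<not> NL \<subseteq> A" if "NL \<subseteq> C" using that lr(1) parts(6) by blast
  have v: "v \<in> L" "v \<notin> NL" "v \<notin> NR" "v \<in> V"
    using cases NLA ac parts(1,3,5-10) unfolding v_def by auto
  have vN: "E v l \<and> (v \<in> B \<union> C \<and> l \<in> A \<union> D \<or> v \<in> A \<union> D \<and> l \<in> B \<union> C)" if "l \<in> NL" for l
    using that cases NLA ac AC unfolding v_def by auto
  have rl: "r \<in> B \<union> C \<and> l \<in> A \<union> D \<or> r \<in> A \<union> D \<and> l \<in> B \<union> C" if "l \<in> NL" "r \<in> NR" for l r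
    using that cases by blast
  have U: "\<not> E l r" if h: "S \<subseteq> M" "conn S ?C" "x \<in> S" "y \<in> S" "\<not> E x l" "\<not> E y r"
    and lr: "l \<in> B \<union> C \<and> r \<in> A \<union> D \<or> l \<in> A \<union> D \<and> r \<in> B \<union> C" for S x y l r
  proof -
    have S: "S \<subseteq> V" "S \<inter> K = {}" "\<And>z. z \<in> S \<Longrightarrow> major z" using h(1) M by blast+
    from lr show ?thesis
    proof
      assume "l \<in> B \<union> C \<and> r \<in> A \<union> D"
      then show ?thesis using connected_major[OF S(1,2) h(2) S(3) h(3,4) _ _ h(5,6)] by blast
    next
      assume "l \<in> A \<union> D \<and> r \<in> B \<union> C"
      then have "\<not> E r l" using connected_major[OF S(1,2) h(2) S(3) h(4,3) _ _ h(6,5)] by blast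
      then show ?thesis using sym by blast
    qed
  qed
  define Q where "Q = NL \<union> linked V E M NL"
  define P where "P = NR \<union> (M - linked V E M NL)"
  define W where "W = V - F - (NL \<union> NR \<union> M)"
  have lM: "linked V E M NL \<subseteq> M" unfolding linked_def by blast
  have NK: "NL \<subseteq> K" "NR \<subseteq> K" "v \<in> K" using v(1) unfolding NL_def NR_def K_def by blast+
  have KV: "K \<subseteq> V" using parts(1-4) unfolding K_def by blast
  have NLR: "NL \<inter> NR = {}" using cases parts by blast
  \<comment> \<open>If \<open>z\<close> missed \<open>m\<close>, then the anticomponent of
    \<open>m\<close> would miss both \<open>z\<close> and some \<open>l\<close> in
    \<open>NL\<close>. These are adjacent and on opposite sides of the complementary configuration,
    against \<open>connected_major\<close>. It serves for \<open>v\<close> and for the vertices of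
    \<open>NR\<close>.\<close>
  have linkE: "E z m" if m: "m \<in> linked V E M NL" and z: "\<And>l. l \<in> NL \<Longrightarrow> E l z \<and> (z \<in> B \<union> C \<and> l \<in> A \<union> D \<or> z \<in> A \<union> D \<and> l \<in> B \<union> C)" for m z
  proof (rule ccontr)
    assume n: "\<not> E z m"
    obtain S s l where S: "S \<subseteq> M" "m \<in> S" "conn S ?C" "s \<in> S" "l \<in> NL" "\<not> E s l" using m unfolding linked_def by blast
    have "\<not> E m z" using n sym by blast
    from U[OF S(1,3,4,2,6) this] z[OF S(5)] show False by blast
  qed
  have "loose V E F W P Q v"
    unfolding loose_def
  proof (intro conjI ballI)
    show "F \<union> W \<union> (P \<union> Q) = V" unfolding W_def P_def Q_def using F(1) M(1) NK KV lM by blast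
    show "F \<inter> W = {}" unfolding W_def by blast
    show "P \<inter> Q = {}" unfolding P_def Q_def using NLR NK M(2) lM by blast
    show "(F \<union> W) \<inter> (P \<union> Q) = {}" unfolding W_def P_def Q_def using F(2) M(3) NK lM by blast
    have "v \<in> W" unfolding W_def using v NK(3) F(2) M(2) by blast
    then show "W \<noteq> {}" "v \<in> W \<union> P" by blast+
    show "F \<noteq> {}" "P \<noteq> {}" "Q \<noteq> {}" unfolding P_def Q_def using f(1) lr by blast+
    show "\<not> E x y" if "x \<in> F" "y \<in> W" for x y
    proof (cases "y \<in> K")
      case True
      then show ?thesis using that unfolding W_def NL_def NR_def K_def by blast
    next
      case False
      then show ?thesis using FW that unfolding W_def by blast
    qed
    show "\<not> E v x" if "x \<in> F" for x using that v(1,2) sym[of v x] unfolding NL_def by blast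
    show "E v x" if "x \<in> Q" for x
      using that vN linkE[of x v] sym[of v] unfolding Q_def by blast
    show "E x y" if x: "x \<in> P" and y: "y \<in> Q" for x y
    proof (cases "x \<in> NR")
      case True
      have "E x y" if "y \<in> linked V E M NL"
        by (rule linkE[OF that]) (use LR rl True in blast)
      then show ?thesis using y LR[OF _ True] sym[of x y] unfolding Q_def by blast
    next
      case False
      then have "x \<in> M - linked V E M NL" using x unfolding P_def by blast
      then show ?thesis using y linked_unlinked[OF g M(1)] unfolding Q_def by blast
    qed
  qed
  then show ?thesis by (rule loose_balanced[OF g b])
qed

text \<open>\<open>F\<close> is the component of \<open>v0\<close> among the outside minor vertices;
  the outside vertices in \<open>M\<close> are not minor and hence major. If \<open>F\<close> sees
  only the right side, the mirror image of the configuration reduces to the case without neighbours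
  on the right.\<close>

lemma minor_vertex:
  assumes v0: "v0 \<in> V" "v0 \<notin> K" "minor v0"
  shows "balanced_skew_partition V E"
proof -
  let ?Mi = "{v \<in> V - K. minor v}"
  define M where "M = V - K - ?Mi"
  obtain F where F: "v0 \<in> F" "F \<subseteq> ?Mi" "conn F E" "\<And>u w. u \<in> F \<Longrightarrow> w \<in> ?Mi - F \<Longrightarrow> \<not> E u w"
    using conn_component[OF g, of v0 ?Mi] v0 by blast
  have F': "F \<subseteq> V" "F \<inter> K = {}" "\<And>z. z \<in> F \<Longrightarrow> minor z" "F \<noteq> {}" using F(1,2) by blast+
  have M: "M \<subseteq> V" "M \<inter> K = {}" "M \<inter> F = {}" unfolding M_def using F(2) by blast+
  have Mmaj: "major m" if "m \<in> M" for m
    using minor_or_dual_minor[of m] that unfolding M_def by blast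
  have out: "\<not> E x y" if "x \<in> F" "y \<in> V - F - (K \<union> M)" for x y
    using F(4)[OF that(1), of y] that unfolding M_def by blast
  show ?thesis
  proof (cases "(\<exists>x\<in>F. \<exists>l\<in>L. E x l) \<and> (\<exists>x\<in>F. \<exists>r\<in>R. E x r)")
    case True
    then obtain x l y r where "x \<in> F" "l \<in> L" "E x l" "y \<in> F" "r \<in> R" "E y r" by blast
    from two_sided[OF F'(1,2) F(3) F'(3) this M Mmaj out] show ?thesis .
  next
    case F0: False
    show ?thesis
    proof (cases "\<exists>x\<in>F. \<exists>r\<in>R. E x r")
      case False
      show ?thesis
      proof (rule one_sided[OF F'(1,2) F(3) F'(4) _ M Mmaj])
        show "\<not> E x y" if "x \<in> F" "y \<in> B \<union> D" for x y using False that by blast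
        show "\<not> E x y" if "x \<in> F" "y \<in> V - F - (A \<union> C \<union> M)" for x y
          using out[OF that(1), of y] that False unfolding K_def by blast
      qed
    next
      case True
      interpret s: maximal_config V E B A D C by (rule maximal_config_swap[OF maximal_config_axioms])
      have sK: "s.K = K" unfolding K_def s.K_def by blast
      have nL: "\<not> E x l" if "x \<in> F" "l \<in> L" for x l using F0 True that by blast
      interpret d: maximal_config V "compl V E" C D B A by (rule maximal_config_dual[OF maximal_config_axioms])
      interpret e: maximal_config V "compl V E" D C A B by (rule maximal_config_dual[OF s.maximal_config_axioms])
      have maj: "e.minor m" if "m \<in> M" for m
        using Mmaj[OF that] d.sym unfolding e.minor_def d.minor_def by blast
      show ?thesis
      proof (rule s.one_sided[OF F'(1) _ F(3) F'(4) _ M(1) _ M(3) maj])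
        show "F \<inter> s.K = {}" "M \<inter> s.K = {}" unfolding sK using F'(2) M(2) by blast+
        show "\<not> E x y" if "x \<in> F" "y \<in> A \<union> C" for x y using nL that by blast
        show "\<not> E x y" if "x \<in> F" "y \<in> V - F - (B \<union> D \<union> M)" for x y
          using out[OF that(1), of y] that nL unfolding K_def by blast
      qed
    qed
  qed
qed

lemma two_join_if_spanning:
  assumes "V = K"
  shows "two_join V E"
proof -
  have refl: "reach X E x x" for X x by (simp add: reach_def)
  have step: "reach X E x y" if "x \<in> X" "y \<in> X" "E x y" for X x y
    using that unfolding reach_def by (intro r_into_rtranclp) blast
  obtain a1 a2 b1 b2 where s: "sq a1 a2 b1 b2" using sq_ex .
  obtain c1 c2 d1 d2 where q: "asq c1 c2 d1 d2" using asq_ex .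
  note S = sqD[OF s] and Q = asqD[OF q]
  \<comment> \<open>A square has two distinct vertices in \<open>A\<close>, and likewise for
    \<open>C\<close>, so the clause of \<open>two_join_side\<close> on paths between single vertices
    is vacuous.\<close>
  have nA: "A \<noteq> {a}" for a using S by blast
  have nC: "C \<noteq> {c}" for c using Q by blast
  have sideI: "two_join_side V E (X \<union> Y) X Y" if h: "X \<noteq> {}" "Y \<noteq> {}" "X \<inter> Y = {}" "\<And>a. X \<noteq> {a}"
    "\<And>x. x \<in> X \<Longrightarrow> \<exists>y\<in>Y. E x y" "\<And>y. y \<in> Y \<Longrightarrow> \<exists>x\<in>X. E y x" for X Y
  proof -
    have "(\<exists>a\<in>X. reach (X \<union> Y) E x a) \<and> (\<exists>y\<in>Y. reach (X \<union> Y) E x y)" if x: "x \<in> X \<union> Y" for x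
    proof (cases "x \<in> X")
      case True
      then show ?thesis using h(5) refl step[of x "X \<union> Y"] by (meson UnCI)
    next
      case False
      then show ?thesis using x h(6) refl step[of x "X \<union> Y"] by (meson UnCI UnE)
    qed
    then show ?thesis unfolding two_join_side_def using h(1-4) by simp
  qed
  have 1: "two_join_side V E (A \<union> B) A B"
  proof (rule sideI[OF _ _ parts(5) nA])
    show "A \<noteq> {}" "B \<noteq> {}" using S by blast+
    show "\<exists>y\<in>B. E x y" if "x \<in> A" for x using nbr_A[OF that] by blast
    show "\<exists>x\<in>A. E y x" if y: "y \<in> B" for y
    proof -
      obtain x x' y' where "sq x x' y y'" using B_cover[OF y] .
      then show ?thesis using sqD sym by blast
    qed
  qed
  have 2: "two_join_side V E (C \<union> D) C D"
  proof (rule sideI[OF _ _ parts(10) nC])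
    show "C \<noteq> {}" "D \<noteq> {}" using Q by blast+
    show "\<exists>y\<in>D. E x y" if "x \<in> C" for x using nbr_C[OF that] by blast
    show "\<exists>x\<in>C. E y x" if y: "y \<in> D" for y
    proof -
      obtain x x' y' where "asq x x' y y'" using D_cover[OF y] .
      then show ?thesis using asqD sym by blast
    qed
  qed
  show ?thesis
    unfolding two_join_def
  proof (intro exI conjI ballI)
    show "(A \<union> B) \<union> (C \<union> D) = V" using assms unfolding K_def by blast
    show "(A \<union> B) \<inter> (C \<union> D) = {}" using parts(6-9) by blast
    show "two_join_side V E (A \<union> B) A B" "two_join_side V E (C \<union> D) C D" by (fact 1 2)+
    show "E x y \<longleftrightarrow> x \<in> A \<and> y \<in> C \<or> x \<in> B \<and> y \<in> D" if "x \<in> A \<union> B" "y \<in> C \<union> D" for x y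
      using that AC(1) BD(1) AD(1) BC(1) parts(5,10) by blast
  qed
qed

end

section \<open>The initial configuration, a maximal one, and the conclusion\<close>

lemma config_of_double_diamond:
  assumes g: "graph V E" and e: "embeds V E {0..<8::nat} dd_E"
  shows "\<exists>A B C D. config V E A B C D"
proof -
  obtain f where f: "inj_on f {0..<8::nat}" "f ` {0..<8} \<subseteq> V" and fe: "\<And>x y. x < 8 \<Longrightarrow> y < 8 \<Longrightarrow> E (f x) (f y) \<longleftrightarrow> dd_E x y"
    using e unfolding embeds_def by auto
  have V: "f i \<in> V" if "i < 8" for i using f(2) that by auto
  have ne: "f i = f j \<longleftrightarrow> i = j" if "i < 8" "j < 8" for i j
    using f(1) that unfolding inj_on_def by auto
  have s1: "square E (f 0) (f 1) (f 4) (f 5)"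
    unfolding square_def by (simp add: fe dd_E_def doubleton_eq_iff)
  \<comment> \<open>\<open>f 7\<close> comes before \<open>f 6\<close> because the complement joins
    \<open>f 2\<close> to \<open>f 7\<close> and \<open>f 3\<close> to \<open>f 6\<close>.\<close>
  have s2: "square (compl V E) (f 2) (f 3) (f 7) (f 6)"
    unfolding square_def compl_def by (simp add: fe dd_E_def doubleton_eq_iff V ne)
  have "config V E {f 0, f 1} {f 4, f 5} {f 2, f 3} {f 7, f 6}"
    unfolding config_def using sqconn_two[OF g s1] sqconn_two[OF graph_compl[OF g] s2]
    by (simp add: fe dd_E_def doubleton_eq_iff V ne)
  then show ?thesis by blast
qed

lemma maximal_config_exists:
  fixes V :: "'a set"
  assumes g: "graph V E" and F5: "F5 V E" and c: "config V E A B C D"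
  shows "\<exists>A B C D. maximal_config V E A B C D"
proof -
  define P where "P = (\<lambda>(A, B, C, D). config V E A B C D)"
  define m where "m = (\<lambda>(A :: 'a set, B, C, D). card (A \<union> B \<union> C \<union> D))"
  have "P (A, B, C, D)" using c by (simp add: P_def)
  moreover have "\<forall>t. P t \<longrightarrow> m t < Suc (card V)"
    using graph_finite[OF g] by (auto simp: P_def m_def config_def less_Suc_eq_le intro!: card_mono)
  ultimately obtain t where t: "P t" "\<And>t'. P t' \<Longrightarrow> m t' \<le> m t"
    using ex_has_greatest_nat[of P "(A, B, C, D)" m] by blast
  obtain A' B' C' D' where "t = (A', B', C', D')" by (cases t) auto
  then have "maximal_config V E A' B' C' D'"
    using t(1) t(2)[of "(_, _, _, _)"] g F5 by unfold_locales (simp_all add: P_def m_def)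
  then show ?thesis by blast
qed

theorem theorem14p3:
  fixes V :: "'a set" and E :: "'a \<Rightarrow> 'a \<Rightarrow> bool"
  assumes "graph V E"
    and "F5 V E"
    and "embeds V E {0..<8::nat} dd_E"
  shows "two_join V E \<or> two_join V (compl V E) \<or> balanced_skew_partition V E"
proof -
  obtain A B C D where "maximal_config V E A B C D"
    using config_of_double_diamond[OF assms(1,3)] maximal_config_exists[OF assms(1,2)] by blast
  then interpret maximal_config V E A B C D .
  interpret d: maximal_config V "compl V E" C D B A by (rule maximal_config_dual[OF maximal_config_axioms])
  show ?thesis
  proof (cases "V = K")
    case True
    then show ?thesis using two_join_if_spanning by blast
  next
    case False
    then obtain v where v: "v \<in> V" "v \<notin> K" using parts(1-4) unfolding K_def by blast
    then have vd: "v \<notin> d.K" unfolding K_def d.K_def by blast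
    show ?thesis
    proof (cases "minor v")
      case True
      then show ?thesis using minor_vertex[OF v] by blast
    next
      case False
      then have "d.minor v" using minor_or_dual_minor[OF v] by blast
      from d.minor_vertex[OF v(1) vd this] show ?thesis
        using balanced_skew_partition_compl[OF assms(1)] by blast
    qed
  qed
qed

end
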